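(* Let $F(\alpha)=\dfrac{1+e^{-\alpha}}{1+e^{-\alpha}+e^{-2\alpha}}$ for $\alpha\ge 0$. Then, uniformly for all integers $\ell$, as $N\to+\infty$, $$V_d\left(\ell,\,N+\frac{|\ell|(|\ell|+1)}{2}\right)=p(N)\,F\left(\frac{\pi|\ell|}{\sqrt{6N}}\right)\left(1+O\left(N^{-1/10}\right)\right),$$ where the implied constant is absolute (i.e. there are absolute constants $C,N_0$ such that the relative error is at most $CN^{-1/10}$ for all integers $N\ge N_0$ and all $\ell\in\mathbb{Z}$). In particular, if $m=m(N)$ is an integer with $m=o(N^{3/8})$, then as $N\to\infty$ $$\frac{V_d(m,N)}{V_d(N)}\sim \frac{1}{(24N)^{1/4}}\exp\left(-\frac{\pi m^2}{\sqrt{24N}}\right).$$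
   Context: A strongly concave composition of a nonnegative integer $n$ is a finite sequence of nonnegative integers $(a_1,\dots,a_s)$, $s\ge 1$, summing to $n$, such that for some index $k$ with $1\le k\le s$ one has $a_1>a_2>\dots>a_{k-1}>a_k<a_{k+1}<\dots<a_s$; $a_k$ is called the central part. Its rank is $s-2k+1$. $V_d(m,n)$ denotes the number of strongly concave compositions of $n$ with rank $m$, and $V_d(n)$ the total number of strongly concave compositions of $n$. $p(n)$ is the partition function, with $p(n)=0$ for negative integers $n$. *)

theory Defs
  imports "HOL-Analysis.Analysis" "HOL-Library.Landau_Symbols"
begin

(* A strongly concave composition of n with central index k (1-based):
   xs = (a_1,...,a_s), s >= 1, sum n, a_1 > ... > a_k < ... < a_s.
   a_i is xs ! (i-1). *)
definition scc_at :: "nat \<Rightarrow> nat list \<Rightarrow> nat \<Rightarrow> bool" where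
  "scc_at n xs k \<longleftrightarrow> length xs \<ge> 1 \<and> sum_list xs = n \<and> 1 \<le> k \<and> k \<le> length xs \<and>
     (\<forall>i. 1 \<le> i \<and> i < k \<longrightarrow> xs ! (i - 1) > xs ! i) \<and>
     (\<forall>i. k \<le> i \<and> i < length xs \<longrightarrow> xs ! (i - 1) < xs ! i)"

definition strongly_concave :: "nat \<Rightarrow> nat list \<Rightarrow> bool" where
  "strongly_concave n xs \<longleftrightarrow> (\<exists>k. scc_at n xs k)"

definition Vd_rank :: "int \<Rightarrow> nat \<Rightarrow> nat" where
  "Vd_rank m n = card {xs. \<exists>k. scc_at n xs k \<and>
       int (length xs) - 2 * int k + 1 = m}"

definition Vd :: "nat \<Rightarrow> nat" where
  "Vd n = card {xs. strongly_concave n xs}"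

definition partition_count :: "nat \<Rightarrow> nat" where
  "partition_count n = card {xs :: nat list. sorted (rev xs) \<and> (\<forall>x\<in>set xs. x > 0) \<and> sum_list xs = n}"

definition F_conc :: "real \<Rightarrow> real" where
  "F_conc \<alpha> = (1 + exp (-\<alpha>)) / (1 + exp (-\<alpha>) + exp (-2*\<alpha>))"

end

theory Submission
  imports Defs "HOL-Complex_Analysis.Complex_Analysis" "HOL-Probability.Distributions"
    "HOL-Real_Asymp.Real_Asymp"
begin

text \<open>
Summing over the central part, the compositions of rank \<open>l \<ge> 0\<close> with \<open>n = N + l (l + 1) / 2\<close> are
counted by \<open>\<Sum>r. q ^ (r (r + l + 1)) / ((q)_r (q)_(r + l) (1 - q ^ (2 r + l + 1)))\<close>. Comparing
this series termwise with Durfee's \<open>1 / (q)_\<infinity> = \<Sum>r. q ^ (r (r + m)) / ((q)_r (q)_(r + m))\<close>, twice,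
relates rank \<open>l\<close> to rank \<open>l + 4\<close>. Iterating gives the count as the alternating sum of the
\<open>p (N - j l - 2 j (j + 1) / 3)\<close> over \<open>j \<equiv> 0\<close> (sign \<open>+\<close>) and \<open>j \<equiv> 2\<close> (sign \<open>-\<close>) modulo 3.

The circle method gives \<open>p n = A e ^ (2 \<pi> \<surd>(n / 6)) / n * (1 + O(1 / \<surd>n))\<close>. The value of \<open>A\<close> is
irrelevant, since only the ratios \<open>p (N - x) / p N \<approx> e ^ (- a x)\<close> with \<open>a = \<pi> / \<surd>(6 N)\<close> are
needed. For \<open>u = e ^ (- a l)\<close> the alternating sum then behaves like
\<open>\<Sum>k. u ^ (3 k) - u ^ (3 k + 2) = (1 + u) / (1 + u + u ^ 2)\<close>. As it has about \<open>N ^ (1/4)\<close> terms, an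
error \<open>N ^ (-2/5)\<close> in each ratio is good enough. Finally, the number of all compositions is a sum
over ranks, where \<open>p (N - m (m + 1) / 2) / p N\<close> turns it into a Gaussian sum.
\<close>

section \<open>Infinite sums of formal power series\<close>

(* The condition is normalised so that only the terms with r \<le> n contribute to the n-th coefficient. *)
definition fps_summable :: "(nat \<Rightarrow> 'a::zero fps) \<Rightarrow> bool" where
  "fps_summable t \<longleftrightarrow> (\<forall>r n. n < r \<longrightarrow> fps_nth (t r) n = 0)"

definition fps_suminf :: "(nat \<Rightarrow> 'a::comm_monoid_add fps) \<Rightarrow> 'a fps" where
  "fps_suminf t = Abs_fps (\<lambda>n. \<Sum>r\<le>n. fps_nth (t r) n)"

lemma fps_nth_suminf:
  assumes "fps_summable t" "n \<le> R"
  shows "fps_nth (fps_suminf t) n = (\<Sum>r\<le>R. fps_nth (t r) n)"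
  unfolding fps_suminf_def fps_nth_Abs_fps
  by (rule sum.mono_neutral_left) (use assms in \<open>auto simp: fps_summable_def\<close>)

lemma fps_X_power_mult_nth_less:
  "n < k \<Longrightarrow> fps_nth (fps_X ^ k * f) n = (0 :: 'a::comm_semiring_1)"
  by (simp add: fps_X_power_mult_nth)

lemma fps_summable_X_power_mult:
  fixes f :: "nat \<Rightarrow> 'a::comm_semiring_1 fps"
  assumes "\<And>r. r \<le> e r"
  shows "fps_summable (\<lambda>r. fps_X ^ e r * f r)"
  by (simp add: fps_summable_def fps_X_power_mult_nth_less less_le_trans[OF _ assms])

lemma fps_suminf_diff:
  fixes f g :: "nat \<Rightarrow> 'a::ab_group_add fps"
  shows "fps_suminf (\<lambda>r. f r - g r) = fps_suminf f - fps_suminf g"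
  by (rule fps_ext) (simp add: fps_suminf_def sum_subtractf)

lemma fps_suminf_Suc:
  assumes "fps_summable t"
  shows "fps_suminf t = t 0 + fps_suminf (\<lambda>r. t (Suc r))"
proof (rule fps_ext)
  fix n
  have "fps_nth (fps_suminf t) n = (\<Sum>r\<le>Suc n. fps_nth (t r) n)"
    by (rule fps_nth_suminf[OF assms]) simp
  also have "\<dots> = fps_nth (t 0) n + (\<Sum>r\<le>n. fps_nth (t (Suc r)) n)"
    by (rule sum.atMost_Suc_shift)
  finally show "fps_nth (fps_suminf t) n = fps_nth (t 0 + fps_suminf (\<lambda>r. t (Suc r))) n"
    by (simp add: fps_suminf_def)
qed

lemma fps_suminf_X_power_mult:
  fixes t :: "nat \<Rightarrow> 'a::comm_semiring_1 fps"
  assumes "fps_summable t"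
  shows "fps_suminf (\<lambda>r. fps_X ^ k * t r) = fps_X ^ k * fps_suminf t"
  by (rule fps_ext)
     (simp add: fps_suminf_def[of "\<lambda>r. fps_X ^ k * t r"] fps_X_power_mult_nth
     fps_nth_suminf[OF assms diff_le_self])

definition fps_geom :: "nat \<Rightarrow> 'a::comm_ring_1 fps" where
  "fps_geom k = Abs_fps (\<lambda>n. if k dvd n then 1 else 0)"

lemma fps_geom_mult:
  assumes "0 < k"
  shows "fps_geom k * (1 - fps_X ^ k) = (1 :: 'a::comm_ring_1 fps)"
proof (rule fps_ext)
  fix n
  have "fps_nth (fps_geom k * (1 - fps_X ^ k)) n
      = fps_nth (fps_geom k) n - (if n < k then 0 else fps_nth (fps_geom k) (n - k))"
    by (simp add: right_diff_distrib fps_X_power_mult_right_nth)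
  also have "\<dots> = (if n = 0 then 1 else 0 :: 'a)"
    using assms by (auto simp: fps_geom_def dvd_imp_le dvd_minus_self)
  finally show "fps_nth (fps_geom k * (1 - fps_X ^ k)) n = fps_nth (1 :: 'a fps) n"
    by simp
qed

lemma fps_eq_geom_multI:
  fixes f g :: "'a::comm_ring_1 fps"
  assumes "0 < k" "f = g + fps_X ^ k * f"
  shows "f = fps_geom k * g"
proof -
  have "g = f * (1 - fps_X ^ k)" using assms(2) by (simp add: algebra_simps)
  then have "fps_geom k * g = f * (fps_geom k * (1 - fps_X ^ k))" by (simp only: mult_ac)
  then show ?thesis by (simp add: fps_geom_mult[OF assms(1)])
qed

lemma fps_suminf_X_power_geom:
  fixes f :: "'a::comm_ring_1 fps"
  assumes "0 < k"
  shows "fps_suminf (\<lambda>j. fps_X ^ (j * k) * f) = fps_geom k * f"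
proof (rule fps_eq_geom_multI[OF assms])
  have summable: "fps_summable (\<lambda>j. fps_X ^ (j * k) * f)"
    using assms by (intro fps_summable_X_power_mult) simp
  have "fps_suminf (\<lambda>j. fps_X ^ (j * k) * f)
      = f + fps_suminf (\<lambda>j. fps_X ^ k * (fps_X ^ (j * k) * f))"
    using fps_suminf_Suc[OF summable] by (simp add: power_add mult.assoc)
  then show "fps_suminf (\<lambda>j. fps_X ^ (j * k) * f)
      = f + fps_X ^ k * fps_suminf (\<lambda>j. fps_X ^ (j * k) * f)"
    by (simp only: fps_suminf_X_power_mult[OF summable])
qed

section \<open>Partitions with bounded parts\<close>

definition inv_qpoch :: "nat \<Rightarrow> 'a::comm_ring_1 fps" where
  "inv_qpoch m = (\<Prod>k=1..m. fps_geom k)"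

lemma inv_qpoch_0 [simp]: "inv_qpoch 0 = 1"
  by (simp add: inv_qpoch_def)

lemma inv_qpoch_Suc: "inv_qpoch (Suc m) = inv_qpoch m * fps_geom (Suc m)"
  by (simp add: inv_qpoch_def)

lemma inv_qpoch_Suc_mult: "inv_qpoch (Suc m) * (1 - fps_X ^ Suc m) = inv_qpoch m"
  unfolding inv_qpoch_Suc mult.assoc by (subst fps_geom_mult) simp_all

definition bounded_partitions :: "nat \<Rightarrow> nat \<Rightarrow> nat list set" where
  "bounded_partitions M n =
     {xs. sorted (rev xs) \<and> (\<forall>x\<in>set xs. 0 < x \<and> x \<le> M) \<and> sum_list xs = n}"

lemma length_le_sum_list: "(\<And>x. x \<in> set xs \<Longrightarrow> 0 < x) \<Longrightarrow> length xs \<le> sum_list (xs :: nat list)"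
proof (induction xs)
  case (Cons a xs)
  then have "length xs \<le> sum_list xs" "0 < a" by simp_all
  then show ?case by simp
qed simp

lemma finite_lists_sum_le: "finite {xs :: nat list. (\<forall>x\<in>set xs. 0 < x) \<and> sum_list xs \<le> n}"
proof (rule finite_subset)
  show "{xs :: nat list. (\<forall>x\<in>set xs. 0 < x) \<and> sum_list xs \<le> n}
      \<subseteq> {xs. set xs \<subseteq> {..n} \<and> length xs \<le> n}"
    using length_le_sum_list by (fastforce dest: member_le_sum_list)
  show "finite {xs. set xs \<subseteq> {..n} \<and> length xs \<le> n}"
    by (rule finite_lists_length_le) simp
qed

lemma finite_bounded_partitions: "finite (bounded_partitions M n)"
  by (rule finite_subset[OF _ finite_lists_sum_le[of n]]) (auto simp: bounded_partitions_def)

lemma bounded_partitions_0: "bounded_partitions 0 n = (if n = 0 then {[]} else {})"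
proof -
  have "xs = []" if "\<forall>x\<in>set xs. 0 < x \<and> x \<le> (0::nat)" for xs
    using that by (cases xs) auto
  then have "bounded_partitions 0 n \<subseteq> {[]}"
    by (auto simp: bounded_partitions_def)
  then show ?thesis by (auto simp: bounded_partitions_def)
qed

lemma bounded_partitions_Suc:
  "bounded_partitions (Suc M) n = bounded_partitions M n \<union>
     (if Suc M \<le> n then (#) (Suc M) ` bounded_partitions (Suc M) (n - Suc M) else {})"
  (is "?L = ?A \<union> ?B")
proof (intro equalityI subsetI)
  fix xs assume xs: "xs \<in> ?L"
  show "xs \<in> ?A \<union> ?B"
  proof (cases xs)
    case Nil
    then show ?thesis using xs by (auto simp: bounded_partitions_def)
  next
    case (Cons y ys)
    show ?thesis
    proof (cases "y = Suc M")
      case True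
      then have "ys \<in> bounded_partitions (Suc M) (n - Suc M)" "Suc M \<le> n"
        using xs Cons by (auto simp: bounded_partitions_def sorted_append)
      then show ?thesis using True Cons by auto
    next
      case False
      then have "\<forall>x\<in>set xs. x \<le> M"
        using xs Cons by (fastforce simp: bounded_partitions_def sorted_append)
      then show ?thesis using xs by (auto simp: bounded_partitions_def)
    qed
  qed
next
  fix xs assume "xs \<in> ?A \<union> ?B"
  then show "xs \<in> ?L"
    by (fastforce simp: bounded_partitions_def sorted_append split: if_splits)
qed

lemma card_bounded_partitions_Suc:
  "card (bounded_partitions (Suc M) n) = card (bounded_partitions M n) +
     (if Suc M \<le> n then card (bounded_partitions (Suc M) (n - Suc M)) else 0)"
proof (cases "Suc M \<le> n")
  case True
  have "Suc M # xs \<notin> bounded_partitions M n" for xs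
    by (simp add: bounded_partitions_def)
  then have "bounded_partitions M n \<inter> (#) (Suc M) ` bounded_partitions (Suc M) (n - Suc M) = {}"
    by blast
  then show ?thesis
    using True by (subst bounded_partitions_Suc)
      (simp add: card_Un_disjoint finite_bounded_partitions card_image)
qed (subst bounded_partitions_Suc, simp)

lemma Abs_fps_card_bounded_partitions:
  "Abs_fps (\<lambda>n. of_nat (card (bounded_partitions M n))) = (inv_qpoch M :: 'a::comm_ring_1 fps)"
proof (induction M)
  case 0
  show ?case by (rule fps_ext) (simp add: bounded_partitions_0)
next
  case (Suc M)
  have "Abs_fps (\<lambda>n. of_nat (card (bounded_partitions (Suc M) n))) =
      fps_geom (Suc M) * (Abs_fps (\<lambda>n. of_nat (card (bounded_partitions M n))) :: 'a fps)"
    by (rule fps_eq_geom_multI, simp, rule fps_ext, simp only: fps_nth_Abs_fps,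
        subst card_bounded_partitions_Suc) (simp add: fps_X_power_mult_nth del: power_Suc)
  then show ?case by (simp only: Suc inv_qpoch_Suc mult.commute)
qed

lemma inv_qpoch_nth: "fps_nth (inv_qpoch M) n = of_nat (card (bounded_partitions M n))"
  by (simp flip: Abs_fps_card_bounded_partitions)

lemma card_bounded_partitions_eq:
  assumes "n \<le> M"
  shows "card (bounded_partitions M n) = partition_count n"
proof -
  have "x \<le> M" if "x \<in> set xs" "sum_list xs = n" for x and xs :: "nat list"
    using member_le_sum_list[OF that(1)] that(2) assms by simp
  then have "bounded_partitions M n
      = {xs :: nat list. sorted (rev xs) \<and> (\<forall>x\<in>set xs. x > 0) \<and> sum_list xs = n}"
    unfolding bounded_partitions_def by blast
  then show ?thesis by (simp add: partition_count_def)
qed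

lemma card_bounded_partitions_le: "card (bounded_partitions M n) \<le> partition_count n"
proof -
  have "bounded_partitions M n \<subseteq> bounded_partitions (max M n) n"
    by (auto simp: bounded_partitions_def)
  then have "card (bounded_partitions M n) \<le> card (bounded_partitions (max M n) n)"
    by (rule card_mono[OF finite_bounded_partitions])
  then show ?thesis by (simp add: card_bounded_partitions_eq)
qed

lemma partition_count_pos: "0 < partition_count n"
proof -
  have "replicate n 1 \<in> bounded_partitions n n"
    by (auto simp: bounded_partitions_def sum_list_replicate)
  then have "0 < card (bounded_partitions n n)"
    using finite_bounded_partitions by (metis card_gt_0_iff empty_iff)
  then show ?thesis by (simp add: card_bounded_partitions_eq)
qed

definition partition_fps :: "'a::comm_ring_1 fps" where
  "partition_fps = Abs_fps (\<lambda>n. of_nat (partition_count n))"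

lemma partition_fps_nth: "fps_nth partition_fps n = of_nat (partition_count n)"
  by (simp add: partition_fps_def)

section \<open>Durfee's identity\<close>

definition durfee_term :: "nat \<Rightarrow> nat \<Rightarrow> 'a::comm_ring_1 fps" where
  "durfee_term m r = fps_X ^ (r * (r + m)) * inv_qpoch r * inv_qpoch (r + m)"

lemma fps_summable_durfee_term: "fps_summable (durfee_term m :: nat \<Rightarrow> 'a::comm_ring_1 fps)"
  unfolding durfee_term_def[abs_def] mult.assoc by (rule fps_summable_X_power_mult) simp

definition durfee_diff_pos :: "nat \<Rightarrow> nat \<Rightarrow> 'a::comm_ring_1 fps" where
  "durfee_diff_pos m r =
     fps_X ^ (r * (r + m)) * (if r = 0 then 0 else inv_qpoch (r - 1)) * inv_qpoch (Suc (r + m))"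

definition durfee_diff_neg :: "nat \<Rightarrow> nat \<Rightarrow> 'a::comm_ring_1 fps" where
  "durfee_diff_neg m r = fps_X ^ (r * (r + m) + r + m + 1) * inv_qpoch r * inv_qpoch (Suc (r + m))"

lemma durfee_term_diff:
  "durfee_term m r - durfee_term (Suc m) r
  = (durfee_diff_pos m r - durfee_diff_neg m r :: 'a::comm_ring_1 fps)"
proof (cases r)
  case 0
  then show ?thesis using inv_qpoch_Suc_mult[of m, where 'a = 'a]
    by (simp add: durfee_term_def durfee_diff_pos_def durfee_diff_neg_def algebra_simps
        del: power_Suc)
next
  case (Suc r')
  let ?X = "fps_X :: 'a fps"
  define common where "common = ?X ^ (r * (r + m)) * inv_qpoch r * inv_qpoch (Suc (r + m))"
  have "durfee_term m r = common * (1 - ?X ^ Suc (r + m))"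
    unfolding durfee_term_def common_def
    by (subst inv_qpoch_Suc_mult[symmetric]) (simp only: mult_ac)
  moreover have "durfee_term (Suc m) r = common * ?X ^ r"
    unfolding durfee_term_def common_def by (simp add: mult_ac power_add)
  moreover have "durfee_diff_pos m r = common * (1 - ?X ^ r)"
    unfolding durfee_diff_pos_def common_def Suc diff_Suc_1
    by (subst inv_qpoch_Suc_mult[of r', symmetric])
        (simp add: mult_ac del: power_Suc mult_Suc mult_Suc_right)
  moreover have "durfee_diff_neg m r = common * ?X ^ Suc (r + m)"
    unfolding durfee_diff_neg_def common_def by (simp add: power_add mult_ac)
  ultimately show ?thesis by (simp add: right_diff_distrib)
qed

lemma durfee_diff_shift:
  "durfee_diff_neg m r - durfee_diff_pos m (Suc r)
     = (fps_X ^ (m + 1) * (durfee_term (Suc m) r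
       - durfee_term (Suc (Suc m)) r) :: 'a::comm_ring_1 fps)"
proof -
  let ?X = "fps_X :: 'a fps"
  define common where
    "common = ?X ^ (r * (r + m) + r + m + 1) * inv_qpoch r * inv_qpoch (Suc (Suc (r + m)))"
  have "durfee_diff_neg m r = common * (1 - ?X ^ Suc (Suc (r + m)))"
    unfolding durfee_diff_neg_def common_def
    by (subst inv_qpoch_Suc_mult[of "Suc (r + m)", symmetric]) (simp only: mult_ac)
  moreover have "durfee_diff_pos m (Suc r) = common * ?X ^ r"
    unfolding durfee_diff_pos_def common_def by (simp add: mult_ac power_add)
  moreover have "?X ^ (m + 1) * durfee_term (Suc m) r = common * (1 - ?X ^ Suc (Suc (r + m)))"
    unfolding durfee_term_def common_def add_Suc_right
    by (subst inv_qpoch_Suc_mult[of "Suc (r + m)", symmetric]) (simp add: mult_ac power_add)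
  moreover have "?X ^ (m + 1) * durfee_term (Suc (Suc m)) r = common * ?X ^ r"
    unfolding durfee_term_def common_def by (simp add: mult_ac power_add)
  ultimately show ?thesis by (simp only: right_diff_distrib)
qed

lemma fps_suminf_durfee_diff:
  "fps_suminf (durfee_term m) - fps_suminf (durfee_term (Suc m)) =
     (- (fps_X ^ (m + 1) * (fps_suminf (durfee_term (Suc m))
       - fps_suminf (durfee_term (Suc (Suc m)))))
       :: 'a::comm_ring_1 fps)"
proof -
  let ?d = "durfee_term :: nat \<Rightarrow> nat \<Rightarrow> 'a fps"
  have diff_summable: "fps_summable (\<lambda>r. ?d (Suc m) r - ?d (Suc (Suc m)) r)"
    using fps_summable_durfee_term[of "Suc m", where 'a = 'a]
        fps_summable_durfee_term[of "Suc (Suc m)", where 'a = 'a]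
    by (simp add: fps_summable_def)
  have pos_summable: "fps_summable (durfee_diff_pos m :: nat \<Rightarrow> 'a fps)"
    unfolding durfee_diff_pos_def[abs_def] mult.assoc by (rule fps_summable_X_power_mult) simp
  have "fps_suminf (?d m) - fps_suminf (?d (Suc m))
      = fps_suminf (durfee_diff_pos m) - fps_suminf (durfee_diff_neg m)"
    by (simp add: durfee_term_diff flip: fps_suminf_diff)
  also have "fps_suminf (durfee_diff_pos m :: nat \<Rightarrow> 'a fps)
      = fps_suminf (\<lambda>r. durfee_diff_pos m (Suc r))"
    by (subst fps_suminf_Suc[OF pos_summable]) (simp add: durfee_diff_pos_def)
  also have "\<dots> - fps_suminf (durfee_diff_neg m)
      = - fps_suminf (\<lambda>r. durfee_diff_neg m r - durfee_diff_pos m (Suc r) :: 'a fps)"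
    by (simp add: fps_suminf_diff)
  also have "\<dots> = - (fps_X ^ (m + 1) * (fps_suminf (?d (Suc m)) - fps_suminf (?d (Suc (Suc m)))))"
    unfolding durfee_diff_shift fps_suminf_X_power_mult[OF diff_summable]
    by (simp add: fps_suminf_diff)
  finally show ?thesis .
qed

(* By the previous lemma, the difference of two consecutive sums is divisible by every power of X. *)
lemma fps_suminf_durfee_Suc:
  "fps_suminf (durfee_term (Suc m)) = (fps_suminf (durfee_term m) :: 'a::comm_ring_1 fps)"
proof (rule fps_ext)
  define delta :: "nat \<Rightarrow> 'a fps"
    where "delta m = fps_suminf (durfee_term m) - fps_suminf (durfee_term (Suc m))" for m
  have delta_rec: "delta m = - (fps_X ^ (m + 1) * delta (Suc m))" for m
    unfolding delta_def by (rule fps_suminf_durfee_diff)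
  have "fps_nth (delta m) n = 0" for n
  proof (induction n arbitrary: m rule: less_induct)
    case (less n)
    then show ?case by (subst delta_rec) (simp add: fps_X_power_mult_nth del: power_Suc)
  qed
  then show "fps_nth (fps_suminf (durfee_term (Suc m))) n
      = fps_nth (fps_suminf (durfee_term m) :: 'a fps) n" for n
    by (simp add: delta_def)
qed

theorem durfee_identity: "fps_suminf (durfee_term m) = (partition_fps :: 'a::comm_ring_1 fps)"
proof (rule fps_ext)
  fix n
  have shift: "fps_suminf (durfee_term m) = (fps_suminf (durfee_term (m + k)) :: 'a fps)" for k
    by (induction k) (simp_all add: fps_suminf_durfee_Suc)
  have vanish: "fps_nth (durfee_term (m + n) r :: 'a fps) n = 0" if "0 < r" for r
    unfolding durfee_term_def mult.assoc
  proof (rule fps_X_power_mult_nth_less)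
    show "n < r * (r + (m + n))" using that by (cases r) auto
  qed
  have "fps_nth (fps_suminf (durfee_term m) :: 'a fps) n
      = (\<Sum>r\<le>n. fps_nth (durfee_term (m + n) r) n)"
    by (subst shift[of n]) (simp add: fps_suminf_def)
  also have "\<dots> = (\<Sum>r\<in>{0}. fps_nth (durfee_term (m + n) r) n)"
    by (rule sum.mono_neutral_right) (auto simp: vanish)
  also have "\<dots> = fps_nth partition_fps n"
    by (simp add: durfee_term_def inv_qpoch_nth card_bounded_partitions_eq partition_fps_nth)
  finally show "fps_nth (fps_suminf (durfee_term m)) n = fps_nth (partition_fps :: 'a fps) n" .
qed

section \<open>The false theta expansion\<close>

(* For d = 1 these are the terms of the rank generating function (see \<open>Vd_rank_eq_nth\<close>); d = 2 is
   the companion series that the comparison with Durfee's identity produces. *)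
definition concave_term :: "nat \<Rightarrow> nat \<Rightarrow> nat \<Rightarrow> 'a::comm_ring_1 fps" where
  "concave_term d m r =
     fps_X ^ (r * (r + m + d)) * inv_qpoch r * inv_qpoch (r + m) * fps_geom (2 * r + m + 1)"

definition concave_fps :: "nat \<Rightarrow> nat \<Rightarrow> 'a::comm_ring_1 fps" where
  "concave_fps d m = fps_suminf (concave_term d m)"

lemma fps_summable_concave_term:
  assumes "0 < d"
  shows "fps_summable (concave_term d m :: nat \<Rightarrow> 'a::comm_ring_1 fps)"
  unfolding concave_term_def[abs_def] mult.assoc
  by (rule fps_summable_X_power_mult) (use assms in simp)

lemma concave_term_0: "concave_term d m 0 = (durfee_term (m + 1) 0 :: 'a::comm_ring_1 fps)"
  by (simp add: concave_term_def durfee_term_def inv_qpoch_Suc)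

definition concave_common :: "nat \<Rightarrow> nat \<Rightarrow> 'a::comm_ring_1 fps" where
  "concave_common m r = fps_X ^ (Suc r * (r + m + 2)) * inv_qpoch (Suc r)
     * inv_qpoch (Suc (Suc (r + m))) * fps_geom (2 * r + m + 3)"

lemma durfee_term_eq_common:
  "durfee_term (m + 1) (Suc r) =
     (concave_common m r * (1 - fps_X ^ Suc r * fps_X ^ Suc (Suc (r + m))) :: 'a::comm_ring_1 fps)"
proof -
  have "2 * r + m + 3 = Suc r + Suc (Suc (r + m))" by simp
  then have power_eq: "fps_X ^ (2 * r + m + 3)
      = (fps_X ^ Suc r * fps_X ^ Suc (Suc (r + m)) :: 'a fps)"
    by (simp only: power_add)
  have geom: "fps_geom (2 * r + m + 3) * (1 - fps_X ^ Suc r * fps_X ^ Suc (Suc (r + m)))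
      = (1 :: 'a fps)"
    unfolding power_eq[symmetric] by (rule fps_geom_mult) simp
  have "durfee_term (m + 1) (Suc r) = durfee_term (m + 1) (Suc r)
      * (fps_geom (2 * r + m + 3) * (1 - fps_X ^ Suc r * fps_X ^ Suc (Suc (r + m))) :: 'a fps)"
    by (simp only: geom mult_1_right)
  also have "\<dots> = concave_common m r * (1 - fps_X ^ Suc r * fps_X ^ Suc (Suc (r + m)))"
    unfolding durfee_term_def concave_common_def by (simp add: mult_ac)
  finally show ?thesis .
qed

lemma concave_term_eq_common:
  fixes m r :: nat
  defines "a \<equiv> fps_X ^ Suc r :: 'a::comm_ring_1 fps" and "b \<equiv> fps_X ^ Suc (Suc (r + m))"
  shows "concave_term 1 m (Suc r) = concave_common m r * (1 - b)"
    and "concave_term 2 m (Suc r) = concave_common m r * ((1 - b) * a)"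
    and "fps_X ^ (2 * m + 4) * concave_term 2 (m + 2) r = concave_common m r * (b * (1 - a))"
    and "fps_X ^ (m + 2) * concave_term 1 (m + 2) r = concave_common m r * (1 - a)"
proof -
  have inv_Suc: "inv_qpoch (Suc (r + m)) = inv_qpoch (Suc (Suc (r + m))) * (1 - b)"
    "inv_qpoch r = inv_qpoch (Suc r) * (1 - a)"
    unfolding a_def b_def by (rule inv_qpoch_Suc_mult[symmetric])+
  show "concave_term 1 m (Suc r) = concave_common m r * (1 - b)"
    unfolding concave_term_def concave_common_def
    by (simp add: inv_Suc(1) mult_ac eval_nat_numeral del: power_Suc)
  have "Suc r * (Suc r + m + 2) = Suc r * (r + m + 2) + Suc r" by simp
  then show "concave_term 2 m (Suc r) = concave_common m r * ((1 - b) * a)"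
    unfolding concave_term_def concave_common_def
    by (simp only: inv_Suc(1) a_def power_add) (simp add: inv_Suc(1) mult_ac eval_nat_numeral)
  have "2 * m + 4 + r * (r + (m + 2) + 2) = Suc r * (r + m + 2) + Suc (Suc (r + m))" by simp
  then show "fps_X ^ (2 * m + 4) * concave_term 2 (m + 2) r = concave_common m r * (b * (1 - a))"
    unfolding concave_term_def concave_common_def mult.assoc[symmetric] power_add[symmetric]
    by (simp only: inv_Suc(2) b_def power_add) (simp add: mult_ac eval_nat_numeral)
  have "m + 2 + r * (r + (m + 2) + 1) = Suc r * (r + m + 2)" by simp
  then show "fps_X ^ (m + 2) * concave_term 1 (m + 2) r = concave_common m r * (1 - a)"
    unfolding concave_term_def concave_common_def mult.assoc[symmetric] power_add[symmetric]
    by (simp only: inv_Suc(2)) (simp add: mult_ac eval_nat_numeral)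
qed

lemma concave_term_Suc:
  shows "concave_term 1 m (Suc r) =
      (durfee_term (m + 1) (Suc r)
        - fps_X ^ (2 * m + 4) * concave_term 2 (m + 2) r :: 'a::comm_ring_1 fps)"
    and "concave_term 2 m (Suc r) =
      (durfee_term (m + 1) (Suc r)
        - fps_X ^ (m + 2) * concave_term 1 (m + 2) r :: 'a::comm_ring_1 fps)"
  by (simp_all only: durfee_term_eq_common concave_term_eq_common) (simp_all add: algebra_simps)

lemma fps_suminf_eq_partition_fps_diff:
  fixes f g :: "nat \<Rightarrow> 'a::comm_ring_1 fps"
  assumes "f 0 = durfee_term m 0" "\<And>r. f (Suc r) = durfee_term m (Suc r) - fps_X ^ e * g r"
    and "fps_summable f" "fps_summable g"
  shows "fps_suminf f = partition_fps - fps_X ^ e * fps_suminf g"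
proof -
  have "fps_suminf f = durfee_term m 0 + fps_suminf (\<lambda>r. durfee_term m (Suc r) - fps_X ^ e * g r)"
    by (subst fps_suminf_Suc[OF assms(3)]) (simp add: assms(1,2))
  also have "\<dots> = (durfee_term m 0 + fps_suminf (\<lambda>r. durfee_term m (Suc r)))
      - fps_X ^ e * fps_suminf g"
    by (simp add: fps_suminf_diff fps_suminf_X_power_mult[OF assms(4)])
  also have "durfee_term m 0 + fps_suminf (\<lambda>r. durfee_term m (Suc r)) = (partition_fps :: 'a fps)"
    by (simp add: durfee_identity flip: fps_suminf_Suc[OF fps_summable_durfee_term])
  finally show ?thesis .
qed

lemma concave_fps_rec:
  shows "concave_fps 1 m = (partition_fps
      - fps_X ^ (2 * m + 4) * concave_fps 2 (m + 2) :: 'a::comm_ring_1 fps)"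
    and "concave_fps 2 m = (partition_fps
        - fps_X ^ (m + 2) * concave_fps 1 (m + 2) :: 'a::comm_ring_1 fps)"
  unfolding concave_fps_def
  by (rule fps_suminf_eq_partition_fps_diff[OF concave_term_0 concave_term_Suc(1)]
           fps_suminf_eq_partition_fps_diff[OF concave_term_0 concave_term_Suc(2)];
      simp add: fps_summable_concave_term)+

(* The division by 3 is exact precisely for j congruent to 0 or 2 modulo 3. *)
definition theta_exponent :: "nat \<Rightarrow> nat \<Rightarrow> nat" where
  "theta_exponent l j = j * l + 2 * j * (j + 1) div 3"

lemma theta_exponent_simps:
  "theta_exponent l (3 * k) = 3 * k * l + (6 * k\<^sup>2 + 2 * k)"
  "theta_exponent l (3 * k + 2) = (3 * k + 2) * l + (6 * k\<^sup>2 + 10 * k + 4)"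
proof -
  have "2 * (3 * k) * (3 * k + 1) = 3 * (6 * k\<^sup>2 + 2 * k)"
    "2 * (3 * k + 2) * (3 * k + 2 + 1) = 3 * (6 * k\<^sup>2 + 10 * k + 4)"
    by (simp_all add: power2_eq_square algebra_simps)
  then show "theta_exponent l (3 * k) = 3 * k * l + (6 * k\<^sup>2 + 2 * k)"
    "theta_exponent l (3 * k + 2) = (3 * k + 2) * l + (6 * k\<^sup>2 + 10 * k + 4)"
    by (simp_all only: theta_exponent_def nonzero_mult_div_cancel_left)
qed

definition false_theta_sum :: "(nat \<Rightarrow> 'a::ab_group_add) \<Rightarrow> nat set \<Rightarrow> 'a" where
  "false_theta_sum f A = (\<Sum>k\<in>A. f (3 * k) - f (3 * k + 2))"

lemma concave_fps_false_theta:
  "concave_fps 1 l = false_theta_sum (\<lambda>j. fps_X ^ theta_exponent l j) {..<K} * partition_fps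
     + fps_X ^ theta_exponent l (3 * K) * (concave_fps 1 (l + 4 * K) :: 'a::comm_ring_1 fps)"
proof (induction K)
  case 0
  show ?case by (simp add: theta_exponent_def false_theta_sum_def)
next
  case (Suc K)
  let ?X = "fps_X :: 'a fps"
  let ?m = "l + 4 * K"
  have shifts: "theta_exponent l (3 * K + 2) = theta_exponent l (3 * K) + (2 * ?m + 4)"
    "theta_exponent l (3 * Suc K) = theta_exponent l (3 * K) + ((2 * ?m + 4) + (?m + 4))"
    unfolding theta_exponent_simps by (simp_all add: power2_eq_square algebra_simps)
  define a b t where "a = ?X ^ (2 * ?m + 4)" and "b = ?X ^ (?m + 4)"
    and "t = ?X ^ theta_exponent l (3 * K)"
  have "?m + 2 + 2 = ?m + 4" by simp
  then have "concave_fps 1 ?m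
      = partition_fps - a * (partition_fps - b * concave_fps 1 (l + 4 * Suc K))"
    using concave_fps_rec(1)[of ?m, where 'a = 'a] concave_fps_rec(2)[of "?m + 2", where 'a = 'a]
    by (simp only: a_def b_def mult_Suc_right add.assoc add.commute[of 4])
  then have "t * concave_fps 1 ?m =
      (t - t * a) * partition_fps + t * (a * b) * concave_fps 1 (l + 4 * Suc K)"
    by (simp only:) (simp add: algebra_simps)
  then have "t * concave_fps 1 ?m =
      (t - ?X ^ theta_exponent l (3 * K + 2)) * partition_fps
      + ?X ^ theta_exponent l (3 * Suc K) * concave_fps 1 (l + 4 * Suc K)"
    by (simp only: shifts power_add a_def b_def t_def)
  then show ?case
    using Suc by (simp only: false_theta_sum_def sum.lessThan_Suc distrib_right add.assoc t_def)
qed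

section \<open>Strictly increasing lists\<close>

definition incr_lists :: "nat \<Rightarrow> nat \<Rightarrow> nat \<Rightarrow> nat list set" where
  "incr_lists r c n = {xs. sorted_wrt (<) (c # xs) \<and> length xs = r \<and> sum_list xs = n}"

lemma finite_incr_lists: "finite (incr_lists r c n)"
  by (rule finite_subset[OF _ finite_lists_sum_le[of n]]) (auto simp: incr_lists_def)

lemma incr_lists_0: "incr_lists 0 c n = (if n = 0 then {[]} else {})"
  by (auto simp: incr_lists_def)

lemma incr_lists_map_Suc:
  "incr_lists r (Suc c) n = (if r \<le> n then map Suc ` incr_lists r c (n - r) else {})"
proof (cases "r \<le> n")
  case True
  have sum: "sum_list (map Suc xs) = sum_list xs + length xs" for xs
    by (induction xs) auto
  have "xs \<in> map Suc ` incr_lists r c (n - r)" if "xs \<in> incr_lists r (Suc c) n" for xs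
  proof
    have pos: "\<forall>x\<in>set xs. Suc c < x" using that by (simp add: incr_lists_def)
    then have "map (Suc \<circ> (\<lambda>x. x - 1)) xs = map id xs"
      by (intro map_cong) auto
    then show eq: "xs = map Suc (map (\<lambda>x. x - 1) xs)" by simp
    have "sum_list (map (\<lambda>x. x - 1) xs) + length xs = sum_list xs"
      using sum[of "map (\<lambda>x. x - 1) xs"] eq by simp
    moreover have "sorted_wrt (<) (map (\<lambda>x. x - 1) xs)"
      unfolding sorted_wrt_map
      by (rule sorted_wrt_mono_rel[of _ "(<)"]) (use pos that in \<open>auto simp: incr_lists_def\<close>)
    ultimately show "map (\<lambda>x. x - 1) xs \<in> incr_lists r c (n - r)"
      using that by (fastforce simp: incr_lists_def)
  qed
  moreover have "map Suc xs \<in> incr_lists r (Suc c) n" if "xs \<in> incr_lists r c (n - r)" for xs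
    using that True by (simp add: incr_lists_def sum sorted_wrt_map)
  ultimately show ?thesis using True by auto
next
  case False
  have "length xs \<le> sum_list xs" if "\<forall>x\<in>set xs. Suc c < x" for xs
    by (rule length_le_sum_list) (use that in auto)
  then show ?thesis using False by (auto simp: incr_lists_def)
qed

lemma card_incr_lists_map_Suc:
  "card (incr_lists r (Suc c) n) = (if r \<le> n then card (incr_lists r c (n - r)) else 0)"
proof -
  have "inj_on (map Suc) A" for A
    by (rule inj_on_subset[OF inj_mapI[OF inj_Suc]]) simp
  then show ?thesis by (simp add: incr_lists_map_Suc card_image)
qed

lemma incr_lists_Suc:
  "incr_lists (Suc r) c n = incr_lists (Suc r) (Suc c) n \<union>
     (if Suc c \<le> n then (#) (Suc c) ` incr_lists r (Suc c) (n - Suc c) else {})"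
  (is "?L = ?A \<union> ?B")
proof (intro equalityI subsetI)
  fix xs assume xs: "xs \<in> ?L"
  then obtain y ys where y: "xs = y # ys" by (cases xs) (auto simp: incr_lists_def)
  show "xs \<in> ?A \<union> ?B"
  proof (cases "y = Suc c")
    case True
    then have "Suc c \<le> n" "ys \<in> incr_lists r (Suc c) (n - Suc c)"
      using xs by (auto simp: incr_lists_def y)
    then show ?thesis by (simp add: y True)
  next
    case False
    then have "Suc c < y" using xs by (simp add: incr_lists_def y)
    then have "xs \<in> ?A" using xs by (fastforce simp: incr_lists_def y)
    then show ?thesis by simp
  qed
next
  fix xs assume "xs \<in> ?A \<union> ?B"
  then show "xs \<in> ?L"
    by (fastforce simp: incr_lists_def split: if_splits)
qed

lemma card_incr_lists_Suc:
  "card (incr_lists (Suc r) c n) = card (incr_lists (Suc r) (Suc c) n) +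
     (if Suc c \<le> n then card (incr_lists r (Suc c) (n - Suc c)) else 0)"
proof (cases "Suc c \<le> n")
  case True
  have "Suc c # xs \<notin> incr_lists (Suc r) (Suc c) n" for xs
    by (simp add: incr_lists_def)
  then have "incr_lists (Suc r) (Suc c) n \<inter> (#) (Suc c) ` incr_lists r (Suc c) (n - Suc c) = {}"
    by blast
  then show ?thesis
    using True by (subst incr_lists_Suc) (simp add: card_Un_disjoint finite_incr_lists card_image)
qed (subst incr_lists_Suc, simp)

definition incr_fps :: "nat \<Rightarrow> nat \<Rightarrow> 'a::comm_ring_1 fps" where
  "incr_fps r c = Abs_fps (\<lambda>n. of_nat (card (incr_lists r c n)))"

lemma incr_fps_0: "incr_fps 0 c = 1"
  by (rule fps_ext) (simp add: incr_fps_def incr_lists_0)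

lemma incr_fps_Suc_right: "incr_fps r (Suc c) = fps_X ^ r * incr_fps r c"
  by (rule fps_ext) (auto simp: incr_fps_def fps_X_power_mult_nth card_incr_lists_map_Suc)

lemma incr_fps_Suc:
  "incr_fps (Suc r) c = incr_fps (Suc r) (Suc c) + fps_X ^ Suc c * incr_fps r (Suc c)"
  by (rule fps_ext)
     (simp only: incr_fps_def fps_add_nth fps_X_power_mult_nth fps_nth_Abs_fps
     card_incr_lists_Suc[of r c] of_nat_add, auto)

lemma incr_fps_eq:
  "incr_fps r c = (fps_X ^ (r * c + triangle r) * inv_qpoch r :: 'a::comm_ring_1 fps)"
proof (induction r)
  case 0
  show ?case by (simp add: incr_fps_0)
next
  case (Suc r)
  have exponent: "Suc c + r + (r * c + triangle r) = Suc r * c + triangle (Suc r)"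
    by simp
  have "incr_fps (Suc r) c =
      fps_geom (Suc r) * (fps_X ^ Suc c * (fps_X ^ r * incr_fps r c) :: 'a fps)"
    using incr_fps_Suc[of r c, where 'a = 'a]
    by (intro fps_eq_geom_multI) (simp_all only: incr_fps_Suc_right add.commute zero_less_Suc)
  also have "\<dots> = fps_X ^ (Suc c + r + (r * c + triangle r)) * inv_qpoch (Suc r)"
    by (simp only: Suc inv_qpoch_Suc power_add mult_ac)
  finally show ?case by (simp only: exponent)
qed

section \<open>Strongly concave compositions as triples\<close>

definition concave_triples :: "nat \<Rightarrow> (nat list \<times> nat \<times> nat list) set" where
  "concave_triples n = {(L, c, R). sorted_wrt (<) (c # L) \<and> sorted_wrt (<) (c # R) \<and>
     sum_list L + c + sum_list R = n}"

definition triple_list :: "nat list \<times> nat \<times> nat list \<Rightarrow> nat list" where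
  "triple_list = (\<lambda>(L, c, R). rev L @ c # R)"

definition triple_rank :: "nat list \<times> nat \<times> nat list \<Rightarrow> int" where
  "triple_rank = (\<lambda>(L, c, R). int (length R) - int (length L))"

lemma inj_on_triple_list: "inj_on triple_list (concave_triples n)"
proof (rule inj_onI)
  fix t t'
  assume tt: "t \<in> concave_triples n" "t' \<in> concave_triples n" "triple_list t = triple_list t'"
  obtain L c R L' c' R' where t: "t = (L, c, R)" "t' = (L', c', R')" by (metis prod_cases3)
  have *: "(L, c, R) \<in> concave_triples n" "(L', c', R') \<in> concave_triples n"
    and eq: "triple_list (L, c, R) = triple_list (L', c', R')"
    using tt by (simp_all add: t)
  have eq': "rev L @ c # R = rev L' @ c' # R'" using eq by (simp add: triple_list_def)
  have gt: "\<forall>x\<in>set L \<union> set R. c < x" "\<forall>x\<in>set L' \<union> set R'. c' < x"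
    using * by (auto simp: concave_triples_def)
  have sets: "insert c (set L \<union> set R) = insert c' (set L' \<union> set R')"
    using arg_cong[OF eq', of set] by auto
  have c: "c = c'"
  proof (rule ccontr)
    assume "c \<noteq> c'"
    then have "c \<in> set L' \<union> set R'" "c' \<in> set L \<union> set R" using sets by (metis insertE insertI1)+
    then show False using gt by (meson less_asym)
  qed
  have notin: "c \<notin> set (rev L)" "c \<notin> set (rev L')" using gt c by auto
  have "rev L = takeWhile (\<lambda>x. x \<noteq> c) (rev L @ c # R)"
    using notin by (subst takeWhile_append2) auto
  moreover have "rev L' = takeWhile (\<lambda>x. x \<noteq> c) (rev L' @ c # R')"
    using notin by (subst takeWhile_append2) auto
  ultimately have "rev L = rev L'" using eq' c by simp
  then show "t = t'" using eq' c t by simp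
qed

lemma sorted_wrt_less_iff_nth:
  "sorted_wrt (<) (xs :: nat list) \<longleftrightarrow> (\<forall>i. Suc i < length xs \<longrightarrow> xs ! i < xs ! Suc i)"
  by (rule sorted_wrt_iff_nth_Suc_transp) simp

lemma scc_at_imp_concave_triple:
  assumes "scc_at n xs k"
  obtains L c R
    where "(L, c, R) \<in> concave_triples n" "xs = triple_list (L, c, R)" "k = Suc (length L)"
proof
  define L c R where "L = rev (take (k - 1) xs)" and "c = xs ! (k - 1)" and "R = drop k xs"
  have k: "1 \<le> k" "k \<le> length xs" and sum: "sum_list xs = n"
    and decreasing: "\<And>i. 1 \<le> i \<Longrightarrow> i < k \<Longrightarrow> xs ! i < xs ! (i - 1)"
    and increasing: "\<And>i. k \<le> i \<Longrightarrow> i < length xs \<Longrightarrow> xs ! (i - 1) < xs ! i"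
    using assms by (auto simp: scc_at_def)
  have xs: "xs = rev L @ c # R"
    using k id_take_nth_drop[of "k - 1" xs] by (simp add: L_def c_def R_def)
  have right_part: "c # R = drop (k - 1) xs"
    using k Cons_nth_drop_Suc[of "k - 1" xs] by (simp add: c_def R_def)
  have left_part: "c # L = rev (take k xs)"
    using k take_Suc_conv_app_nth[of "k - 1" xs] by (simp add: c_def L_def)
  have "sorted_wrt (<) (c # R)"
    unfolding sorted_wrt_less_iff_nth right_part
  proof (intro allI impI)
    fix i assume "Suc i < length (drop (k - 1) xs)"
    then show "drop (k - 1) xs ! i < drop (k - 1) xs ! Suc i"
      using increasing[of "k + i"] k by (simp add: add.commute)
  qed
  moreover have "sorted_wrt (<) (c # L)"
    unfolding sorted_wrt_less_iff_nth left_part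
  proof (intro allI impI)
    fix i assume "Suc i < length (rev (take k xs))"
    then show "rev (take k xs) ! i < rev (take k xs) ! Suc i"
      using decreasing[of "k - Suc i"] k by (simp add: rev_nth min_absorb2)
  qed
  moreover have "sum_list L + c + sum_list R = n"
    using sum by (subst (asm) xs) simp
  ultimately show "(L, c, R) \<in> concave_triples n"
    by (simp add: concave_triples_def)
  show "xs = triple_list (L, c, R)" "k = Suc (length L)"
    using xs k by (simp_all add: triple_list_def L_def)
qed

lemma scc_at_triple_list:
  assumes "(L, c, R) \<in> concave_triples n"
  shows "scc_at n (triple_list (L, c, R)) (Suc (length L))"
proof -
  have left: "\<And>i. Suc i < length (c # L) \<Longrightarrow> (c # L) ! i < (c # L) ! Suc i"
    and right: "\<And>i. Suc i < length (c # R) \<Longrightarrow> (c # R) ! i < (c # R) ! Suc i"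
    using assms sorted_wrt_less_iff_nth[of "c # L"] sorted_wrt_less_iff_nth[of "c # R"]
    by (auto simp: concave_triples_def)
  define xs where "xs = rev L @ c # R"
  have xs_left: "xs = rev (c # L) @ R" by (simp add: xs_def)
  have decreasing: "xs ! i < xs ! (i - 1)" if "1 \<le> i" "i < Suc (length L)" for i
  proof -
    have "xs ! i = (c # L) ! (length L - i)" "xs ! (i - 1) = (c # L) ! Suc (length L - i)"
      using that unfolding xs_left
      by (simp_all add: nth_append_left rev_nth Suc_diff_le del: rev.simps nth_Cons_Suc)
    then show ?thesis using left[of "length L - i"] that by simp
  qed
  have increasing: "xs ! (i - 1) < xs ! i" if "Suc (length L) \<le> i" "i < length xs" for i
  proof -
    have "xs ! i = (c # R) ! Suc (i - Suc (length L))"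
        "xs ! (i - 1) = (c # R) ! (i - Suc (length L))"
      using that unfolding xs_def by (simp_all add: nth_append_right Suc_diff_le)
    then show ?thesis using right[of "i - Suc (length L)"] that xs_def by simp
  qed
  have "scc_at n xs (Suc (length L))"
    unfolding scc_at_def using assms decreasing increasing
    by (auto simp: xs_def concave_triples_def)
  then show ?thesis by (simp add: triple_list_def xs_def)
qed

lemma Vd_rank_eq_card: "Vd_rank m n = card {t \<in> concave_triples n. triple_rank t = m}"
proof -
  have "{xs. \<exists>k. scc_at n xs k \<and> int (length xs) - 2 * int k + 1 = m}
     = triple_list ` {t \<in> concave_triples n. triple_rank t = m}"
  proof (intro equalityI subsetI)
    fix xs assume "xs \<in> {xs. \<exists>k. scc_at n xs k \<and> int (length xs) - 2 * int k + 1 = m}"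
    then obtain k where k: "scc_at n xs k" "int (length xs) - 2 * int k + 1 = m" by blast
    from k(1) show "xs \<in> triple_list ` {t \<in> concave_triples n. triple_rank t = m}"
    proof (rule scc_at_imp_concave_triple)
      fix L c R assume t: "(L, c, R) \<in> concave_triples n" "xs = triple_list (L, c, R)"
          "k = Suc (length L)"
      then have "triple_rank (L, c, R) = m"
        using k(2) by (simp add: triple_list_def triple_rank_def)
      then show ?thesis using t by blast
    qed
  next
    fix xs assume "xs \<in> triple_list ` {t \<in> concave_triples n. triple_rank t = m}"
    then obtain L c R where t: "(L, c, R) \<in> concave_triples n" "xs = triple_list (L, c, R)"
      and rank: "triple_rank (L, c, R) = m"
      by auto
    have "scc_at n xs (Suc (length L))" using t scc_at_triple_list by blast
    moreover have "int (length xs) - 2 * int (Suc (length L)) + 1 = m"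
      using rank by (simp add: t triple_list_def triple_rank_def)
    ultimately show "xs \<in> {xs. \<exists>k. scc_at n xs k \<and> int (length xs) - 2 * int k + 1 = m}" by blast
  qed
  moreover have "inj_on triple_list {t \<in> concave_triples n. triple_rank t = m}"
    by (rule inj_on_subset[OF inj_on_triple_list[of n]]) auto
  ultimately show ?thesis by (simp add: Vd_rank_def card_image)
qed

lemma Vd_eq_card: "Vd n = card (concave_triples n)"
proof -
  have "{xs. strongly_concave n xs} = triple_list ` concave_triples n"
    unfolding strongly_concave_def
    by (auto elim!: scc_at_imp_concave_triple intro!: scc_at_triple_list)
  then show ?thesis by (simp add: Vd_def card_image inj_on_triple_list)
qed

lemma length_le_concave_triple:
  assumes "(L, c, R) \<in> concave_triples n"
  shows "length L \<le> n" "length R \<le> n"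
proof -
  have "length L \<le> sum_list L" "length R \<le> sum_list R"
    using assms by (auto simp: concave_triples_def intro!: length_le_sum_list)
  then show "length L \<le> n" "length R \<le> n"
    using assms by (auto simp: concave_triples_def)
qed

lemma finite_concave_triples: "finite (concave_triples n)"
proof -
  have "finite ({xs :: nat list. (\<forall>x\<in>set xs. 0 < x) \<and> sum_list xs \<le> n} \<times> {..n} \<times>
      {xs :: nat list. (\<forall>x\<in>set xs. 0 < x) \<and> sum_list xs \<le> n})"
    using finite_lists_sum_le by simp
  then show ?thesis
    by (rule finite_subset[rotated]) (auto simp: concave_triples_def)
qed

lemma Vd_eq_sum: "Vd n = (\<Sum>m=-int n..int n. Vd_rank m n)"
proof -
  have "triple_rank ` concave_triples n \<subseteq> {-int n..int n}"
  proof
    fix m assume "m \<in> triple_rank ` concave_triples n"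
    then obtain L c R where "(L, c, R) \<in> concave_triples n" "m = int (length R) - int (length L)"
      by (auto simp: triple_rank_def)
    then show "m \<in> {-int n..int n}" using length_le_concave_triple[of L c R n] by auto
  qed
  then have "card (concave_triples n)
      = (\<Sum>m=-int n..int n. card {t \<in> concave_triples n. triple_rank t = m})"
    using sum.group[of "concave_triples n" "{-int n..int n}" triple_rank "\<lambda>_. 1 :: nat"]
    by (simp add: finite_concave_triples)
  then show ?thesis by (simp add: Vd_eq_card Vd_rank_eq_card)
qed

lemma Vd_rank_minus: "Vd_rank (- m) n = Vd_rank m n"
proof -
  have "bij_betw (\<lambda>(L, c, R). (R, c, L)) {t \<in> concave_triples n. triple_rank t = m}
      {t \<in> concave_triples n. triple_rank t = - m}"
    by (rule bij_betwI[where g = "\<lambda>(L, c, R). (R, c, L)"])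
       (auto simp: concave_triples_def triple_rank_def)
  then show ?thesis by (simp add: Vd_rank_eq_card bij_betw_same_card)
qed

lemma Vd_rank_abs: "Vd_rank m n = Vd_rank (int (nat \<bar>m\<bar>)) n"
  by (cases "m \<ge> 0") (simp_all add: Vd_rank_minus)

section \<open>The number of compositions of given rank\<close>

lemma of_nat_card_concave_triples_fixed:
  "of_nat (card {(L, c', R) \<in> concave_triples n. c' = c \<and> length L = r \<and> length R = s})
    = (fps_nth (fps_X ^ c * (incr_fps r c * incr_fps s c)) n :: 'a::comm_ring_1)"
  (is "of_nat (card ?T) = _")
proof (cases "c \<le> n")
  case True
  have "?T = (\<Union>i\<in>{0..n - c}. incr_lists r c i \<times> {c} \<times> incr_lists s c (n - c - i))"
    using True by (auto simp: concave_triples_def incr_lists_def)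
  then have "card ?T = (\<Sum>i=0..n - c. card (incr_lists r c i \<times> {c} \<times> incr_lists s c (n - c - i)))"
    by (simp only:, subst card_UN_disjoint)
       (auto simp: finite_incr_lists, auto simp: incr_lists_def)
  then have "of_nat (card ?T) = (fps_nth (incr_fps r c * incr_fps s c) (n - c) :: 'a)"
    by (simp add: fps_mult_nth incr_fps_def card_cartesian_product)
  then show ?thesis using True by (simp add: fps_X_power_mult_nth)
next
  case False
  then have "?T = {}" by (auto simp: concave_triples_def)
  then show ?thesis using False by (simp only: card.empty) (simp add: fps_X_power_mult_nth)
qed

lemma Vd_rank_eq_sum_card:
  "Vd_rank (int l) n =
    (\<Sum>r\<le>n. \<Sum>c\<le>n. card {(L, c', R) \<in> concave_triples n. c' = c \<and> length L = r \<and> length R = r + l})"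
  (is "_ = (\<Sum>r\<le>n. \<Sum>c\<le>n. card (?T r c))")
proof -
  have finite: "finite (?T r c)" for r c
    by (rule finite_subset[OF _ finite_concave_triples[of n]]) auto
  have "{t \<in> concave_triples n. triple_rank t = int l} = (\<Union>(r, c)\<in>{..n} \<times> {..n}. ?T r c)"
  proof (intro equalityI subsetI)
    fix t assume t: "t \<in> {t \<in> concave_triples n. triple_rank t = int l}"
    obtain L c R where [simp]: "t = (L, c, R)" by (cases t)
    have "t \<in> ?T (length L) c" "length L \<le> n" "c \<le> n"
      using t length_le_concave_triple[of L c R n]
      by (auto simp: triple_rank_def concave_triples_def)
    then show "t \<in> (\<Union>(r, c)\<in>{..n} \<times> {..n}. ?T r c)" by blast
  qed (auto simp: triple_rank_def)
  then have "Vd_rank (int l) n = card (\<Union>(r, c)\<in>{..n} \<times> {..n}. ?T r c)"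
    by (simp add: Vd_rank_eq_card)
  also have "\<dots> = (\<Sum>(r, c)\<in>{..n} \<times> {..n}. card (?T r c))"
    by (subst card_UN_disjoint) (use finite in \<open>auto simp: case_prod_unfold\<close>)
  finally show ?thesis by (simp add: sum.cartesian_product)
qed

lemma triangle_add: "triangle r + triangle (r + l) = r * (r + l + 1) + triangle l"
  by (induction r) (simp_all add: algebra_simps)

lemma incr_fps_mult_eq:
  "fps_X ^ c * (incr_fps r c * incr_fps (r + l) c) =
     (fps_X ^ (c * (2 * r + l + 1))
       * (fps_X ^ (r * (r + l + 1) + triangle l) * inv_qpoch r * inv_qpoch (r + l))
       :: 'a::comm_ring_1 fps)"
proof -
  have exponent: "c + (r * c + triangle r) + ((r + l) * c + triangle (r + l))
      = c * (2 * r + l + 1) + (r * (r + l + 1) + triangle l)"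
    unfolding triangle_add[symmetric] by (simp add: algebra_simps)
  have "fps_X ^ c * (incr_fps r c * incr_fps (r + l) c) =
      (fps_X ^ (c + (r * c + triangle r) + ((r + l) * c + triangle (r + l))) * inv_qpoch r
        * inv_qpoch (r + l)
        :: 'a fps)"
    unfolding incr_fps_eq power_add by (simp only: mult_ac)
  then show ?thesis unfolding exponent by (simp only: power_add mult_ac)
qed

theorem Vd_rank_eq_nth:
  "of_nat (Vd_rank (int l) n)
  = (fps_nth (fps_X ^ triangle l * concave_fps 1 l) n :: 'a::comm_ring_1)"
proof -
  have "of_nat (Vd_rank (int l) n)
      = (\<Sum>r\<le>n. fps_nth (fps_suminf (\<lambda>c. fps_X ^ c * (incr_fps r c * incr_fps (r + l) c))) n :: 'a)"
    unfolding Vd_rank_eq_sum_card of_nat_sum of_nat_card_concave_triples_fixed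
    by (simp add: fps_suminf_def)
  also have "\<dots> = (\<Sum>r\<le>n. fps_nth (fps_X ^ triangle l * concave_term 1 l r) n)"
    unfolding incr_fps_mult_eq
    by (subst fps_suminf_X_power_geom) (simp_all add: concave_term_def power_add mult_ac)
  also have "\<dots> = fps_nth (fps_suminf (\<lambda>r. fps_X ^ triangle l * concave_term 1 l r)) n"
    by (simp add: fps_suminf_def)
  also have "\<dots> = fps_nth (fps_X ^ triangle l * concave_fps 1 l) n"
    by (simp add: concave_fps_def fps_suminf_X_power_mult fps_summable_concave_term)
  finally show ?thesis .
qed

definition partition_count_minus :: "nat \<Rightarrow> nat \<Rightarrow> nat" where
  "partition_count_minus N x = (if x \<le> N then partition_count (N - x) else 0)"

lemma fps_X_power_mult_partition_fps_nth:
  "fps_nth (fps_X ^ x * partition_fps) N = of_nat (partition_count_minus N x)"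
  by (simp add: fps_X_power_mult_nth partition_fps_nth partition_count_minus_def)

theorem Vd_rank_false_theta:
  assumes "N < K"
  shows "real (Vd_rank m (N + triangle (nat \<bar>m\<bar>))) =
    false_theta_sum (\<lambda>j. real (partition_count_minus N (theta_exponent (nat \<bar>m\<bar>) j))) {..<K}"
proof -
  let ?l = "nat \<bar>m\<bar>"
  let ?X = "fps_X :: real fps"
  have "K \<le> theta_exponent ?l (3 * K)" by (simp add: theta_exponent_simps)
  then have remainder: "fps_nth (?X ^ theta_exponent ?l (3 * K) * concave_fps 1 (?l + 4 * K)) N = 0"
    using assms by (intro fps_X_power_mult_nth_less) linarith
  have "real (Vd_rank m (N + triangle ?l)) = fps_nth (concave_fps 1 ?l) N"
    unfolding Vd_rank_abs[of m] Vd_rank_eq_nth by (simp add: fps_X_power_mult_nth)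
  also have "\<dots> = fps_nth (false_theta_sum (\<lambda>j. ?X ^ theta_exponent ?l j) {..<K} * partition_fps) N"
    by (subst concave_fps_false_theta[of _ K]) (simp only: fps_add_nth remainder add_0_right)
  finally show ?thesis
    by (simp only: false_theta_sum_def sum_distrib_right fps_sum_nth left_diff_distrib fps_sub_nth
        fps_X_power_mult_partition_fps_nth)
qed

lemma concave_fps_nth_nonneg: "0 \<le> fps_nth (concave_fps d m :: real fps) n"
proof -
  have mult_nonneg: "0 \<le> fps_nth (f * g) k"
    if "\<And>k. 0 \<le> fps_nth f k" "\<And>k. 0 \<le> fps_nth g k" for f g :: "real fps" and k
    unfolding fps_mult_nth using that by (intro sum_nonneg mult_nonneg_nonneg) auto
  have "0 \<le> fps_nth (concave_term d m r :: real fps) n" for r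
    unfolding concave_term_def
    by (intro mult_nonneg) (auto simp: inv_qpoch_nth fps_geom_def fps_X_power_nth)
  then show ?thesis unfolding concave_fps_def fps_suminf_def by (simp add: sum_nonneg)
qed

lemma Vd_rank_le: "Vd_rank m n \<le> partition_count_minus n (triangle (nat \<bar>m\<bar>))"
proof (cases "triangle (nat \<bar>m\<bar>) \<le> n")
  case True
  let ?l = "nat \<bar>m\<bar>" and ?k = "n - triangle (nat \<bar>m\<bar>)"
  have "0 \<le> fps_nth (fps_X ^ (2 * ?l + 4) * concave_fps 2 (?l + 2) :: real fps) ?k"
    by (simp add: fps_X_power_mult_nth concave_fps_nth_nonneg)
  then have "fps_nth (concave_fps 1 ?l) ?k \<le> (fps_nth partition_fps ?k :: real)"
    by (subst concave_fps_rec(1)) simp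
  moreover have "real (Vd_rank m n) = fps_nth (concave_fps 1 ?l) ?k"
    unfolding Vd_rank_abs[of m] Vd_rank_eq_nth using True by (simp add: fps_X_power_mult_nth)
  ultimately show ?thesis
    using True by (simp add: partition_fps_nth partition_count_minus_def)
next
  case False
  then have "real (Vd_rank m n) = 0"
    unfolding Vd_rank_abs[of m] Vd_rank_eq_nth by (simp add: fps_X_power_mult_nth)
  then show ?thesis by simp
qed

section \<open>The partition generating function\<close>

lemma fps_conv_radius_geom: "1 \<le> fps_conv_radius (fps_geom k :: 'a::{banach,real_normed_field} fps)"
  unfolding fps_conv_radius_def
proof (rule conv_radius_geI_ex')
  fix r :: real assume r: "0 < r" "ereal r < 1"
  show "summable (\<lambda>n. fps_nth (fps_geom k) n * of_real r ^ n :: 'a)"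
  proof (rule summable_comparison_test')
    show "summable (\<lambda>n. r ^ n)" using r by (intro summable_geometric) simp
    show "norm (fps_nth (fps_geom k) n * of_real r ^ n :: 'a) \<le> r ^ n" for n
      using r by (simp add: fps_geom_def norm_power)
  qed
qed

lemma fps_conv_radius_inv_qpoch:
  "1 \<le> fps_conv_radius (inv_qpoch m :: 'a::{banach,real_normed_field} fps)"
proof (induction m)
  case (Suc m)
  then have "1 \<le> min (fps_conv_radius (inv_qpoch m :: 'a fps))
      (fps_conv_radius (fps_geom (Suc m) :: 'a fps))"
    by (simp add: fps_conv_radius_geom)
  also have "\<dots> \<le> fps_conv_radius (inv_qpoch (Suc m) :: 'a fps)"
    unfolding inv_qpoch_Suc by (rule fps_conv_radius_mult)
  finally show ?case .
qed (simp add: one_ereal_def)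

lemma eval_fps_geom:
  fixes q :: "'a::{banach,real_normed_field}"
  assumes "norm q < 1" "0 < k"
  shows "eval_fps (fps_geom k) q = inverse (1 - q ^ k)"
proof -
  have radius: "ereal (norm q) < fps_conv_radius (fps_geom k :: 'a fps)"
    using less_le_trans[OF _ fps_conv_radius_geom] assms(1) by (metis ereal_less(3))
  have radius_denom: "fps_conv_radius (1 - fps_X ^ k :: 'a fps) = \<infinity>"
    using fps_conv_radius_diff[of "1 :: 'a fps" "fps_X ^ k"] by simp
  have "eval_fps (fps_geom k) q * (1 - q ^ k) = eval_fps (fps_geom k * (1 - fps_X ^ k)) q"
    using radius by (simp add: eval_fps_mult eval_fps_diff radius_denom)
  then have "eval_fps (fps_geom k) q * (1 - q ^ k) = 1"
    by (simp add: fps_geom_mult[OF assms(2)])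
  then show ?thesis by (metis inverse_unique mult.commute)
qed

lemma eval_fps_inv_qpoch:
  fixes q :: "'a::{banach,real_normed_field}"
  assumes "norm q < 1"
  shows "eval_fps (inv_qpoch m) q = (\<Prod>k=1..m. inverse (1 - q ^ k))"
proof (induction m)
  case (Suc m)
  have "ereal (norm q) < fps_conv_radius (inv_qpoch m :: 'a fps)"
    "ereal (norm q) < fps_conv_radius (fps_geom (Suc m) :: 'a fps)"
    using less_le_trans[OF _ fps_conv_radius_inv_qpoch] less_le_trans[OF _ fps_conv_radius_geom]
        assms
    by (metis ereal_less(3))+
  then show ?case
    by (simp add: inv_qpoch_Suc eval_fps_mult eval_fps_geom assms Suc del: power_Suc)
qed simp

lemma prod_inverse_le_exp:
  fixes x :: real
  assumes "0 \<le> x" "x < 1"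
  shows "(\<Prod>k=1..m. inverse (1 - x ^ k)) \<le> exp (1 / (1 - x)\<^sup>2)"
proof -
  have "inverse (1 - x ^ k) \<le> exp (x ^ k / (1 - x))" if "1 \<le> k" for k
  proof -
    have "x ^ k \<le> x" using assms that by (metis less_imp_le power_decreasing power_one_right)
    have "inverse (1 - x ^ k) = 1 + x ^ k / (1 - x ^ k)"
      using \<open>x ^ k \<le> x\<close> assms by (simp add: field_simps)
    also have "\<dots> \<le> 1 + x ^ k / (1 - x)"
      using \<open>x ^ k \<le> x\<close> assms by (intro add_left_mono divide_left_mono mult_pos_pos) auto
    also have "\<dots> \<le> exp (x ^ k / (1 - x))" by (rule exp_ge_add_one_self)
    finally show ?thesis .
  qed
  moreover have "0 \<le> inverse (1 - x ^ k)" for k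
    using assms by (simp add: power_le_one)
  ultimately have "(\<Prod>k=1..m. inverse (1 - x ^ k)) \<le> (\<Prod>k=1..m. exp (x ^ k / (1 - x)))"
    by (intro prod_mono) auto
  also have "\<dots> = exp ((\<Sum>k=1..m. x ^ k) / (1 - x))" by (simp add: exp_sum sum_divide_distrib)
  also have "(\<Sum>k=1..m. x ^ k) \<le> (\<Sum>k. x ^ k)"
    using assms by (intro sum_le_suminf) (auto intro: summable_geometric)
  also have "\<dots> = 1 / (1 - x)" using assms by (intro suminf_geometric) auto
  finally show ?thesis using assms by (simp add: power2_eq_square divide_right_mono)
qed

lemma summable_partition_count:
  fixes x :: real
  assumes "0 \<le> x" "x < 1"
  shows "summable (\<lambda>n. partition_count n * x ^ n)"
proof (rule summableI_nonneg_bounded)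
  show "0 \<le> partition_count n * x ^ n" for n using assms by simp
  show "(\<Sum>n<N. partition_count n * x ^ n) \<le> exp (1 / (1 - x)\<^sup>2)" for N
  proof -
    have radius: "ereal (norm x) < fps_conv_radius (inv_qpoch N :: real fps)"
      using less_le_trans[OF _ fps_conv_radius_inv_qpoch] assms
      by (metis abs_of_nonneg ereal_less(3) real_norm_def)
    have "(\<Sum>n<N. partition_count n * x ^ n) = (\<Sum>n<N. fps_nth (inv_qpoch N) n * x ^ n)"
      by (intro sum.cong) (auto simp: inv_qpoch_nth card_bounded_partitions_eq)
    also have "\<dots> \<le> eval_fps (inv_qpoch N) x"
      unfolding eval_fps_def using assms
      by (intro sum_le_suminf summable_fps radius) (auto simp: inv_qpoch_nth)
    also have "\<dots> \<le> exp (1 / (1 - x)\<^sup>2)"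
      using assms prod_inverse_le_exp[OF assms] by (subst eval_fps_inv_qpoch) simp_all
    finally show ?thesis .
  qed
qed

lemma summable_norm_partition_count:
  fixes q :: "'a::real_normed_field"
  assumes "norm q < 1"
  shows "summable (\<lambda>n. norm (of_nat (partition_count n) * q ^ n))"
  using summable_partition_count[of "norm q"] assms by (simp add: norm_mult norm_power)

lemma eval_fps_inv_qpoch_tendsto:
  fixes q :: "'a::{banach,real_normed_field}"
  assumes "norm q < 1"
  shows "(\<lambda>M. eval_fps (inv_qpoch M) q) \<longlonglongrightarrow> eval_fps partition_fps q"
  unfolding eval_fps_def
proof (rule tannerys_theorem[THEN conjunct2, THEN conjunct2])
  fix n
  have "\<forall>\<^sub>F M in sequentially. fps_nth (inv_qpoch M) n * q ^ n = fps_nth partition_fps n * q ^ n"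
    using eventually_ge_at_top[of n]
    by eventually_elim (simp add: inv_qpoch_nth partition_fps_nth card_bounded_partitions_eq)
  then show "(\<lambda>M. fps_nth (inv_qpoch M) n * q ^ n) \<longlonglongrightarrow> fps_nth partition_fps n * q ^ n"
    by (rule tendsto_eventually)
  show "\<forall>\<^sub>F (n, M) in sequentially \<times>\<^sub>F sequentially.
      norm (fps_nth (inv_qpoch M) n * q ^ n) \<le> norm (of_nat (partition_count n) * q ^ n)"
    by (intro always_eventually allI)
       (auto simp: inv_qpoch_nth norm_mult card_bounded_partitions_le intro!: mult_right_mono)
qed (use summable_norm_partition_count[OF assms] in auto)

lemma fps_conv_radius_partition_fps:
  "1 \<le> fps_conv_radius (partition_fps :: 'a::{banach,real_normed_field} fps)"
  unfolding fps_conv_radius_def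
  by (rule conv_radius_geI_ex')
     (auto simp: partition_fps_nth intro!: summable_norm_cancel[OF summable_norm_partition_count])

section \<open>The logarithm of the partition generating function\<close>

definition partition_log_term :: "nat \<Rightarrow> complex \<Rightarrow> complex" where
  "partition_log_term m z = inverse (of_nat (Suc m)) * inverse (exp (of_nat (Suc m) * z) - 1)"

definition partition_log :: "complex \<Rightarrow> complex" where
  "partition_log z = (\<Sum>m. partition_log_term m z)"

lemma geometric_sum_tendsto:
  assumes "0 < Re w"
  shows "(\<lambda>M. \<Sum>k=1..M. exp (- w) ^ k) \<longlonglongrightarrow> inverse (exp w - 1)"
proof -
  have "norm (exp (- w)) < 1" using assms by (simp add: norm_exp_eq_Re)
  then have "(\<lambda>M. \<Sum>k<M. exp (- w) * exp (- w) ^ k) \<longlonglongrightarrow> exp (- w) * (1 / (1 - exp (- w)))"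
    unfolding sums_def[symmetric] by (intro sums_mult geometric_sums)
  moreover have "exp (- w) * (1 / (1 - exp (- w))) = inverse (exp w - 1)"
  proof -
    have "exp w \<noteq> 1" using assms by (auto simp: exp_eq_1)
    then show ?thesis by (simp add: exp_minus field_simps)
  qed
  ultimately show ?thesis by (simp add: sum.atLeast1_atMost_eq)
qed

lemma norm_geometric_sum_le:
  fixes q :: "'a::real_normed_field"
  assumes "norm q < 1"
  shows "norm (\<Sum>k=1..M. q ^ k) \<le> norm q / (1 - norm q)"
proof -
  have "norm (\<Sum>k=1..M. q ^ k) \<le> (\<Sum>k=1..M. norm q ^ k)"
    by (intro sum_norm_le) (simp add: norm_power)
  also have "\<dots> = norm q * (\<Sum>k<M. norm q ^ k)"
    by (simp add: sum.atLeast1_atMost_eq sum_distrib_left)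
  also have "(\<Sum>k<M. norm q ^ k) \<le> (\<Sum>k. norm q ^ k)"
    using assms by (intro sum_le_suminf summable_geometric) auto
  also have "(\<Sum>k. norm q ^ k) = 1 / (1 - norm q)"
    using assms by (intro suminf_geometric) auto
  finally show ?thesis by (simp add: mult_left_mono)
qed

lemma norm_inverse_mult_geometric_sum_le:
  fixes q :: "'a::real_normed_field"
  assumes "norm q < 1"
  shows "norm (inverse (of_nat (Suc m)) * (\<Sum>k=1..M. (q ^ Suc m) ^ k))
      \<le> norm q ^ Suc m / (1 - norm q)"
proof -
  have norm_power_lt: "norm q ^ Suc m < 1" using power_less_one_iff[of "norm q" "Suc m"] assms
    by simp
  have "norm (inverse (of_nat (Suc m)) * (\<Sum>k=1..M. (q ^ Suc m) ^ k))
      \<le> 1 * norm (\<Sum>k=1..M. (q ^ Suc m) ^ k)"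
    unfolding norm_mult norm_inverse norm_of_nat by (intro mult_right_mono) (auto simp: field_simps)
  also have "\<dots> \<le> norm q ^ Suc m / (1 - norm q ^ Suc m)"
    using norm_geometric_sum_le[of "q ^ Suc m" M] norm_power_lt unfolding norm_power by simp
  also have "\<dots> \<le> norm q ^ Suc m / (1 - norm q)"
    using assms norm_power_lt
    by (intro divide_left_mono mult_pos_pos) (auto simp: mult_left_le power_le_one)
  finally show ?thesis .
qed

lemma
  assumes "0 < Re z"
  shows summable_norm_partition_log_term: "summable (\<lambda>m. norm (partition_log_term m z))"
    and partition_log_tendsto:
      "(\<lambda>M. \<Sum>m. inverse (of_nat (Suc m)) * (\<Sum>k=1..M. (exp (- z) ^ Suc m) ^ k)) \<longlonglongrightarrow> partition_log z"
proof -
  define x where "x = norm (exp (- z))"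
  have x: "0 \<le> x" "x < 1" using assms by (simp_all add: x_def norm_exp_eq_Re)
  have "summable (\<lambda>m. x ^ Suc m / (1 - x))"
    using x by (intro summable_divide) (subst summable_Suc_iff, rule summable_geometric, simp)
  moreover have "(\<lambda>M. inverse (of_nat (Suc m)) * (\<Sum>k=1..M. (exp (- z) ^ Suc m) ^ k))
      \<longlonglongrightarrow> partition_log_term m z" for m
  proof -
    have "exp (- z) ^ Suc m = exp (- (of_nat (Suc m) * z))"
      by (simp only: exp_of_nat_mult[symmetric] mult_minus_right)
    then show ?thesis
      unfolding partition_log_term_def using assms
      by (simp only:) (intro tendsto_mult tendsto_const geometric_sum_tendsto, simp del: of_nat_Suc)
  qed
  moreover have "\<forall>\<^sub>F (m, M) in sequentially \<times>\<^sub>F sequentially.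
      norm (inverse (of_nat (Suc m)) * (\<Sum>k=1..M. (exp (- z) ^ Suc m) ^ k)) \<le> x ^ Suc m / (1 - x)"
    unfolding x_def case_prod_unfold
    using x by (intro always_eventually allI norm_inverse_mult_geometric_sum_le) (simp add: x_def)
  ultimately have "summable (\<lambda>m. norm (partition_log_term m z)) \<and>
    (\<lambda>M. \<Sum>m. inverse (of_nat (Suc m)) * (\<Sum>k=1..M. (exp (- z) ^ Suc m) ^ k))
    \<longlonglongrightarrow> suminf (\<lambda>m. partition_log_term m z)"
    by (intro tannerys_theorem[THEN conjunct2]) auto
  then show "summable (\<lambda>m. norm (partition_log_term m z))"
    "(\<lambda>M. \<Sum>m. inverse (of_nat (Suc m)) * (\<Sum>k=1..M. (exp (- z) ^ Suc m) ^ k)) \<longlonglongrightarrow> partition_log z"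
    by (auto simp: partition_log_def)
qed

lemma sums_minus_Ln_one_minus:
  assumes "norm w < 1"
  shows "(\<lambda>m. inverse (of_nat (Suc m)) * w ^ Suc m) sums (- Ln (1 - w))"
proof -
  have "(\<lambda>n. - (- (w ^ n) / of_nat n)) sums (- Ln (1 + - w))"
    using Ln_series'[of "- w"] assms by (intro sums_minus) simp
  then have "(\<lambda>m. - (- (w ^ Suc m) / of_nat (Suc m))) sums (- Ln (1 - w))"
    by (subst sums_Suc_iff) simp
  then show ?thesis by (simp add: divide_inverse mult.commute del: of_nat_Suc power_Suc)
qed

lemma prod_inverse_eq_exp:
  fixes q :: complex
  assumes "norm q < 1"
  shows "(\<Prod>k=1..M. inverse (1 - q ^ k))
    = exp (\<Sum>m. inverse (of_nat (Suc m)) * (\<Sum>k=1..M. (q ^ Suc m) ^ k))"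
proof -
  have norm_lt: "norm (q ^ k) < 1" if "1 \<le> k" for k
    using power_less_one_iff[of "norm q" k] assms that by (simp add: norm_power)
  have "(\<lambda>m. \<Sum>k=1..M. inverse (of_nat (Suc m)) * (q ^ k) ^ Suc m) sums (\<Sum>k=1..M. - Ln (1 - q ^ k))"
    by (intro sums_sum sums_minus_Ln_one_minus norm_lt) simp
  moreover have "(q ^ k) ^ Suc m = (q ^ Suc m) ^ k" for k m
    by (metis mult.commute power_mult)
  ultimately have "(\<Sum>m. inverse (of_nat (Suc m)) * (\<Sum>k=1..M. (q ^ Suc m) ^ k))
      = (\<Sum>k=1..M. - Ln (1 - q ^ k))"
    by (simp only: sum_distrib_left sums_unique[symmetric])
  also have "exp \<dots> = (\<Prod>k=1..M. inverse (1 - q ^ k))"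
    unfolding exp_sum[OF finite_atLeastAtMost]
  proof (rule prod.cong[OF refl])
    fix k assume "k \<in> {1..M}"
    then have "1 - q ^ k \<noteq> 0" using norm_lt[of k] by auto
    then show "exp (- Ln (1 - q ^ k)) = inverse (1 - q ^ k)" by (simp add: exp_minus)
  qed
  finally show ?thesis by simp
qed

theorem eval_partition_fps_eq_exp_partition_log:
  assumes "0 < Re z"
  shows "eval_fps partition_fps (exp (- z)) = exp (partition_log z)"
proof (rule LIMSEQ_unique)
  have norm_lt: "norm (exp (- z)) < 1" using assms by (simp add: norm_exp_eq_Re)
  then show "(\<lambda>M. eval_fps (inv_qpoch M) (exp (- z))) \<longlonglongrightarrow> eval_fps partition_fps (exp (- z))"
    by (rule eval_fps_inv_qpoch_tendsto)
  show "(\<lambda>M. eval_fps (inv_qpoch M) (exp (- z))) \<longlonglongrightarrow> exp (partition_log z)"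
    unfolding eval_fps_inv_qpoch[OF norm_lt] prod_inverse_eq_exp[OF norm_lt]
    by (rule tendsto_exp[OF partition_log_tendsto[OF assms]])
qed

section \<open>The regular part of 1 / (exp w - 1)\<close>

definition sector :: "complex set" where
  "sector = {w. \<bar>Im w\<bar> \<le> Re w}"
lemma convex_sector: "convex sector"
proof (rule convexI)
  fix x y :: complex and u v :: real
  assume *: "x \<in> sector" "y \<in> sector" "0 \<le> u" "0 \<le> v" "u + v = 1"
  have "\<bar>Im (u *\<^sub>R x + v *\<^sub>R y)\<bar> \<le> \<bar>u * Im x\<bar> + \<bar>v * Im y\<bar>"
    by simp
  also have "\<dots> = u * \<bar>Im x\<bar> + v * \<bar>Im y\<bar>"
    using * by (simp add: abs_mult)
  also have "\<dots> \<le> u * Re x + v * Re y"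
    using * by (intro add_mono mult_left_mono) (auto simp: sector_def)
  finally show "u *\<^sub>R x + v *\<^sub>R y \<in> sector" by (simp add: sector_def)
qed

lemma closed_sector: "closed sector"
proof -
  have "sector = {w. \<bar>Im w\<bar> - Re w \<le> 0}" by (auto simp: sector_def)
  moreover have "closed {w. \<bar>Im w\<bar> - Re w \<le> 0}"
    by (intro closed_Collect_le continuous_intros)
  ultimately show ?thesis by (simp only:)
qed

lemma sector_Re_ge: "w \<in> sector \<Longrightarrow> 7 / 10 * norm w \<le> Re w"
proof -
  assume "w \<in> sector"
  then have w: "\<bar>Im w\<bar> \<le> Re w" by (simp add: sector_def)
  then have "(Im w)\<^sup>2 \<le> (Re w)\<^sup>2" by (metis abs_ge_zero abs_le_square_iff abs_of_nonneg order_trans)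
  then have "(7 / 10 * norm w)\<^sup>2 \<le> (Re w)\<^sup>2"
    unfolding power_mult_distrib cmod_power2 power_divide
    by simp (use zero_le_power2[of "Re w"] in linarith)
  then show ?thesis by (rule power2_le_imp_le) (use w in linarith)
qed

lemma sector_scale: "w \<in> sector \<Longrightarrow> 0 \<le> r \<Longrightarrow> of_real r * w \<in> sector"
  by (auto simp: sector_def abs_mult mult_left_mono)

(* The value at 0 is the one that makes the function holomorphic there. *)
definition inv_expm1_reg :: "complex \<Rightarrow> complex" where
  "inv_expm1_reg w = (if w = 0 then - 1 / 2 else inverse (exp w - 1) - inverse w)"

definition inv_expm1_dom :: "complex set" where
  "inv_expm1_dom = ball 0 1 \<union> {w. 0 < Re w}"

lemma open_inv_expm1_dom: "open inv_expm1_dom"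
  unfolding inv_expm1_dom_def by (intro open_Un open_ball open_halfspace_Re_gt)

lemma sector_subset_inv_expm1_dom: "sector \<subseteq> inv_expm1_dom"
proof
  fix w assume "w \<in> sector"
  then show "w \<in> inv_expm1_dom"
    using sector_Re_ge[of w] by (cases "w = 0") (auto simp: inv_expm1_dom_def)
qed

lemma exp_neq_1_inv_expm1_dom:
  assumes "w \<in> inv_expm1_dom" "w \<noteq> 0"
  shows "exp w \<noteq> 1"
proof
  assume "exp w = 1"
  then obtain n :: int where n: "Re w = 0" "Im w = of_int (2 * n) * pi" by (auto simp: exp_eq_1)
  with assms have "norm w < 1" by (auto simp: inv_expm1_dom_def)
  then have "\<bar>Im w\<bar> < 1" using abs_Im_le_cmod[of w] by linarith
  moreover have "n \<noteq> 0" using n assms(2) by (auto simp: complex_eq_iff)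
  then have "1 \<le> \<bar>real_of_int n\<bar>" by linarith
  then have "1 * 1 \<le> \<bar>real_of_int n\<bar> * (2 * pi)" by (intro mult_mono) (use pi_gt3 in auto)
  then have "1 \<le> \<bar>Im w\<bar>" unfolding n by (simp add: abs_mult mult_ac)
  ultimately show False by simp
qed

lemma inv_expm1_reg_holomorphic: "inv_expm1_reg holomorphic_on inv_expm1_dom"
proof -
  define F1 F2 :: "complex fps" where "F1 = fps_exp 1 - 1" and "F2 = fps_exp 1 - 1 - fps_X"
  have radius: "fps_conv_radius F1 = \<infinity>" "fps_conv_radius F2 = \<infinity>"
    using fps_conv_radius_diff[of "fps_exp 1 :: complex fps" 1] fps_conv_radius_diff[of F1 fps_X]
    by (simp_all add: F1_def F2_def)
  have coeffs: "fps_nth F1 1 = 1" "fps_nth F2 2 = 1 / 2" by (simp_all add: F1_def F2_def)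
  then have "F1 \<noteq> 0" "F2 \<noteq> 0" by auto
  moreover have "fps_nth F1 i = 0" if "i < 1" for i using that by (simp add: F1_def)
  moreover have "fps_nth F2 i = 0" if "i < 2" for i using that by (cases i) (simp_all add: F2_def)
  ultimately have subdegree: "1 \<le> subdegree F1" "2 \<le> subdegree F2" by (blast intro: subdegree_geI)+
  have eval_F1: "eval_fps F1 w = exp w - 1" for w by (simp add: F1_def eval_fps_diff)
  have "F2 = F1 - fps_X" by (simp add: F1_def F2_def)
  then have eval_F2: "eval_fps F2 w = exp w - 1 - w" for w
    by (simp add: eval_fps_diff eval_F1 radius)
  define E1 E2 where "E1 = eval_fps (fps_shift 1 F1)" and "E2 = eval_fps (fps_shift 2 F2)"
  have E1: "E1 w = (if w = 0 then 1 else (exp w - 1) / w)" for w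
    using eval_fps_shift[OF subdegree(1), of w]
    by (simp only: E1_def radius eval_F1 coeffs power_one_right) simp
  have E2: "E2 w = (if w = 0 then 1 / 2 else (exp w - 1 - w) / w\<^sup>2)" for w
    using eval_fps_shift[OF subdegree(2), of w] by (simp only: E2_def radius eval_F2 coeffs) simp
  have "E1 w \<noteq> 0" if "w \<in> inv_expm1_dom" for w
    using exp_neq_1_inv_expm1_dom[OF that] by (simp add: E1)
  then have "(\<lambda>w. - E2 w / E1 w) holomorphic_on inv_expm1_dom"
    unfolding E1_def E2_def by (intro holomorphic_intros) (auto simp: radius)
  moreover have "- E2 w / E1 w = inv_expm1_reg w" if "w \<in> inv_expm1_dom" for w
  proof (cases "w = 0")
    case False
    then have "exp w - 1 \<noteq> 0" using exp_neq_1_inv_expm1_dom[OF that] by simp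
    then show ?thesis using False
      by (simp add: E1 E2 inv_expm1_reg_def field_simps power2_eq_square)
  qed (simp add: E1 E2 inv_expm1_reg_def)
  ultimately show ?thesis by (rule holomorphic_transform)
qed

lemma norm_inv_expm1_reg_le:
  assumes "0 < Re w"
  shows "norm (inv_expm1_reg w) \<le> 1 / Re w + 1 / norm w"
proof -
  have "w \<noteq> 0" using assms by auto
  have "Re w \<le> exp (Re w) - 1" using exp_ge_add_one_self[of "Re w"] by linarith
  also have "\<dots> \<le> norm (exp w - 1)"
    using norm_triangle_ineq2[of "exp w" 1] by (simp add: norm_exp_eq_Re)
  finally have "inverse (norm (exp w - 1)) \<le> inverse (Re w)"
    using assms by (intro le_imp_inverse_le)
  moreover have "norm (inv_expm1_reg w) \<le> inverse (norm (exp w - 1)) + inverse (norm w)"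
    using norm_triangle_ineq4[of "inverse (exp w - 1)" "inverse w"] \<open>w \<noteq> 0\<close>
    by (simp add: inv_expm1_reg_def norm_inverse)
  ultimately show ?thesis by (simp add: divide_inverse)
qed

lemma inv_expm1_reg_has_derivs:
  assumes "w \<in> inv_expm1_dom"
  shows "(inv_expm1_reg has_field_derivative deriv inv_expm1_reg w) (at w)"
    and "(deriv inv_expm1_reg has_field_derivative deriv (deriv inv_expm1_reg) w) (at w)"
  using assms by (auto intro!: holomorphic_derivI holomorphic_deriv inv_expm1_reg_holomorphic
      open_inv_expm1_dom)

lemma cball_half_norm_sector:
  assumes "w \<in> sector" "v \<in> cball w (norm w / 2)"
  shows "norm w / 5 \<le> Re v" "norm w / 2 \<le> norm v"
proof -
  have dist: "norm (w - v) \<le> norm w / 2" using assms(2) by (simp add: dist_norm)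
  have "Re w - Re v \<le> norm w / 2" using dist complex_Re_le_cmod[of "w - v"] by simp
  then show "norm w / 5 \<le> Re v" using sector_Re_ge[OF assms(1)] norm_ge_zero[of w] by linarith
  have "norm w \<le> norm (w - v) + norm v" using norm_triangle_ineq[of "w - v" v] by simp
  then show "norm w / 2 \<le> norm v" using dist by linarith
qed

lemma norm_deriv2_inv_expm1_reg_le:
  assumes "w \<in> sector" "w \<noteq> 0"
  shows "norm (deriv (deriv inv_expm1_reg) w) \<le> 56 / norm w ^ 3"
proof -
  define r where "r = norm w / 2"
  have w_pos: "0 < norm w" and r_pos: "0 < r" using assms by (simp_all add: r_def)
  have Re_pos: "0 < Re v" if "v \<in> cball w r" for v
    using cball_half_norm_sector(1)[OF assms(1) that[unfolded r_def]] w_pos by linarith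
  then have "cball w r \<subseteq> inv_expm1_dom" by (auto simp: inv_expm1_dom_def)
  then have holomorphic: "inv_expm1_reg holomorphic_on cball w r"
    by (rule holomorphic_on_subset[OF inv_expm1_reg_holomorphic])
  have "norm ((deriv ^^ 2) inv_expm1_reg w) \<le> fact 2 * (7 / norm w) / r ^ 2"
  proof (rule Cauchy_inequality)
    show "inv_expm1_reg holomorphic_on ball w r"
      by (rule holomorphic_on_subset[OF holomorphic]) auto
    show "continuous_on (cball w r) inv_expm1_reg"
      by (rule holomorphic_on_imp_continuous_on[OF holomorphic])
    show "norm (inv_expm1_reg v) \<le> 7 / norm w" if "norm (w - v) = r" for v
    proof -
      have v: "v \<in> cball w r" using that by (simp add: dist_norm)
      have "norm (inv_expm1_reg v) \<le> 1 / Re v + 1 / norm v"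
        using Re_pos[OF v] by (rule norm_inv_expm1_reg_le)
      also have "\<dots> \<le> 1 / (norm w / 5) + 1 / (norm w / 2)"
        using cball_half_norm_sector[OF assms(1) v[unfolded r_def]] w_pos Re_pos[OF v]
        by (intro add_mono divide_left_mono mult_pos_pos) auto
      also have "\<dots> = 7 / norm w" by (simp add: field_simps)
      finally show ?thesis .
    qed
  qed (rule r_pos)
  also have "fact 2 * (7 / norm w) / r ^ 2 = 56 / norm w ^ 3"
    by (simp add: r_def field_simps power2_eq_square power3_eq_cube)
  finally show ?thesis by (simp add: eval_nat_numeral)
qed

lemma deriv2_inv_expm1_reg_bounded_on_cball:
  obtains B where "0 < B" "\<And>w. w \<in> sector \<Longrightarrow> norm w \<le> 1 \<Longrightarrow> norm (deriv (deriv inv_expm1_reg) w) \<le> B"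
proof -
  have "compact (sector \<inter> cball 0 1)"
    using closed_sector by (metis closed_Int_compact compact_cball)
  moreover have "deriv (deriv inv_expm1_reg) holomorphic_on inv_expm1_dom"
    by (intro holomorphic_deriv inv_expm1_reg_holomorphic open_inv_expm1_dom)
  then have "continuous_on (sector \<inter> cball 0 1) (deriv (deriv inv_expm1_reg))"
    using sector_subset_inv_expm1_dom
    by (metis holomorphic_on_imp_continuous_on continuous_on_subset le_infI1)
  ultimately have "bounded (deriv (deriv inv_expm1_reg) ` (sector \<inter> cball 0 1))"
    by (intro compact_imp_bounded compact_continuous_image)
  then show ?thesis
    unfolding bounded_pos using that by auto
qed

lemma deriv2_inv_expm1_reg_decay:
  "\<exists>K>0. \<forall>w\<in>sector. norm (deriv (deriv inv_expm1_reg) w) \<le> K / (1 + norm w)\<^sup>2"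
proof -
  obtain B where B: "0 < B" "\<And>w. w \<in> sector \<Longrightarrow> norm w \<le> 1 \<Longrightarrow> norm (deriv (deriv inv_expm1_reg) w) \<le> B"
    using deriv2_inv_expm1_reg_bounded_on_cball by blast
  have "norm (deriv (deriv inv_expm1_reg) w) * (1 + norm w)\<^sup>2 \<le> 4 * B + 224" if w: "w \<in> sector" for w
  proof (cases "norm w \<le> 1")
    case True
    then have "(1 + norm w)\<^sup>2 \<le> 2\<^sup>2" by (intro power_mono) auto
    then have "norm (deriv (deriv inv_expm1_reg) w) * (1 + norm w)\<^sup>2 \<le> B * 4"
      using B w True by (intro mult_mono) auto
    then show ?thesis by simp
  next
    case False
    then have "(1 + norm w)\<^sup>2 \<le> (2 * norm w)\<^sup>2" by (intro power_mono) auto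
    also have "\<dots> \<le> 4 * norm w ^ 3"
      using False by (simp add: power_mult_distrib power_increasing)
    finally have "norm (deriv (deriv inv_expm1_reg) w) * (1 + norm w)\<^sup>2
        \<le> (56 / norm w ^ 3) * (4 * norm w ^ 3)"
      using norm_deriv2_inv_expm1_reg_le[OF w] False
      by (intro mult_mono) fastforce+
    also have "\<dots> = 224" using False by auto
    finally show ?thesis using B by simp
  qed
  then have "norm (deriv (deriv inv_expm1_reg) w) \<le> (4 * B + 224) / (1 + norm w)\<^sup>2"
    if "w \<in> sector" for w
    using that by (subst pos_le_divide_eq) (intro zero_less_power add_pos_nonneg, auto)
  then show ?thesis using B by (intro exI[of _ "4 * B + 224"]) auto
qed

section \<open>Expansion of the logarithm at the origin\<close>

definition partition_log_rem :: "complex \<Rightarrow> complex" where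
  "partition_log_rem z = partition_log z - of_real (pi\<^sup>2 / 6) / z - Ln z / 2"

definition partial_log_rem :: "nat \<Rightarrow> complex \<Rightarrow> complex" where
  "partial_log_rem M z = (\<Sum>m<M. inverse (of_nat (Suc m)) * inv_expm1_reg (of_nat (Suc m) * z))
  - Ln z / 2"

definition small_sector :: "complex set" where
  "small_sector = {z \<in> sector. 0 < Re z \<and> norm z \<le> 2}"

lemma Re_pos_sector: "z \<in> sector \<Longrightarrow> z \<noteq> 0 \<Longrightarrow> 0 < Re z"
  using sector_Re_ge[of z] zero_less_norm_iff[of z] by linarith

lemma of_nat_mult_sector: "z \<in> sector \<Longrightarrow> of_nat m * z \<in> sector"
  using sector_scale[of z "real m"] by simp

lemma sum_inverse_square_le:
  fixes y :: real
  assumes "0 \<le> y"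
  shows "(\<Sum>m<M. y / (1 + real m * y)\<^sup>2) \<le> y + 1"
proof -
  have telescope: "(\<Sum>m<Suc M. y / (1 + real m * y)\<^sup>2) \<le> y + 1 - 1 / (1 + real M * y)" for M
  proof (induction M)
    case (Suc M)
    define a where "a = real M * y"
    have a: "0 \<le> a" "real (Suc M) * y = a + y" using assms by (simp_all add: a_def algebra_simps)
    have "y / (1 + (a + y))\<^sup>2 \<le> y / ((1 + a) * (1 + (a + y)))"
      using a assms unfolding power2_eq_square
      by (intro divide_left_mono mult_mono mult_pos_pos) auto
    also have "\<dots> = 1 / (1 + a) - 1 / (1 + (a + y))"
      using a assms by (simp add: divide_simps)
    finally have "y / (1 + real (Suc M) * y)\<^sup>2 \<le> 1 / (1 + real M * y) - 1 / (1 + real (Suc M) * y)"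
      by (simp only: a(2) a_def)
    then show ?case using Suc by (subst sum.lessThan_Suc) linarith
  qed simp
  have "(\<Sum>m<M. y / (1 + real m * y)\<^sup>2) \<le> (\<Sum>m<Suc M. y / (1 + real m * y)\<^sup>2)"
    using assms by (intro sum_mono2) auto
  also have "\<dots> \<le> y + 1 - 1 / (1 + real M * y)" by (rule telescope)
  also have "\<dots> \<le> y + 1" using assms by simp
  finally show ?thesis .
qed

lemma partial_log_rem_has_field_derivative:
  assumes "z \<in> sector" "z \<noteq> 0"
  shows "(partial_log_rem M has_field_derivative
      (\<Sum>m<M. deriv inv_expm1_reg (of_nat (Suc m) * z)) - 1 / (2 * z)) (at z)"
proof -
  let ?\<phi> = "inv_expm1_reg"
  have "((\<lambda>z. inverse (of_nat (Suc m)) * ?\<phi> (of_nat (Suc m) * z)) has_field_derivative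
      deriv ?\<phi> (of_nat (Suc m) * z)) (at z)" for m
  proof -
    have "of_nat (Suc m) * z \<in> inv_expm1_dom"
      using of_nat_mult_sector[OF assms(1)] sector_subset_inv_expm1_dom by blast
    then have "((\<lambda>z. ?\<phi> (of_nat (Suc m) * z))
        has_field_derivative deriv ?\<phi> (of_nat (Suc m) * z) * of_nat (Suc m)) (at z)"
      by (intro DERIV_chain'[of "\<lambda>z. of_nat (Suc m) * z"] inv_expm1_reg_has_derivs(1))
         (auto intro!: derivative_eq_intros)
    from DERIV_cmult[OF this, of "inverse (of_nat (Suc m))"] show ?thesis
      by (simp add: field_simps del: of_nat_Suc)
  qed
  then have "((\<lambda>z. \<Sum>m<M. inverse (of_nat (Suc m)) * ?\<phi> (of_nat (Suc m) * z)) has_field_derivative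
      (\<Sum>m<M. deriv ?\<phi> (of_nat (Suc m) * z))) (at z)"
    by (intro DERIV_sum)
  moreover have "((\<lambda>z. Ln z / 2) has_field_derivative 1 / (2 * z)) (at z)"
    using Re_pos_sector[OF assms] assms(2)
    by (auto intro!: derivative_eq_intros simp: complex_nonpos_Reals_iff divide_simps)
  ultimately show ?thesis
    unfolding partial_log_rem_def[abs_def] by (rule DERIV_diff)
qed

lemma norm_ge_on_multiples_segment:
  fixes z :: "'a::real_normed_field"
  assumes "v \<in> closed_segment (of_nat m * z) (of_nat (Suc m) * z)"
  shows "real m * norm z \<le> norm v"
proof -
  obtain t where t: "0 \<le> t" "t \<le> 1" "v = (1 - t) *\<^sub>R (of_nat m * z) + t *\<^sub>R (of_nat (Suc m) * z)"
    using assms by (auto simp: closed_segment_def)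
  have "v = of_real (real m + t) * z"
    by (simp add: t scaleR_conv_of_real algebra_simps)
  then have "norm v = (real m + t) * norm z"
    using t(1,2) by (simp only: norm_mult norm_of_real)
  then show ?thesis using t(1) by (simp add: mult_right_mono)
qed

context
  fixes K :: real
  assumes K_pos: "0 < K"
    and deriv2_le: "\<And>w. w \<in> sector \<Longrightarrow> norm (deriv (deriv inv_expm1_reg) w) \<le> K / (1 + norm w)\<^sup>2"
begin

lemma norm_linear_approx_le:
  fixes f f' f'' :: "complex \<Rightarrow> complex"
  assumes f: "\<And>v. v \<in> closed_segment a b \<Longrightarrow>
        (f has_field_derivative f' v) (at v within closed_segment a b)"
    and f': "\<And>v. v \<in> closed_segment a b \<Longrightarrow>
        (f' has_field_derivative f'' v) (at v within closed_segment a b)"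
    and f'': "\<And>v. v \<in> closed_segment a b \<Longrightarrow> norm (f'' v) \<le> B"
  shows "norm (f a - f b - f' b * (a - b)) \<le> B * (norm (a - b))\<^sup>2"
proof -
  define g where "g i = (if i = 0 then f else if i = 1 then f' else f'')" for i :: nat
  have "norm (g 0 a - (\<Sum>i\<le>1. g i b * (a - b) ^ i / fact i)) \<le> B * norm (a - b) ^ Suc 1 / fact 1"
    using f f' f''
    by (intro complex_Taylor[of "closed_segment a b" 1 g B b a]) (auto simp: g_def le_Suc_eq)
  then show ?thesis by (simp add: g_def power2_eq_square diff_diff_eq)
qed

lemma norm_deriv_diff_quotient_le:
  assumes "z \<in> sector" "z \<noteq> 0"
  shows "norm (deriv inv_expm1_reg (of_nat (Suc m) * z)
      - (inv_expm1_reg (of_nat (Suc m) * z) - inv_expm1_reg (of_nat m * z)) / z)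
    \<le> K * (norm z / (1 + real m * norm z)\<^sup>2)"
proof -
  let ?\<phi> = "inv_expm1_reg"
  define a b B where "a = of_nat m * z" and "b = of_nat (Suc m) * z"
    and "B = K / (1 + real m * norm z)\<^sup>2"
  have "b - a = z" by (simp add: a_def b_def algebra_simps)
  have "closed_segment a b \<subseteq> sector"
    unfolding a_def b_def by (intro closed_segment_subset of_nat_mult_sector convex_sector assms(1))
  then have in_sector: "v \<in> sector" if "v \<in> closed_segment a b" for v
    using that by blast
  have "norm (?\<phi> a - ?\<phi> b - deriv ?\<phi> b * (a - b)) \<le> B * (norm (a - b))\<^sup>2"
  proof (rule norm_linear_approx_le)
    fix v assume v: "v \<in> closed_segment a b"
    then have "v \<in> inv_expm1_dom" using in_sector sector_subset_inv_expm1_dom by blast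
    then show "(?\<phi> has_field_derivative deriv ?\<phi> v) (at v within closed_segment a b)"
      "(deriv ?\<phi> has_field_derivative deriv (deriv ?\<phi>) v) (at v within closed_segment a b)"
      by (simp_all add: inv_expm1_reg_has_derivs[THEN has_field_derivative_at_within])
    have "norm (deriv (deriv ?\<phi>) v) \<le> K / (1 + norm v)\<^sup>2"
      by (rule deriv2_le[OF in_sector[OF v]])
    also have "\<dots> \<le> B"
      unfolding B_def using K_pos norm_ge_on_multiples_segment[of v m z] v
      by (intro divide_left_mono power_mono mult_pos_pos zero_less_power)
         (auto simp: a_def b_def intro: add_pos_nonneg)
    finally show "norm (deriv (deriv ?\<phi>) v) \<le> B" .
  qed
  also have "?\<phi> a - ?\<phi> b - deriv ?\<phi> b * (a - b) = z * (deriv ?\<phi> b - (?\<phi> b - ?\<phi> a) / z)"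
  proof -
    have "a - b = - z" using \<open>b - a = z\<close> by (simp add: algebra_simps)
    moreover have "z * ((?\<phi> b - ?\<phi> a) / z) = ?\<phi> b - ?\<phi> a" using assms(2) by simp
    ultimately show ?thesis by (simp add: right_diff_distrib[of z] mult.commute)
  qed
  finally have "norm z * norm (deriv ?\<phi> b - (?\<phi> b - ?\<phi> a) / z) \<le> norm z * (B * norm z)"
    using \<open>b - a = z\<close> by (simp add: norm_mult norm_minus_commute[of a] power2_eq_square mult_ac)
  then have "norm (deriv ?\<phi> b - (?\<phi> b - ?\<phi> a) / z) \<le> B * norm z"
    using assms(2) by (subst (asm) mult_le_cancel_left_pos) simp_all
  then show ?thesis by (simp only: B_def a_def b_def) simp
qed

(* The derivatives at the multiples of z are close to difference quotients, whose sum telescopes;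
   the boundary term at 0 cancels the derivative of the logarithm. *)
lemma norm_deriv_partial_log_rem_le:
  assumes "z \<in> sector" "z \<noteq> 0"
  shows "norm ((\<Sum>m<M. deriv inv_expm1_reg (of_nat (Suc m) * z)) - 1 / (2 * z))
      \<le> K * (norm z + 1) + norm (inv_expm1_reg (of_nat M * z)) / norm z"
proof -
  let ?\<phi> = "inv_expm1_reg"
  define err where "err m = deriv ?\<phi> (of_nat (Suc m) * z)
      - (?\<phi> (of_nat (Suc m) * z) - ?\<phi> (of_nat m * z)) / z" for m
  have "(\<Sum>m<M. (?\<phi> (of_nat (Suc m) * z) - ?\<phi> (of_nat m * z)) / z) = (?\<phi> (of_nat M * z) - ?\<phi> 0) / z"
    using sum_lessThan_telescope[of "\<lambda>m. ?\<phi> (of_nat m * z)" M] by (simp flip: sum_divide_distrib)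
  also have "\<dots> = ?\<phi> (of_nat M * z) / z + 1 / (2 * z)"
    using assms(2) by (simp add: inv_expm1_reg_def[of 0] field_simps)
  finally have "(\<Sum>m<M. deriv ?\<phi> (of_nat (Suc m) * z)) - 1 / (2 * z)
      = (\<Sum>m<M. err m) + ?\<phi> (of_nat M * z) / z"
    by (simp add: err_def sum_subtractf)
  also have "norm \<dots> \<le> norm (\<Sum>m<M. err m) + norm (?\<phi> (of_nat M * z) / z)"
    by (rule norm_triangle_ineq)
  also have "norm (\<Sum>m<M. err m) \<le> (\<Sum>m<M. K * (norm z / (1 + real m * norm z)\<^sup>2))"
    unfolding err_def by (intro sum_norm_le norm_deriv_diff_quotient_le assms)
  also have "\<dots> \<le> K * (norm z + 1)"
    unfolding sum_distrib_left[symmetric] using K_pos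
    by (intro mult_left_mono sum_inverse_square_le) auto
  finally show ?thesis by (simp add: norm_divide)
qed

lemma norm_deriv_partial_log_rem_le_uniform:
  assumes "z \<in> small_sector" "0 < d" "d \<le> Re z" "0 < M"
  shows "norm ((\<Sum>m<M. deriv inv_expm1_reg (of_nat (Suc m) * z)) - 1 / (2 * z))
      \<le> 3 * K + 2 / (real M * d\<^sup>2)"
proof -
  have z: "z \<in> sector" "z \<noteq> 0" "norm z \<le> 2" "d \<le> norm z"
    using assms complex_Re_le_cmod[of z] by (auto simp: small_sector_def)
  have "norm ((\<Sum>m<M. deriv inv_expm1_reg (of_nat (Suc m) * z)) - 1 / (2 * z))
      \<le> K * (norm z + 1) + norm (inv_expm1_reg (of_nat M * z)) / norm z"
    by (rule norm_deriv_partial_log_rem_le[OF z(1,2)])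
  also have "K * (norm z + 1) \<le> K * 3" using K_pos z by (intro mult_left_mono) auto
  also have "norm (inv_expm1_reg (of_nat M * z)) \<le> 1 / Re (of_nat M * z) + 1 / norm (of_nat M * z)"
    using assms by (intro norm_inv_expm1_reg_le) auto
  also have "\<dots> \<le> 1 / (real M * d) + 1 / (real M * d)"
    using assms z by (intro add_mono divide_left_mono mult_pos_pos) (auto simp: norm_mult)
  also have "(1 / (real M * d) + 1 / (real M * d)) / norm z
      \<le> (1 / (real M * d) + 1 / (real M * d)) / d"
    using assms z by (intro divide_left_mono mult_pos_pos) auto
  also have "\<dots> = 2 / (real M * d\<^sup>2)" using assms by (simp add: field_simps power2_eq_square)
  finally show ?thesis by (simp add: divide_right_mono mult.commute)
qed

lemma partial_log_rem_lipschitz: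
  assumes "z \<in> small_sector" "z' \<in> small_sector" "0 < M"
  shows "norm (partial_log_rem M z - partial_log_rem M z')
    \<le> (3 * K + 2 / (real M * (min (Re z) (Re z'))\<^sup>2)) * norm (z - z')"
proof -
  define d where "d = min (Re z) (Re z')"
  have d: "0 < d" using assms by (simp add: d_def small_sector_def)
  define S where "S = sector \<inter> cball 0 2 \<inter> {w. d \<le> Re w}"
  have S_small: "w \<in> small_sector" "d \<le> Re w" if "w \<in> S" for w
    using that d by (auto simp: S_def small_sector_def)
  have "convex S"
    unfolding S_def by (intro convex_Int convex_sector convex_cball convex_halfspace_Re_ge)
  then show ?thesis
    unfolding d_def[symmetric]
  proof (rule field_differentiable_bound)
    show "(partial_log_rem M has_field_derivative
        (\<Sum>m<M. deriv inv_expm1_reg (of_nat (Suc m) * w)) - 1 / (2 * w)) (at w within S)"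
      if "w \<in> S" for w
      using S_small[OF that]
      by (intro partial_log_rem_has_field_derivative[THEN has_field_derivative_at_within])
         (auto simp: small_sector_def)
    show "norm ((\<Sum>m<M. deriv inv_expm1_reg (of_nat (Suc m) * w)) - 1 / (2 * w))
        \<le> 3 * K + 2 / (real M * d\<^sup>2)"
      if "w \<in> S" for w
      by (rule norm_deriv_partial_log_rem_le_uniform[OF S_small(1)[OF that] d S_small(2)[OF that]
          assms(3)])
    show "z \<in> S" "z' \<in> S" using assms by (auto simp: S_def d_def small_sector_def)
  qed
qed

end

lemma partial_log_rem_tendsto:
  assumes "0 < Re z"
  shows "(\<lambda>M. partial_log_rem M z) \<longlonglongrightarrow> partition_log_rem z"
proof -
  have "z \<noteq> 0" using assms by auto
  have "(\<lambda>m. partition_log_term m z) sums partition_log z"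
    unfolding partition_log_def
    using summable_norm_cancel[OF summable_norm_partition_log_term[OF assms]]
    by (rule summable_sums)
  moreover have "(\<lambda>m. of_real (1 / (real m + 1)\<^sup>2) :: complex) sums of_real (pi\<^sup>2 / 6)"
    unfolding sums_of_real_iff using inverse_squares_sums by (simp add: add.commute)
  then have "(\<lambda>m. of_real (1 / (real m + 1)\<^sup>2) / z) sums (of_real (pi\<^sup>2 / 6) / z)"
    by (rule sums_divide)
  ultimately have "(\<lambda>m. partition_log_term m z - of_real (1 / (real m + 1)\<^sup>2) / z)
      sums (partition_log z - of_real (pi\<^sup>2 / 6) / z)"
    by (rule sums_diff)
  moreover have "partition_log_term m z - of_real (1 / (real m + 1)\<^sup>2) / z
      = inverse (of_nat (Suc m)) * inv_expm1_reg (of_nat (Suc m) * z)" for m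
  proof -
    have "of_nat (Suc m) * z \<noteq> 0" using \<open>z \<noteq> 0\<close> by (simp del: of_nat_Suc)
    moreover have "(of_real (1 / (real m + 1)\<^sup>2) / z :: complex)
        = inverse (of_nat (Suc m)) * inverse (of_nat (Suc m) * z)"
      by (simp add: divide_inverse power2_eq_square add.commute)
    ultimately show ?thesis
      by (simp del: of_nat_Suc add: partition_log_term_def inv_expm1_reg_def right_diff_distrib)
  qed
  ultimately have "(\<lambda>M. \<Sum>m<M. inverse (of_nat (Suc m)) * inv_expm1_reg (of_nat (Suc m) * z))
      \<longlonglongrightarrow> partition_log z - of_real (pi\<^sup>2 / 6) / z"
    by (simp only: sums_def)
  then show ?thesis
    unfolding partial_log_rem_def partition_log_rem_def by (intro tendsto_diff tendsto_const)
qed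

lemma partition_log_rem_lipschitz: "\<exists>L>0. L-lipschitz_on small_sector partition_log_rem"
proof -
  obtain K where K_pos: "0 < K"
    and deriv2_le: "\<And>w. w \<in> sector \<Longrightarrow> norm (deriv (deriv inv_expm1_reg) w) \<le> K / (1 + norm w)\<^sup>2"
    using deriv2_inv_expm1_reg_decay by blast
  have "norm (partition_log_rem z - partition_log_rem z') \<le> 3 * K * norm (z - z')"
    if z: "z \<in> small_sector" "z' \<in> small_sector" for z z'
  proof -
    define d where "d = min (Re z) (Re z')"
    have "(\<lambda>M. norm (partial_log_rem M z - partial_log_rem M z'))
        \<longlonglongrightarrow> norm (partition_log_rem z - partition_log_rem z')"
      using z by (intro tendsto_intros partial_log_rem_tendsto) (auto simp: small_sector_def)
    moreover have "(\<lambda>M. (3 * K + 2 / d\<^sup>2 / real M) * norm (z - z')) \<longlonglongrightarrow> (3 * K + 0) * norm (z - z')"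
      by (intro tendsto_intros lim_const_over_n)
    moreover have "\<exists>N. \<forall>M\<ge>N. norm (partial_log_rem M z - partial_log_rem M z')
        \<le> (3 * K + 2 / d\<^sup>2 / real M) * norm (z - z')"
      using partial_log_rem_lipschitz[OF K_pos deriv2_le z]
      by (intro exI[of _ 1]) (simp add: d_def mult.commute)
    ultimately have "norm (partition_log_rem z - partition_log_rem z')
        \<le> (3 * K + 0) * norm (z - z')"
      by (rule LIMSEQ_le)
    then show ?thesis by simp
  qed
  then have "(3 * K)-lipschitz_on small_sector partition_log_rem"
    using K_pos by (intro lipschitz_onI) (auto simp: dist_norm)
  then show ?thesis using K_pos by (intro exI[of _ "3 * K"]) auto
qed

lemma partition_log_term_of_real:
  "partition_log_term m (of_real s)
  = of_real (inverse (real (Suc m)) * inverse (exp (real (Suc m) * s) - 1))"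
  by (simp add: partition_log_term_def flip: exp_of_real)

lemma Im_partition_log_rem_of_real:
  assumes "0 < s"
  shows "Im (partition_log_rem (of_real s)) = 0"
proof -
  have "Im (partition_log_term m (of_real s)) = 0" for m
    by (simp only: partition_log_term_of_real Im_complex_of_real)
  moreover have "summable (\<lambda>m. partition_log_term m (of_real s))"
    using assms by (intro summable_norm_cancel[OF summable_norm_partition_log_term]) simp
  ultimately have "Im (partition_log (of_real s)) = 0"
    by (simp add: partition_log_def Im_suminf)
  then show ?thesis
    using assms by (simp add: partition_log_rem_def Ln_of_real flip: of_real_divide)
qed

lemma of_real_small_sector: "0 < s \<Longrightarrow> s \<le> 2 \<Longrightarrow> of_real s \<in> small_sector"
  by (simp add: small_sector_def sector_def)

(* In fact C = - ln (2 * pi) / 2, but its value is irrelevant for ratios of partition numbers. *)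
theorem partition_log_rem_limit:
  "\<exists>C K. 0 < K \<and> (\<forall>z\<in>small_sector. norm (partition_log_rem z - of_real C) \<le> K * norm z)"
proof -
  obtain K where K_pos: "0 < K" and lipschitz: "K-lipschitz_on small_sector partition_log_rem"
    using partition_log_rem_lipschitz by blast
  have "0 \<in> closure small_sector"
    unfolding closure_approachable
  proof (intro allI impI)
    fix e :: real assume "0 < e"
    then show "\<exists>z\<in>small_sector. dist z 0 < e"
      using of_real_small_sector[of "min 1 (e / 2)"]
      by (intro bexI[of _ "of_real (min 1 (e / 2))"]) auto
  qed
  then have nontrivial: "at 0 within small_sector \<noteq> bot"
    by (auto simp: trivial_limit_within closure_def small_sector_def)
  obtain c where c: "(partition_log_rem \<longlongrightarrow> c) (at 0 within small_sector)"
    using uniformly_continuous_on_extension_at_closure[OF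
        lipschitz_on_uniformly_continuous[OF lipschitz] \<open>0 \<in> closure small_sector\<close>] .
  have bound: "norm (partition_log_rem z - c) \<le> K * norm z" if "z \<in> small_sector" for z
  proof (rule tendsto_le[OF nontrivial])
    show "((\<lambda>w. K * norm (z - w)) \<longlongrightarrow> K * norm z) (at 0 within small_sector)"
      by (auto intro!: tendsto_eq_intros)
    show "((\<lambda>w. norm (partition_log_rem z - partition_log_rem w)) \<longlongrightarrow> norm (partition_log_rem z
        - c)) (at 0 within small_sector)"
      by (intro tendsto_intros c)
    show "\<forall>\<^sub>F w in at 0 within small_sector. norm (partition_log_rem z - partition_log_rem w)
        \<le> K * norm (z - w)"
      using lipschitz_onD[OF lipschitz that] by (auto simp: eventually_at_topological dist_norm)
  qed
  have "\<bar>Im c\<bar> \<le> e" if "0 < e" for e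
  proof -
    define s where "s = min 2 (e / K)"
    have s: "0 < s" "s \<le> 2" "K * s \<le> e"
      using that K_pos by (auto simp: s_def min_def field_simps)
    have "\<bar>Im c\<bar> = \<bar>Im (partition_log_rem (of_real s) - c)\<bar>"
      using Im_partition_log_rem_of_real[OF s(1)] by simp
    also have "\<dots> \<le> norm (partition_log_rem (of_real s) - c)" by (rule abs_Im_le_cmod)
    also have "\<dots> \<le> K * norm (complex_of_real s)" by (rule bound[OF of_real_small_sector[OF s(1,2)]])
    finally show ?thesis using s by simp
  qed
  then have "Im c = 0" by (metis abs_le_zero_iff dense_le_bounded field_le_epsilon add_0)
  then have "c = of_real (Re c)" by (simp add: complex_eq_iff)
  then show ?thesis using bound K_pos by (intro exI[of _ "Re c"] exI[of _ K]) auto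
qed

section \<open>Fourier coefficients on a circle\<close>

lemma has_integral_exp_int:
  fixes k :: int
  shows "((\<lambda>\<theta>. exp (\<i> * of_int k * of_real \<theta>))
      has_integral (if k = 0 then of_real (2 * pi) else 0)) {-pi..pi}"
proof (cases "k = 0")
  case True
  then show ?thesis using has_integral_const_real[of "1 :: complex" "- pi" pi]
    by (simp add: scaleR_conv_of_real)
next
  case False
  define c where "c = \<i> * of_int k"
  have c: "c \<noteq> 0" using False by (simp add: c_def)
  have "((\<lambda>\<theta>. exp (c * of_real \<theta>))
      has_integral (exp (c * of_real pi) / c - exp (c * of_real (- pi)) / c)) {-pi..pi}"
  proof (rule fundamental_theorem_of_calculus)
    show "((\<lambda>\<theta>. exp (c * of_real \<theta>) / c)
        has_vector_derivative exp (c * of_real x)) (at x within {-pi..pi})" for x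
    proof -
      have "((\<lambda>w. exp (c * w) / c) has_field_derivative exp (c * of_real x)) (at (of_real x))"
        using c by (auto intro!: derivative_eq_intros)
      then show ?thesis
        by (rule has_vector_derivative_real_field[THEN has_vector_derivative_at_within])
    qed
  qed simp
  moreover have "exp (c * of_real pi) = exp (c * of_real (- pi))"
  proof -
    have "exp (c * of_real pi) = exp (c * of_real (- pi) + of_int (2 * k) * of_real pi * \<i>)"
      by (simp add: c_def algebra_simps)
    also have "\<dots> = exp (c * of_real (- pi))"
      by (simp add: exp_eq)
    finally show ?thesis .
  qed
  ultimately show ?thesis using False by (simp add: c_def)
qed
lemma has_integral_circle_power:
  "((\<lambda>\<theta>. exp (- Complex s \<theta>) ^ k * exp (of_nat n * Complex s \<theta>)) has_integral
     (if k = n then of_real (2 * pi) else 0)) {-pi..pi}"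
proof -
  have "exp (- Complex s \<theta>) ^ k * exp (of_nat n * Complex s \<theta>)
      = of_real (exp ((real n - real k) * s)) * exp (\<i> * of_int (int n - int k) * of_real \<theta>)" for \<theta>
  proof -
    have "exp (- Complex s \<theta>) ^ k * exp (of_nat n * Complex s \<theta>)
        = exp (of_nat k * (- Complex s \<theta>) + of_nat n * Complex s \<theta>)"
      by (simp only: exp_of_nat_mult exp_add)
    also have "of_nat k * (- Complex s \<theta>) + of_nat n * Complex s \<theta>
        = of_real ((real n - real k) * s) + \<i> * of_int (int n - int k) * of_real \<theta>"
      by (simp add: complex_eq_iff algebra_simps)
    finally show ?thesis by (simp only: exp_add exp_of_real)
  qed
  then show ?thesis
    using has_integral_mult_right[OF has_integral_exp_int[of "int n - int k"],
        of "of_real (exp ((real n - real k) * s))"]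
    by (cases "k = n") auto
qed

lemma has_integral_uniform_limit_eventually:
  fixes g :: "nat \<Rightarrow> real \<Rightarrow> 'b::banach"
  assumes "uniform_limit {a..b} g h sequentially" "\<And>N. continuous_on {a..b} (g N)"
    and g_integral: "\<forall>\<^sub>F N in sequentially. (g N has_integral J) {a..b}"
  shows "(h has_integral J) {a..b}"
proof -
  obtain I J' where limits: "\<And>N. (g N has_integral I N) {a..b}" "(h has_integral J') {a..b}"
      "I \<longlonglongrightarrow> J'"
    using assms(1,2) by (rule uniform_limit_integral[where F = sequentially]) auto
  have "\<forall>\<^sub>F N in sequentially. I N = J"
    using g_integral by eventually_elim (rule has_integral_unique[OF limits(1)])
  then have "I \<longlonglongrightarrow> J" by (rule tendsto_eventually)
  then show ?thesis using limits(2) LIMSEQ_unique[OF limits(3)] by simp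
qed

lemma has_integral_eval_fps_circle:
  assumes radius: "ereal (exp (- s)) < fps_conv_radius f"
  shows "((\<lambda>\<theta>. eval_fps f (exp (- Complex s \<theta>)) * exp (of_nat n * Complex s \<theta>)) has_integral
     of_real (2 * pi) * fps_nth f n) {-pi..pi}"
proof -
  define summand where "summand k \<theta>
      = fps_nth f k * exp (- Complex s \<theta>) ^ k * exp (of_nat n * Complex s \<theta>)" for k \<theta>
  have eval: "eval_fps f (exp (- Complex s \<theta>)) * exp (of_nat n * Complex s \<theta>) = (\<Sum>k. summand k \<theta>)"
    for \<theta>
  proof -
    have "summable (\<lambda>k. fps_nth f k * exp (- Complex s \<theta>) ^ k)"
      using radius by (intro summable_fps) (simp add: norm_exp_eq_Re)
    then show ?thesis by (simp add: summand_def eval_fps_def suminf_mult2)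
  qed
  have integrals: "(summand k
      has_integral (if k = n then of_real (2 * pi) * fps_nth f n else 0)) {-pi..pi}" for k
    using has_integral_mult_right[OF has_integral_circle_power[of s k n], of "fps_nth f k"]
    by (cases "k = n") (simp_all add: summand_def[abs_def] mult_ac)
  have "((\<lambda>\<theta>. \<Sum>k. summand k \<theta>) has_integral of_real (2 * pi) * fps_nth f n) {-pi..pi}"
  proof (rule has_integral_uniform_limit_eventually)
    show "uniform_limit {-pi..pi} (\<lambda>N \<theta>. \<Sum>k<N. summand k \<theta>) (\<lambda>\<theta>. \<Sum>k. summand k \<theta>) sequentially"
    proof (rule Weierstrass_m_test)
      show "norm (summand k \<theta>) \<le> norm (fps_nth f k * of_real (exp (- s)) ^ k) * exp (n * s)" for k \<theta>
        by (simp add: summand_def norm_mult norm_power)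
      show "summable (\<lambda>k. norm (fps_nth f k * of_real (exp (- s)) ^ k) * exp (n * s))"
        using radius by (intro summable_mult2 norm_summable_fps) simp
    qed
    have "Complex s \<theta> = of_real s + \<i> * of_real \<theta>" for \<theta> by (simp add: complex_eq_iff)
    then show "continuous_on {-pi..pi} (\<lambda>\<theta>. \<Sum>k<N. summand k \<theta>)" for N
      by (simp only: summand_def) (intro continuous_intros)
    show "\<forall>\<^sub>F N in sequentially.
        ((\<lambda>\<theta>. \<Sum>k<N. summand k \<theta>) has_integral of_real (2 * pi) * fps_nth f n) {-pi..pi}"
      using eventually_gt_at_top[of n]
    proof eventually_elim
      case (elim N)
      have "((\<lambda>\<theta>. \<Sum>k<N. summand k \<theta>)
          has_integral (\<Sum>k<N. if k = n then of_real (2 * pi) * fps_nth f n else 0)) {-pi..pi}"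
        by (intro has_integral_sum integrals) auto
      then show ?case using elim by simp
    qed
  qed
  then show ?thesis by (simp only: eval)
qed

lemma has_integral_exp_partition_log:
  assumes "0 < s"
  shows "((\<lambda>\<theta>. exp (partition_log (Complex s \<theta>) + of_nat n * Complex s \<theta>)) has_integral
     of_real (2 * pi * partition_count n)) {-pi..pi}"
proof -
  have "ereal (exp (- s)) < 1" using assms by (simp add: one_ereal_def)
  then have "ereal (exp (- s)) < fps_conv_radius (partition_fps :: complex fps)"
    by (rule less_le_trans[OF _ fps_conv_radius_partition_fps])
  moreover have "eval_fps partition_fps (exp (- Complex s \<theta>)) * exp (of_nat n * Complex s \<theta>)
      = exp (partition_log (Complex s \<theta>) + of_nat n * Complex s \<theta>)" for \<theta>
    using assms
    by (subst eval_partition_fps_eq_exp_partition_log) (simp_all only: exp_add complex.sel)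
  ultimately show ?thesis
    using has_integral_eval_fps_circle[of s "partition_fps" n] by (simp add: partition_fps_nth)
qed

section \<open>Elementary estimates\<close>

lemma has_integral_gaussian:
  fixes b :: real
  assumes "0 < b"
  shows "((\<lambda>x. exp (- b * x\<^sup>2)) has_integral sqrt (pi / b)) UNIV"
proof -
  define \<sigma> where "\<sigma> = sqrt (1 / (2 * b))"
  have sig: "0 < \<sigma>" "\<sigma>\<^sup>2 = 1 / (2 * b)" using assms by (auto simp: \<sigma>_def)
  have "((\<lambda>x. normal_density 0 \<sigma> x) has_integral 1) UNIV"
    using has_integral_integral_lborel[OF integrable_normal_density[OF sig(1), of 0]] sig
    by simp
  then have "((\<lambda>x. sqrt (pi / b) * normal_density 0 \<sigma> x) has_integral (sqrt (pi / b) * 1)) UNIV"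
    by (rule has_integral_mult_right)
  moreover have "sqrt (pi / b) * normal_density 0 \<sigma> x = exp (- b * x\<^sup>2)" for x
  proof -
    have "2 * pi * \<sigma>\<^sup>2 = pi / b" unfolding sig by simp
    moreover have "- (x - 0)\<^sup>2 / (2 * \<sigma>\<^sup>2) = - b * x\<^sup>2" unfolding sig using assms
      by (simp add: field_simps)
    moreover have "sqrt (pi / b) \<noteq> 0" using assms by simp
    ultimately show ?thesis unfolding normal_density_def
      by (simp only: times_divide_eq_left times_divide_eq_right) simp
  qed
  ultimately show ?thesis by simp
qed
lemma one_minus_cos_le: "1 - cos y \<le> (y::real)\<^sup>2 / 2"
proof -
  have "(sin (y / 2))\<^sup>2 \<le> (y / 2)\<^sup>2"
    using abs_sin_x_le_abs_x[of "y / 2"] by (simp only: abs_le_square_iff)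
  then show ?thesis using cos_double_sin[of "y / 2"] by (simp add: power_divide)
qed

lemma one_minus_cos_ge:
  fixes y :: real
  assumes "0 \<le> y" "y \<le> 1"
  shows "y\<^sup>2 / 4 \<le> 1 - cos y"
proof -
  have "7 / 8 * (y / 2) \<le> sin (y / 2)"
  proof (cases "y = 0")
    case False
    then have "0 < y / 2" using assms by simp
    then obtain \<xi> where xi: "0 < \<xi>" "\<xi> < y / 2" "sin (y / 2) - sin 0 = (y / 2 - 0) * cos \<xi>"
      using MVT2[of 0 "y / 2" sin cos] DERIV_sin by blast
    have "\<xi>\<^sup>2 \<le> (1 / 2)\<^sup>2" using xi assms by (intro power_mono) auto
    then have "7 / 8 \<le> cos \<xi>" using one_minus_cos_le[of \<xi>] by (simp add: power_divide)
    then have "(y / 2) * (7 / 8) \<le> (y / 2) * cos \<xi>" using assms by (intro mult_left_mono) auto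
    then show ?thesis using xi(3) by (simp only: sin_zero diff_0_right)
  qed simp
  then have "(7 / 8 * (y / 2))\<^sup>2 \<le> (sin (y / 2))\<^sup>2"
    using assms by (intro power_mono) auto
  then have "49 * y\<^sup>2 / 256 \<le> (sin (y / 2))\<^sup>2" by (simp add: power_mult_distrib power_divide)
  moreover have "cos y = 1 - 2 * (sin (y / 2))\<^sup>2" using cos_double_sin[of "y / 2"] by simp
  ultimately show ?thesis using zero_le_power2[of y] by linarith
qed
lemma abs_exp_minus_1_le: "\<bar>exp x - 1\<bar> \<le> \<bar>x\<bar> * exp (max x (0 :: real))"
proof (cases "0 \<le> x")
  case True
  have "1 - x \<le> exp (- x)" using exp_ge_add_one_self[of "- x"] by simp
  then have "(1 - x) * exp x \<le> exp (- x) * exp x" by (intro mult_right_mono) auto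
  then have "(1 - x) * exp x \<le> 1" by (simp flip: exp_add)
  then show ?thesis using True by (simp add: algebra_simps max_def)
next
  case False
  have "exp x \<le> 1" using False by simp
  moreover have "1 + x \<le> exp x" by (rule exp_ge_add_one_self)
  ultimately have "\<bar>exp x - 1\<bar> \<le> \<bar>x\<bar>" using False by linarith
  then show ?thesis using False by (simp add: max_def)
qed

lemma abs_exp_cos_minus_1_le:
  fixes x y :: real
  shows "\<bar>exp x * cos y - 1\<bar> \<le> (\<bar>x\<bar> + y\<^sup>2) * exp (max x 0)"
proof -
  have "0 \<le> 1 - cos y" by simp
  have "\<bar>exp x * cos y - 1\<bar> = \<bar>(exp x - 1) - exp x * (1 - cos y)\<bar>" by (simp add: algebra_simps)
  also have "\<dots> \<le> \<bar>exp x - 1\<bar> + exp x * (1 - cos y)"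
    using abs_triangle_ineq4[of "exp x - 1" "exp x * (1 - cos y)"] \<open>0 \<le> 1 - cos y\<close>
    by (simp add: abs_mult)
  also have "exp x * (1 - cos y) \<le> exp (max x 0) * y\<^sup>2"
  proof (intro mult_mono)
    show "1 - cos y \<le> y\<^sup>2" using one_minus_cos_le[of y] zero_le_power2[of y] by linarith
  qed auto
  finally show ?thesis using abs_exp_minus_1_le[of x] by (simp add: algebra_simps)
qed

lemma cubic_le_exp:
  fixes s c :: real
  assumes "0 \<le> s" "0 \<le> c"
  shows "s\<^sup>2 + 4 * s + 3 * s ^ 3 + c \<le> (1536 + c) * exp (3 * s / 8)"
proof -
  define u where "u = s / 8"
  have u: "0 \<le> u" "s = 8 * u" using assms by (auto simp: u_def)
  have "(1 + u) ^ 3 \<le> exp u ^ 3" using u by (intro power_mono exp_ge_add_one_self) auto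
  also have "exp u ^ 3 = exp (3 * s / 8)" by (simp add: u flip: exp_of_nat_mult)
  finally have e: "(1 + u) ^ 3 \<le> exp (3 * s / 8)" .
  have "s\<^sup>2 + 4 * s + 3 * s ^ 3 + c \<le> (1536 + c) * (1 + u) ^ 3"
  proof -
    have "0 \<le> c * ((1 + u) ^ 3 - 1)" using u assms
      by (intro mult_nonneg_nonneg) (auto simp: one_le_power)
    moreover have "64 * u\<^sup>2 + 32 * u + 1536 * u ^ 3 \<le> 1536 * (1 + u) ^ 3"
      using u by (simp add: power3_eq_cube power2_eq_square algebra_simps)
    ultimately show ?thesis by (simp add: u power_mult_distrib algebra_simps)
  qed
  also have "\<dots> \<le> (1536 + c) * exp (3 * s / 8)" using e assms by (intro mult_left_mono) auto
  finally show ?thesis .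
qed

lemma square_sum3_le: "(a + b + c)\<^sup>2 \<le> 3 * (a\<^sup>2 + b\<^sup>2 + (c::real)\<^sup>2)"
proof -
  have "0 \<le> (a - b)\<^sup>2 + (b - c)\<^sup>2 + (a - c)\<^sup>2" by simp
  then show ?thesis by (simp add: power2_eq_square algebra_simps)
qed

lemma pi_squared_bounds: "9 < pi\<^sup>2" "pi\<^sup>2 < 12"
proof -
  have "3\<^sup>2 < pi\<^sup>2" using pi_gt3 by (intro power_strict_mono) auto
  then show "9 < pi\<^sup>2" by simp
  have "pi\<^sup>2 < (3.2)\<^sup>2" using pi_approx by (intro power_strict_mono) auto
  then show "pi\<^sup>2 < 12" by (simp add: power2_eq_square)
qed

lemma norm_exp_minus_1_squared:
  "(norm (exp z - 1))\<^sup>2 = (exp (Re z) - 1)\<^sup>2 + 2 * exp (Re z) * (1 - cos (Im z))"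
proof -
  have "(norm (exp z - 1))\<^sup>2 = (exp (Re z) * cos (Im z) - 1)\<^sup>2 + (exp (Re z) * sin (Im z))\<^sup>2"
    unfolding cmod_power2 by (simp add: Re_exp Im_exp)
  also have "\<dots> = (exp (Re z))\<^sup>2 * ((sin (Im z))\<^sup>2 + (cos (Im z))\<^sup>2) - 2 * exp (Re z) * cos (Im z) + 1"
    by (simp add: power2_diff power_mult_distrib algebra_simps
        del: sin_cos_squared_add sin_cos_squared_add2 sin_cos_squared_add3)
  finally show ?thesis by (simp add: power2_eq_square algebra_simps)
qed

lemma norm_exp_minus_1_ge_off_axis:
  assumes s: "0 < s" "s \<le> 1" and \<theta>: "s \<le> \<bar>\<theta>\<bar>" "\<bar>\<theta>\<bar> \<le> pi"
  shows "106 / 100 * (exp s - 1) \<le> norm (exp (Complex s \<theta>) - 1)"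
proof (rule power2_le_imp_le)
  define a where "a = exp s - 1"
  have "exp s \<le> 1 + s + s\<^sup>2" using s by (intro exp_bound) auto
  also have "s\<^sup>2 \<le> s" using s by (simp add: power2_eq_square mult_left_le)
  finally have "a\<^sup>2 \<le> (2 * s)\<^sup>2" using s by (intro power_mono) (auto simp: a_def)
  have "cos \<bar>\<theta>\<bar> \<le> cos s" using s \<theta> by (intro cos_monotone_0_pi_le) auto
  then have "s\<^sup>2 / 4 \<le> 1 - cos \<theta>" using one_minus_cos_ge[of s] s by simp
  then have "2 * 1 * (s\<^sup>2 / 4) \<le> 2 * exp s * (1 - cos \<theta>)"
    using s by (intro mult_mono) auto
  then have "a\<^sup>2 + a\<^sup>2 / 8 \<le> a\<^sup>2 + 2 * exp s * (1 - cos \<theta>)"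
    using \<open>a\<^sup>2 \<le> (2 * s)\<^sup>2\<close> by (simp add: power_mult_distrib)
  moreover have "(106 / 100 * a)\<^sup>2 \<le> a\<^sup>2 + a\<^sup>2 / 8"
    unfolding power_mult_distrib by (simp add: power2_eq_square)
  ultimately show "(106 / 100 * (exp s - 1))\<^sup>2 \<le> (norm (exp (Complex s \<theta>) - 1))\<^sup>2"
    by (simp add: norm_exp_minus_1_squared a_def)
qed simp

lemma Re_partition_log_term_le:
  assumes "0 < Re z"
  shows "Re (partition_log_term m z) \<le> Re (partition_log_term m (of_real (Re z)))"
proof -
  have "exp (real (Suc m) * Re z) - 1 \<le> norm (exp (of_nat (Suc m) * z) - 1)"
    using norm_triangle_ineq2[of "exp (of_nat (Suc m) * z)" 1] by (simp add: norm_exp_eq_Re)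
  moreover have "0 < exp (real (Suc m) * Re z) - 1" using assms by (simp del: of_nat_Suc)
  ultimately have "inverse (norm (exp (of_nat (Suc m) * z) - 1))
      \<le> inverse (exp (real (Suc m) * Re z) - 1)"
    by (rule le_imp_inverse_le)
  then have "norm (partition_log_term m z)
      \<le> inverse (real (Suc m)) * inverse (exp (real (Suc m) * Re z) - 1)"
    unfolding partition_log_term_def norm_mult norm_inverse norm_of_nat
    by (intro mult_left_mono) simp_all
  then show ?thesis
    unfolding partition_log_term_of_real Re_complex_of_real
    using complex_Re_le_cmod[of "partition_log_term m z"] by linarith
qed

lemma Re_partition_log_diff_ge:
  assumes "0 < Re z"
  shows "Re (partition_log_term 0 (of_real (Re z))) - Re (partition_log_term 0 z)
    \<le> Re (partition_log (of_real (Re z))) - Re (partition_log z)"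
proof -
  define d where "d m = Re (partition_log_term m (of_real (Re z))) - Re (partition_log_term m z)"
    for m
  have sums: "(\<lambda>m. Re (partition_log_term m w)) sums Re (partition_log w)" if "0 < Re w" for w
    unfolding partition_log_def
    using summable_sums[OF summable_norm_cancel[OF summable_norm_partition_log_term[OF that]]]
    by (rule sums_Re)
  have d_sums: "d sums (Re (partition_log (of_real (Re z))) - Re (partition_log z))"
    unfolding d_def using assms by (intro sums_diff sums) auto
  have "0 \<le> d m" for m
    using Re_partition_log_term_le[OF assms, of m] by (simp add: d_def)
  then have "d 0 \<le> suminf d"
    using sum_le_suminf[OF sums_summable[OF d_sums], of "{0}"] by simp
  then show ?thesis using sums_unique[OF d_sums] by (simp add: d_def)
qed

lemma Re_partition_log_off_axis:
  assumes s: "0 < s" "s \<le> 1" and \<theta>: "s \<le> \<bar>\<theta>\<bar>" "\<bar>\<theta>\<bar> \<le> pi"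
  shows "Re (partition_log (Complex s \<theta>)) \<le> Re (partition_log (of_real s)) - 1 / (40 * s)"
proof -
  define a where "a = exp s - 1"
  have a_pos: "0 < a" using s by (simp add: a_def)
  have "exp s \<le> 1 + s + s\<^sup>2" using s by (intro exp_bound) auto
  also have "s\<^sup>2 \<le> s" using s by (simp add: power2_eq_square mult_left_le)
  finally have a_le: "a \<le> 2 * s" by (simp add: a_def)
  have "Re (partition_log_term 0 (Complex s \<theta>)) \<le> norm (partition_log_term 0 (Complex s \<theta>))"
    by (rule complex_Re_le_cmod)
  also have "\<dots> = inverse (norm (exp (Complex s \<theta>) - 1))"
    by (simp add: partition_log_term_def norm_inverse)
  also have "\<dots> \<le> inverse (106 / 100 * a)"
    using norm_exp_minus_1_ge_off_axis[OF s \<theta>] a_pos by (intro le_imp_inverse_le) (auto simp: a_def)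
  also have "\<dots> = inverse a - 6 / 106 * inverse a" using a_pos by (simp add: field_simps)
  also have "\<dots> \<le> inverse a - 6 / 106 * inverse (2 * s)"
    using a_pos a_le s by (intro diff_left_mono mult_left_mono le_imp_inverse_le) auto
  also have "\<dots> \<le> inverse a - 1 / (40 * s)" using s by (simp add: field_simps)
  finally have "Re (partition_log_term 0 (Complex s \<theta>))
      \<le> Re (partition_log_term 0 (of_real s)) - 1 / (40 * s)"
    unfolding partition_log_term_of_real Re_complex_of_real by (simp add: a_def)
  then show ?thesis using Re_partition_log_diff_ge[of "Complex s \<theta>"] s by simp
qed

section \<open>The circle method\<close>

locale circle_method =
  fixes C K s :: real
  assumes K_pos: "0 < K"
    and rem_le: "\<And>z. z \<in> small_sector \<Longrightarrow> norm (partition_log_rem z - of_real C) \<le> K * norm z"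
    and s_pos: "0 < s" and s_le_1: "s \<le> 1"
begin

definition X :: real where
  "X = pi\<^sup>2 / (6 * s)"

(* For X / s = n this is the integrand of the n-th Fourier coefficient, with s the saddle point. *)
definition integrand :: "real \<Rightarrow> complex" where
  "integrand \<theta> = exp (partition_log (Complex s \<theta>) + of_real (X / s) * Complex s \<theta>)"

definition peak :: real where
  "peak = exp (2 * X + C) * sqrt s"

definition major_const :: real where
  "major_const = exp (1 + 4 * K) * (1536 + (4 * K + 48 * K\<^sup>2)) + 2"

definition deviation :: "real \<Rightarrow> complex" where
  "deviation t = partition_log_rem (Complex s (s * t)) - of_real C"

definition log_error :: "real \<Rightarrow> real" where
  "log_error t = X * t ^ 4 / (1 + t\<^sup>2) + ln (1 + t\<^sup>2) / 4 + Re (deviation t)"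

definition phase_error :: "real \<Rightarrow> real" where
  "phase_error t = X * t ^ 3 / (1 + t\<^sup>2) + arctan t / 2 + Im (deviation t)"

lemma X_ge_1: "1 \<le> X"
  unfolding X_def using s_pos s_le_1 pi_squared_bounds by (subst pos_le_divide_eq) auto

lemma s_le: "s \<le> 2 / X"
  unfolding X_def using s_pos pi_squared_bounds by (simp add: field_simps)

lemma peak_pos: "0 < peak"
  using s_pos by (simp add: peak_def)

lemma norm_deviation_le:
  assumes "\<bar>t\<bar> \<le> 1"
  shows "norm (deviation t) \<le> 4 * K / X"
proof -
  have t_le: "s * \<bar>t\<bar> \<le> s" using s_pos assms by (simp add: mult_left_le)
  moreover have "norm (Complex s (s * t)) \<le> s + s * \<bar>t\<bar>"
    using cmod_le[of "Complex s (s * t)"] s_pos by (simp add: abs_mult)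
  ultimately have norm_le: "norm (Complex s (s * t)) \<le> 2 * s" by linarith
  then have "Complex s (s * t) \<in> small_sector"
    using t_le s_pos s_le_1 by (simp add: small_sector_def sector_def abs_mult)
  then have "norm (deviation t) \<le> K * norm (Complex s (s * t))"
    unfolding deviation_def by (rule rem_le)
  also have "\<dots> \<le> K * (2 * (2 / X))" using K_pos norm_le s_le by (intro mult_left_mono) auto
  finally show ?thesis by (simp add: mult.commute)
qed

lemma Ln_Complex_1: "Ln (Complex 1 t) = Complex (ln (1 + t\<^sup>2) / 2) (arctan t)"
proof (rule complex_eqI)
  have "Complex 1 t \<noteq> 0" by (simp add: complex_eq_iff)
  moreover have "norm (Complex 1 t) = sqrt (1 + t\<^sup>2)" by (simp add: cmod_def)
  ultimately show "Re (Ln (Complex 1 t)) = Re (Complex (ln (1 + t\<^sup>2) / 2) (arctan t))"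
    by (simp add: ln_sqrt add_pos_nonneg)
  show "Im (Ln (Complex 1 t)) = Im (Complex (ln (1 + t\<^sup>2) / 2) (arctan t))"
    by (subst Im_Ln_eq) (auto simp: complex_eq_iff)
qed

lemma exponent_eq:
  "partition_log (Complex s (s * t)) + of_real (X / s) * Complex s (s * t)
     = Complex (2 * X + C + ln s / 2 - X * t\<^sup>2 + log_error t) (phase_error t)"
proof -
  define z where "z = Complex s (s * t)"
  have z: "z = of_real s * Complex 1 t" by (simp add: z_def complex_eq_iff)
  have "Ln z = of_real (ln s) + Ln (Complex 1 t)"
    unfolding z using s_pos by (subst Ln_times_of_real) (auto simp: complex_eq_iff)
  moreover have "of_real (pi\<^sup>2 / 6) / z = of_real X / Complex 1 t"
    unfolding z X_def using s_pos by (simp add: field_simps)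
  moreover have "of_real (X / s) * z = of_real X * Complex 1 t"
    unfolding z using s_pos by simp
  ultimately have exponent: "partition_log z + of_real (X / s) * z
      = of_real X / Complex 1 t + (of_real (ln s) + Ln (Complex 1 t)) / 2 + deviation t + of_real C
      + of_real X * Complex 1 t"
    unfolding deviation_def partition_log_rem_def z_def[symmetric] by simp
  have t_pos: "0 < 1 + t\<^sup>2" by (simp add: add_pos_nonneg)
  have "1 / (1 + t\<^sup>2) = 1 - t\<^sup>2 + t ^ 4 / (1 + t\<^sup>2)" "t / (1 + t\<^sup>2) = t - t ^ 3 / (1 + t\<^sup>2)"
    using t_pos by (simp_all add: field_simps power4_eq_xxxx power3_eq_cube power2_eq_square)
  then have "X / (1 + t\<^sup>2) = X - X * t\<^sup>2 + X * t ^ 4 / (1 + t\<^sup>2)"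
      "X * t / (1 + t\<^sup>2) = X * t - X * t ^ 3 / (1 + t\<^sup>2)"
    by (metis right_diff_distrib distrib_left times_divide_eq_right mult_1_right)+
  then show ?thesis
    unfolding z_def[symmetric] exponent Ln_Complex_1
    by (intro complex_eqI) (simp_all
        add: log_error_def phase_error_def Re_divide Im_divide add_divide_distrib)
qed

lemma Re_integrand_eq:
  "Re (integrand (s * t)) = peak * exp (- X * t\<^sup>2) * (exp (log_error t) * cos (phase_error t))"
proof -
  have "exp (ln s / 2) = sqrt s" using s_pos by (simp add: ln_sqrt[symmetric])
  moreover have "2 * X + C + ln s / 2 - X * t\<^sup>2 + log_error t
      = (2 * X + C) + ln s / 2 + (- X * t\<^sup>2) + log_error t"
    by simp
  ultimately show ?thesis
    unfolding integrand_def exponent_eq Re_exp complex.sel peak_def by (simp only: exp_add mult_ac)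
qed

lemma log_error_bounds:
  assumes "\<bar>t\<bar> \<le> 1"
  defines "u \<equiv> X * t\<^sup>2"
  shows "\<bar>log_error t\<bar> \<le> (u\<^sup>2 + u + 4 * K) / X" "log_error t \<le> u / 2 + (1 + 4 * K)"
proof -
  have t_pos: "0 < 1 + t\<^sup>2" and t_le: "t\<^sup>2 \<le> 1" using assms(1)
    by (simp_all add: add_pos_nonneg abs_square_le_1)
  have u_nonneg: "0 \<le> u" using X_ge_1 by (simp add: u_def)
  have deviation: "\<bar>Re (deviation t)\<bar> \<le> 4 * K / X"
    using norm_deviation_le[OF assms(1)] abs_Re_le_cmod[of "deviation t"] by linarith
  have quartic_nonneg: "0 \<le> X * t ^ 4 / (1 + t\<^sup>2)" using X_ge_1 t_pos by simp
  have "X * t ^ 4 / (1 + t\<^sup>2) \<le> X * t ^ 4 / 1"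
    using X_ge_1 t_pos by (intro divide_left_mono) auto
  also have "\<dots> = u\<^sup>2 / X"
    using X_ge_1 by (simp add: u_def power_mult_distrib power2_eq_square power4_eq_xxxx)
  finally have quartic_le: "X * t ^ 4 / (1 + t\<^sup>2) \<le> u\<^sup>2 / X" .
  have "X * t ^ 4 / (1 + t\<^sup>2) = u * (t\<^sup>2 / (1 + t\<^sup>2))"
    by (simp add: u_def power2_eq_square power4_eq_xxxx)
  also have "\<dots> \<le> u * (1 / 2)" using u_nonneg t_le t_pos
    by (intro mult_left_mono) (auto simp: field_simps)
  finally have quartic_le_half: "X * t ^ 4 / (1 + t\<^sup>2) \<le> u / 2" by simp
  have log: "0 \<le> ln (1 + t\<^sup>2)" "ln (1 + t\<^sup>2) \<le> u / X" "ln (1 + t\<^sup>2) \<le> 1"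
    using ln_add_one_self_le_self[of "t\<^sup>2"] t_le X_ge_1 by (simp_all add: u_def)
  show "\<bar>log_error t\<bar> \<le> (u\<^sup>2 + u + 4 * K) / X"
    unfolding log_error_def add_divide_distrib using quartic_nonneg quartic_le log deviation
    by linarith
  have "4 * K / X \<le> 4 * K / 1" using K_pos X_ge_1 by (intro divide_left_mono) auto
  then show "log_error t \<le> u / 2 + (1 + 4 * K)"
    unfolding log_error_def using quartic_le_half log deviation by linarith
qed

lemma phase_error_squared_le:
  assumes "\<bar>t\<bar> \<le> 1"
  defines "u \<equiv> X * t\<^sup>2"
  shows "(phase_error t)\<^sup>2 \<le> 3 * (u ^ 3 + u + 16 * K\<^sup>2) / X"
proof -
  have t_pos: "0 < 1 + t\<^sup>2" by (simp add: add_pos_nonneg)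
  have "(phase_error t)\<^sup>2 \<le> 3 * ((X * t ^ 3 / (1 + t\<^sup>2))\<^sup>2 + (arctan t / 2)\<^sup>2 + (Im (deviation t))\<^sup>2)"
    unfolding phase_error_def by (rule square_sum3_le)
  also have "(X * t ^ 3 / (1 + t\<^sup>2))\<^sup>2 \<le> u ^ 3 / X"
  proof -
    have "(X * t ^ 3 / (1 + t\<^sup>2))\<^sup>2 \<le> (X * t ^ 3)\<^sup>2 / 1"
      unfolding power_divide using t_pos by (intro divide_left_mono) (auto simp: one_le_power)
    also have "\<dots> = u ^ 3 / X"
      using X_ge_1 by (simp add: u_def power_mult_distrib power2_eq_square power3_eq_cube)
    finally show ?thesis .
  qed
  also have "(arctan t / 2)\<^sup>2 \<le> u / X"
  proof -
    have "\<bar>arctan t / 2\<bar> \<le> \<bar>t\<bar>" using abs_arctan_le[of t] by simp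
    then have "(arctan t / 2)\<^sup>2 \<le> t\<^sup>2" by (simp only: abs_le_square_iff)
    then show ?thesis using X_ge_1 by (simp add: u_def)
  qed
  also have "(Im (deviation t))\<^sup>2 \<le> 16 * K\<^sup>2 / X"
  proof -
    have "(Im (deviation t))\<^sup>2 \<le> (4 * K / X)\<^sup>2"
      using norm_deviation_le[OF assms(1)] abs_Im_le_cmod[of "deviation t"] K_pos X_ge_1
      by (simp add: abs_le_square_iff[symmetric])
    also have "\<dots> \<le> 16 * K\<^sup>2 / X"
      unfolding power_divide power_mult_distrib using X_ge_1
      by (intro frac_le) (auto simp: self_le_power)
    finally show ?thesis .
  qed
  finally show ?thesis by (simp add: add_divide_distrib)
qed

lemma Re_integrand_major_arc:
  assumes "\<bar>t\<bar> \<le> 1"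
  shows "\<bar>Re (integrand (s * t)) - peak * exp (- X * t\<^sup>2)\<bar>
      \<le> peak * (major_const / X * exp (- X * t\<^sup>2 / 8))"
proof -
  define u c where "u = X * t\<^sup>2" and "c = 4 * K + 48 * K\<^sup>2"
  have u_nonneg: "0 \<le> u" and c_nonneg: "0 \<le> c" using X_ge_1 K_pos by (simp_all add: u_def c_def)
  have "\<bar>log_error t\<bar> + (phase_error t)\<^sup>2 \<le> (u\<^sup>2 + u + 4 * K) / X + 3 * (u ^ 3 + u + 16 * K\<^sup>2) / X"
    unfolding u_def by (intro add_mono log_error_bounds(1) phase_error_squared_le assms)
  also have "\<dots> = (u\<^sup>2 + 4 * u + 3 * u ^ 3 + c) / X"
    unfolding add_divide_distrib[symmetric] c_def by (rule arg_cong[of _ _ "\<lambda>y. y / X"]) simp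
  finally have errors: "\<bar>log_error t\<bar> + (phase_error t)\<^sup>2 \<le> (u\<^sup>2 + 4 * u + 3 * u ^ 3 + c) / X" .
  have "Re (integrand (s * t)) - peak * exp (- u)
      = peak * exp (- u) * (exp (log_error t) * cos (phase_error t) - 1)"
    unfolding Re_integrand_eq by (simp add: u_def algebra_simps)
  then have "\<bar>Re (integrand (s * t)) - peak * exp (- u)\<bar>
      = peak * exp (- u) * \<bar>exp (log_error t) * cos (phase_error t) - 1\<bar>"
    using peak_pos by (simp add: abs_mult)
  also have "\<dots> \<le> peak * exp (- u)
      * ((\<bar>log_error t\<bar> + (phase_error t)\<^sup>2) * exp (max (log_error t) 0))"
    using peak_pos by (intro mult_left_mono abs_exp_cos_minus_1_le) auto
  also have "\<dots> \<le> peak * exp (- u)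
      * (((u\<^sup>2 + 4 * u + 3 * u ^ 3 + c) / X) * exp (u / 2 + (1 + 4 * K)))"
    using peak_pos errors log_error_bounds(2)[OF assms] u_nonneg c_nonneg K_pos X_ge_1
    by (intro mult_left_mono mult_mono) (simp_all add: u_def)
  also have "\<dots> \<le> peak * exp (- u)
      * (((1536 + c) * exp (3 * u / 8) / X) * exp (u / 2 + (1 + 4 * K)))"
    using peak_pos u_nonneg c_nonneg X_ge_1
    by (intro mult_left_mono mult_right_mono divide_right_mono cubic_le_exp) auto
  also have "\<dots> = peak * (exp (1 + 4 * K) * (1536 + c) / X
      * (exp (- u) * exp (3 * u / 8) * exp (u / 2)))"
    by (simp add: exp_add)
  also have "exp (- u) * exp (3 * u / 8) * exp (u / 2) = exp (- u / 8)"
    by (simp flip: exp_add)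
  also have "peak * (exp (1 + 4 * K) * (1536 + c) / X * exp (- u / 8))
      \<le> peak * (major_const / X * exp (- u / 8))"
    using peak_pos X_ge_1
    by (intro mult_left_mono mult_right_mono divide_right_mono) (auto simp: major_const_def c_def)
  finally show ?thesis by (simp add: u_def)
qed

lemma norm_integrand_minor_arc:
  assumes "s \<le> \<bar>\<theta>\<bar>" "\<bar>\<theta>\<bar> \<le> pi"
  shows "norm (integrand \<theta>) \<le> peak * (exp K * exp (- X / 80))"
proof -
  have small: "complex_of_real s \<in> small_sector"
    using s_pos s_le_1 by (intro of_real_small_sector) auto
  have "Re (partition_log_rem (of_real s)) - C \<le> norm (partition_log_rem (of_real s) - of_real C)"
    using complex_Re_le_cmod[of "partition_log_rem (of_real s) - of_real C"] by simp
  also have "\<dots> \<le> K * s" using rem_le[OF small] s_pos by simp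
  also have "\<dots> \<le> K * 1" using K_pos s_le_1 by (intro mult_left_mono) auto
  finally have rem: "Re (partition_log_rem (of_real s)) \<le> C + K" by simp
  have log: "partition_log (of_real s) = of_real (X + ln s / 2) + partition_log_rem (of_real s)"
    using s_pos unfolding partition_log_rem_def X_def by (simp add: Ln_of_real)
  have X_le: "X / 80 \<le> 1 / (40 * s)"
    unfolding X_def using s_pos pi_squared_bounds by (simp add: field_simps)
  have "Re (partition_log (Complex s \<theta>)) + X \<le> Re (partition_log (of_real s)) - 1 / (40 * s) + X"
    using Re_partition_log_off_axis[OF s_pos s_le_1 assms] by simp
  also have "\<dots> \<le> 2 * X + C + ln s / 2 + K - X / 80"
    unfolding log using rem X_le by simp
  finally have "exp (Re (partition_log (Complex s \<theta>)) + X)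
      \<le> exp (2 * X + C + ln s / 2 + K - X / 80)" by simp
  also have "\<dots> = exp (2 * X + C) * exp (ln s / 2) * (exp K * exp (- X / 80))"
    by (simp flip: exp_add)
  also have "exp (ln s / 2) = sqrt s" using s_pos by (simp add: ln_sqrt[symmetric])
  finally show ?thesis using s_pos by (simp add: integrand_def peak_def)
qed

definition gauss_rate :: real where
  "gauss_rate = X / s\<^sup>2"

lemma gauss_rate_pos: "0 < gauss_rate"
  using X_ge_1 s_pos by (simp add: gauss_rate_def)

lemma major_const_ge: "2 \<le> major_const"
  using K_pos by (simp add: major_const_def)

lemma gauss_tail_le:
  assumes "s \<le> \<bar>\<theta>\<bar>"
  shows "exp (- gauss_rate * \<theta>\<^sup>2) \<le> major_const / X * exp (- (gauss_rate / 8) * \<theta>\<^sup>2)"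
proof -
  have "s\<^sup>2 \<le> \<theta>\<^sup>2" using assms s_pos by (subst abs_le_square_iff[symmetric]) simp
  then have "gauss_rate * s\<^sup>2 \<le> gauss_rate * \<theta>\<^sup>2" using gauss_rate_pos by (intro mult_left_mono) auto
  then have X_le: "X \<le> gauss_rate * \<theta>\<^sup>2" using s_pos by (simp add: gauss_rate_def)
  have "X / 2 \<le> exp (X / 2)" using exp_ge_add_one_self[of "X / 2"] by linarith
  then have "inverse (exp (X / 2)) \<le> inverse (X / 2)" using X_ge_1 by (intro le_imp_inverse_le) auto
  then have exp_le: "exp (- (X / 2)) \<le> 2 / X" by (simp add: exp_minus)
  have "exp (- gauss_rate * \<theta>\<^sup>2) \<le> exp (- (X / 2)) * exp (- (gauss_rate / 8) * \<theta>\<^sup>2)"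
    using X_le X_ge_1 by (simp flip: exp_add)
  also have "exp (- (X / 2)) \<le> major_const / X"
    using exp_le divide_right_mono[OF major_const_ge, of X] X_ge_1 by linarith
  finally show ?thesis by (simp add: mult_right_mono)
qed

definition cut :: "real \<Rightarrow> real \<Rightarrow> real" where
  "cut \<theta> c = (if \<theta> \<in> {-pi..pi} then c else 0)"

lemma abs_integrand_minus_gauss_le:
  "\<bar>cut \<theta> (Re (integrand \<theta>)) - peak * exp (- gauss_rate * \<theta>\<^sup>2)\<bar>
    \<le> peak * (major_const / X * exp (- (gauss_rate / 8) * \<theta>\<^sup>2) + cut \<theta> (exp K * exp (- X / 80)))"
proof (cases "\<bar>\<theta>\<bar> \<le> s")
  case True
  define t where "t = \<theta> / s"
  have t: "\<bar>t\<bar> \<le> 1" "\<theta> = s * t" using s_pos True by (auto simp: t_def)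
  have "\<theta> \<in> {-pi..pi}" using True s_le_1 pi_gt3 by auto
  then have "\<bar>cut \<theta> (Re (integrand \<theta>)) - peak * exp (- gauss_rate * \<theta>\<^sup>2)\<bar>
      = \<bar>Re (integrand (s * t)) - peak * exp (- X * t\<^sup>2)\<bar>"
    using s_pos by (simp add: cut_def gauss_rate_def t(2) power_mult_distrib)
  also have "\<dots> \<le> peak * (major_const / X * exp (- X * t\<^sup>2 / 8))"
    by (rule Re_integrand_major_arc[OF t(1)])
  also have "- X * t\<^sup>2 / 8 = - (gauss_rate / 8) * \<theta>\<^sup>2"
    using s_pos by (simp add: gauss_rate_def t(2) power_mult_distrib)
  also have "peak * (major_const / X * exp (- (gauss_rate / 8) * \<theta>\<^sup>2))
      \<le> peak * (major_const / X * exp (- (gauss_rate / 8) * \<theta>\<^sup>2) + cut \<theta> (exp K * exp (- X / 80)))"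
    using peak_pos by (intro mult_left_mono) (auto simp: cut_def)
  finally show ?thesis .
next
  case False
  have "\<bar>Re (integrand \<theta>)\<bar> \<le> peak * (exp K * exp (- X / 80))" if "\<theta> \<in> {-pi..pi}"
    using abs_Re_le_cmod[of "integrand \<theta>"] norm_integrand_minor_arc[of \<theta>] that False by force
  then have "\<bar>cut \<theta> (Re (integrand \<theta>))\<bar> \<le> peak * cut \<theta> (exp K * exp (- X / 80))"
    by (simp add: cut_def)
  moreover have "peak * exp (- gauss_rate * \<theta>\<^sup>2)
      \<le> peak * (major_const / X * exp (- (gauss_rate / 8) * \<theta>\<^sup>2))"
    using False peak_pos by (intro mult_left_mono gauss_tail_le) auto
  moreover have "0 \<le> peak * exp (- gauss_rate * \<theta>\<^sup>2)" using peak_pos by simp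
  ultimately show ?thesis unfolding distrib_left by linarith
qed

lemma partition_count_gauss:
  assumes "real n = X / s"
  shows "\<bar>2 * pi * partition_count n - peak * sqrt (pi / gauss_rate)\<bar>
     \<le> peak * (major_const / X * sqrt (8 * pi / gauss_rate) + 2 * pi * (exp K * exp (- X / 80)))"
proof -
  have "((\<lambda>\<theta>. Re (integrand \<theta>)) has_integral (2 * pi * partition_count n)) {-pi..pi}"
    using has_integral_linear[OF has_integral_exp_partition_log[OF s_pos, of n] bounded_linear_Re]
    by (simp add: o_def integrand_def flip: assms)
  then have "((\<lambda>\<theta>. cut \<theta> (Re (integrand \<theta>))) has_integral (2 * pi * partition_count n)) UNIV"
    unfolding cut_def by (subst has_integral_restrict_UNIV)
  then have difference: "((\<lambda>\<theta>. cut \<theta> (Re (integrand \<theta>))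
      - peak * exp (- gauss_rate * \<theta>\<^sup>2)) has_integral
      (2 * pi * partition_count n - peak * sqrt (pi / gauss_rate))) UNIV"
    using gauss_rate_pos by (intro has_integral_diff has_integral_mult_right has_integral_gaussian)
  have "((\<lambda>\<theta>. cut \<theta> (exp K * exp (- X / 80))) has_integral 2 * pi * (exp K * exp (- X / 80))) UNIV"
    unfolding cut_def has_integral_restrict_UNIV
    using has_integral_const_real[of "exp K * exp (- X / 80)" "- pi" pi] by simp
  then have majorant: "((\<lambda>\<theta>. peak * (major_const / X * exp (- (gauss_rate / 8) * \<theta>\<^sup>2)
      + cut \<theta> (exp K * exp (- X / 80)))) has_integral
      (peak * (major_const / X * sqrt (pi / (gauss_rate / 8))
        + 2 * pi * (exp K * exp (- X / 80))))) UNIV"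
    using gauss_rate_pos
    by (intro has_integral_mult_right has_integral_add has_integral_gaussian) auto
  have "\<bar>integral UNIV (\<lambda>\<theta>. cut \<theta> (Re (integrand \<theta>)) - peak * exp (- gauss_rate * \<theta>\<^sup>2))\<bar>
      \<le> integral UNIV (\<lambda>\<theta>. peak
        * (major_const / X * exp (- (gauss_rate / 8) * \<theta>\<^sup>2) + cut \<theta> (exp K * exp (- X / 80))))"
    using integral_norm_bound_integral[OF has_integral_integrable[OF difference]
        has_integral_integrable[OF majorant]]
    by (simp only: real_norm_def abs_integrand_minus_gauss_le)
  then show ?thesis
    by (simp only: integral_unique[OF difference] integral_unique[OF majorant])
        (simp add: mult.commute)
qed

lemma peak_le: "peak \<le> peak * sqrt (pi / gauss_rate) * X\<^sup>2"
proof -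
  have "X * (6 / pi\<^sup>2) = 1 / s" using s_pos unfolding X_def by simp
  then have "gauss_rate = X * (X * (6 / pi\<^sup>2))\<^sup>2"
    by (simp add: gauss_rate_def power_divide)
  then have rate_eq: "gauss_rate = 36 / (pi\<^sup>2 * pi\<^sup>2) * X ^ 3"
    by (simp add: power2_eq_square power3_eq_cube)
  have "9 * 9 \<le> pi\<^sup>2 * pi\<^sup>2" using pi_squared_bounds by (intro mult_mono) auto
  then have "36 / (pi\<^sup>2 * pi\<^sup>2) \<le> 1" by (subst divide_le_eq_1_pos) auto
  then have "36 / (pi\<^sup>2 * pi\<^sup>2) * X ^ 3 \<le> 1 * X ^ 3" using X_ge_1 by (intro mult_right_mono) auto
  then have "gauss_rate \<le> X ^ 3" by (simp add: rate_eq)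
  also have "X ^ 3 \<le> X ^ 4" using X_ge_1 by (intro power_increasing) auto
  also have "X ^ 4 \<le> pi * X ^ 4" using mult_right_mono[of 1 pi "X ^ 4"] pi_gt3 by simp
  finally have "1 \<le> (pi / gauss_rate) * (X\<^sup>2)\<^sup>2" using gauss_rate_pos by (simp add: field_simps)
  then have "sqrt 1 \<le> sqrt ((pi / gauss_rate) * (X\<^sup>2)\<^sup>2)" by (subst real_sqrt_le_iff)
  then have "1 \<le> sqrt (pi / gauss_rate) * X\<^sup>2"
    by (simp only: real_sqrt_mult real_sqrt_abs abs_power2 real_sqrt_one)
  then have "peak * 1 \<le> peak * (sqrt (pi / gauss_rate) * X\<^sup>2)" using peak_pos
    by (intro mult_left_mono) auto
  then show ?thesis by (simp add: mult.assoc)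
qed

lemma exp_minus_X_le: "exp (- X / 80) \<le> 240 ^ 3 / X ^ 3"
proof -
  have "X / 240 \<le> exp (X / 240)" using exp_ge_add_one_self[of "X / 240"] by linarith
  then have "(X / 240) ^ 3 \<le> exp (X / 240) ^ 3" using X_ge_1 by (intro power_mono) auto
  also have "exp (X / 240) ^ 3 = exp (X / 80)" by (simp flip: exp_of_nat_mult)
  finally have "inverse (exp (X / 80)) \<le> inverse ((X / 240) ^ 3)"
    using X_ge_1 by (intro le_imp_inverse_le) auto
  then show ?thesis by (simp add: exp_minus power_divide)
qed

definition rel_const :: real where
  "rel_const = 3 * major_const + 2 * pi * exp K * 240 ^ 3"

lemma rel_const_pos: "0 < rel_const"
  unfolding rel_const_def using major_const_ge by (intro add_pos_pos) auto

lemma partition_count_gauss_relative: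
  assumes "real n = X / s"
  shows "\<bar>2 * pi * partition_count n - peak * sqrt (pi / gauss_rate)\<bar>
      \<le> rel_const / X * (peak * sqrt (pi / gauss_rate))"
proof -
  define G where "G = peak * sqrt (pi / gauss_rate)"
  have G_pos: "0 < G" using peak_pos gauss_rate_pos by (simp add: G_def)
  have "sqrt (8 * pi / gauss_rate) = sqrt 8 * sqrt (pi / gauss_rate)" by (simp flip: real_sqrt_mult)
  then have "peak * (major_const / X * sqrt (8 * pi / gauss_rate)) = G * (major_const / X) * sqrt 8"
    by (simp add: G_def)
  also have "sqrt 8 \<le> 3" by (rule real_le_lsqrt) auto
  then have "G * (major_const / X) * sqrt 8 \<le> G * (major_const / X) * 3"
    using G_pos major_const_ge X_ge_1 by (intro mult_left_mono) auto
  finally have major: "peak * (major_const / X * sqrt (8 * pi / gauss_rate))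
      \<le> 3 * major_const / X * G"
    by (simp add: mult_ac)
  have "peak * (2 * pi * (exp K * exp (- X / 80)))
      \<le> (G * X\<^sup>2) * (2 * pi * (exp K * (240 ^ 3 / X ^ 3)))"
    using peak_le exp_minus_X_le peak_pos G_pos
    by (intro mult_mono mult_left_mono) (auto simp: G_def)
  also have "\<dots> = 2 * pi * exp K * 240 ^ 3 / X * G"
    using X_ge_1 by (simp add: field_simps power2_eq_square power3_eq_cube)
  finally have minor: "peak * (2 * pi * (exp K * exp (- X / 80)))
      \<le> 2 * pi * exp K * 240 ^ 3 / X * G" .
  have "\<bar>2 * pi * partition_count n - G\<bar>
      \<le> 3 * major_const / X * G + 2 * pi * exp K * 240 ^ 3 / X * G"
    using partition_count_gauss[OF assms] major minor unfolding G_def[symmetric] distrib_left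
    by linarith
  also have "\<dots> = rel_const / X * G"
    by (simp add: rel_const_def add_divide_distrib distrib_right)
  finally show ?thesis by (simp only: G_def)
qed

lemma peak_gauss_eq: "peak * sqrt (pi / gauss_rate) = exp C * sqrt (6 / pi) * s\<^sup>2 * exp (2 * X)"
proof -
  have "s * (pi / gauss_rate) = 6 / pi * (s\<^sup>2)\<^sup>2"
    using s_pos unfolding gauss_rate_def X_def by (simp add: field_simps power2_eq_square)
  then have "sqrt s * sqrt (pi / gauss_rate) = sqrt (6 / pi) * s\<^sup>2"
    by (metis abs_power2 real_sqrt_abs real_sqrt_mult)
  then show ?thesis by (simp add: peak_def exp_add mult_ac)
qed

theorem partition_count_saddle:
  assumes "real n = X / s"
  defines "main \<equiv> exp C * sqrt (6 / pi) * s\<^sup>2 * exp (2 * X) / (2 * pi)"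
  shows "\<bar>partition_count n / main - 1\<bar> \<le> rel_const / X"
proof (rule mult_right_le_imp_le)
  show main_pos: "0 < 2 * pi * main" using s_pos by (simp add: main_def)
  have "(partition_count n / main - 1) * (2 * pi * main)
      = 2 * pi * partition_count n - 2 * pi * main"
    using main_pos by (auto simp: field_simps)
  then have "\<bar>partition_count n / main - 1\<bar> * (2 * pi * main)
      = \<bar>2 * pi * partition_count n - 2 * pi * main\<bar>"
    using abs_mult[of _ "2 * pi * main"] abs_of_pos[OF main_pos] by metis
  also have "\<dots> \<le> rel_const / X * (2 * pi * main)"
    using partition_count_gauss_relative[OF assms(1)] by (simp add: peak_gauss_eq main_def)
  finally show "\<bar>partition_count n / main - 1\<bar> * (2 * pi * main)
      \<le> rel_const / X * (2 * pi * main)" .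
qed

end

section \<open>Asymptotics of the partition numbers\<close>

definition saddle :: "nat \<Rightarrow> real" where
  "saddle N = pi / sqrt (6 * real N)"

lemma sqrt_6_le_pi: "sqrt 6 \<le> pi"
  using pi_squared_bounds by (intro real_le_lsqrt) auto

lemma saddle_bounds:
  assumes "0 < N"
  shows "1 / sqrt N \<le> saddle N" "saddle N \<le> 2 / sqrt N" "0 < saddle N"
proof -
  show "1 / sqrt N \<le> saddle N"
    using assms sqrt_6_le_pi by (simp add: saddle_def real_sqrt_mult field_simps)
  have "2 \<le> sqrt 6" by (rule real_le_rsqrt) simp
  then have "pi \<le> 2 * sqrt 6" using pi_less_4 by linarith
  then show "saddle N \<le> 2 / sqrt N" using assms by (simp add: saddle_def real_sqrt_mult field_simps)
  show "0 < saddle N" using assms by (simp add: saddle_def)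
qed

lemma saddle_squared: "(saddle N)\<^sup>2 = pi\<^sup>2 / (6 * real N)"
  by (simp add: saddle_def power_divide)

lemma saddle_le_1:
  assumes "2 \<le> N"
  shows "saddle N \<le> 1"
proof (rule power2_le_imp_le)
  show "(saddle N)\<^sup>2 \<le> 1\<^sup>2"
    unfolding saddle_squared using assms pi_squared_bounds by (simp add: divide_le_eq)
qed simp

theorem partition_count_asymp:
  "\<exists>A>0. \<exists>K. \<forall>n\<ge>2.
     \<bar>partition_count n / (A / real n * exp (2 * pi * sqrt (real n / 6))) - 1\<bar> \<le> K / sqrt (real n)"
proof -
  obtain C K where K_pos: "0 < K"
    and rem_le: "\<And>z. z \<in> small_sector \<Longrightarrow> norm (partition_log_rem z - of_real C) \<le> K * norm z"
    using partition_log_rem_limit by blast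
  define A where "A = exp C * sqrt (6 / pi) * (pi\<^sup>2 / 6) / (2 * pi)"
  have "\<bar>partition_count n / (A / real n * exp (2 * pi * sqrt (real n / 6))) - 1\<bar>
      \<le> circle_method.rel_const K / sqrt (real n)" if n: "2 \<le> n" for n
  proof -
    interpret circle_method C K "saddle n"
      using K_pos rem_le saddle_bounds(3)[of n] saddle_le_1[OF n] n by unfold_locales auto
    have "X / saddle n = pi\<^sup>2 / (6 * (saddle n)\<^sup>2)" by (simp add: X_def power2_eq_square)
    then have n_eq: "real n = X / saddle n" unfolding saddle_squared using n by simp
    then have "X = real n * saddle n" using s_pos by simp
    also have "\<dots> = pi * (real n / sqrt (real n)) / sqrt 6"
      by (simp add: saddle_def real_sqrt_mult mult_ac)
    finally have X_eq: "X = pi * sqrt (real n / 6)" by (simp add: real_div_sqrt real_sqrt_divide)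
    have "A / real n * exp (2 * pi * sqrt (real n / 6))
        = exp C * sqrt (6 / pi) * (saddle n)\<^sup>2 * exp (2 * X) / (2 * pi)"
      by (simp add: saddle_squared X_eq A_def mult_ac)
    then have "\<bar>partition_count n / (A / real n * exp (2 * pi * sqrt (real n / 6))) - 1\<bar>
        \<le> rel_const / X"
      using partition_count_saddle[OF n_eq] by (simp only:)
    also have "sqrt (real n) \<le> X"
      using mult_left_mono[OF sqrt_6_le_pi, of "sqrt (real n)"]
      by (simp add: X_eq real_sqrt_divide field_simps)
    then have "rel_const / X \<le> rel_const / sqrt (real n)"
      using rel_const_pos n X_ge_1 by (intro divide_left_mono mult_pos_pos) auto
    finally show ?thesis .
  qed
  moreover have "0 < A" by (simp add: A_def)
  ultimately show ?thesis by blast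
qed

lemma abs_ln_one_plus_le:
  fixes e :: real
  assumes "\<bar>e\<bar> \<le> 1 / 2"
  shows "\<bar>ln (1 + e)\<bar> \<le> 2 * \<bar>e\<bar>"
proof -
  have "\<bar>ln (1 + e) - e\<bar> \<le> 2 * e\<^sup>2" using assms by (rule abs_ln_one_plus_x_minus_x_bound)
  also have "e\<^sup>2 = \<bar>e\<bar> * \<bar>e\<bar>" by (simp add: power2_eq_square)
  also have "2 * (\<bar>e\<bar> * \<bar>e\<bar>) \<le> 2 * (\<bar>e\<bar> * (1 / 2))" using assms by (intro mult_left_mono) auto
  finally show ?thesis by linarith
qed

lemma bigo_sequentially_imp_bound:
  fixes f g :: "nat \<Rightarrow> real"
  assumes "f \<in> O(g)" "\<And>n. 0 < n \<Longrightarrow> 0 < g n"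
  obtains C where "0 < C" "\<And>n. 0 < n \<Longrightarrow> \<bar>f n\<bar> \<le> C * g n"
proof -
  obtain c where "0 < c" "\<forall>\<^sub>F n in sequentially. \<bar>f n\<bar> \<le> c * \<bar>g n\<bar>"
    using assms(1) by (auto elim: landau_o.bigE)
  then obtain n0 where c: "0 < c" "\<And>n. n0 \<le> n \<Longrightarrow> \<bar>f n\<bar> \<le> c * \<bar>g n\<bar>"
    by (auto simp: eventually_sequentially)
  define B where "B = (\<Sum>n\<in>{1..<n0}. \<bar>f n\<bar> / g n)"
  have B_nonneg: "0 \<le> B" unfolding B_def using assms(2)
    by (intro sum_nonneg) (simp add: less_imp_le)
  have "\<bar>f n\<bar> \<le> (c + B) * g n" if "0 < n" for n
  proof (cases "n0 \<le> n")
    case True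
    then have "\<bar>f n\<bar> \<le> c * g n" using c(2) assms(2)[OF that] by fastforce
    also have "\<dots> \<le> (c + B) * g n" using B_nonneg assms(2)[OF that] by simp
    finally show ?thesis .
  next
    case False
    then have "\<bar>f n\<bar> / g n \<le> B"
      unfolding B_def using that assms(2) by (intro member_le_sum) (auto simp: less_imp_le)
    then have "\<bar>f n\<bar> \<le> B * g n" using assms(2)[OF that] by (simp add: divide_le_eq)
    also have "\<dots> \<le> (c + B) * g n" using c(1) assms(2)[OF that] by simp
    finally show ?thesis .
  qed
  with c(1) B_nonneg show ?thesis by (intro that[of "c + B"]) auto
qed

theorem ln_partition_count_approx:
  obtains A C where "0 < C"
    "\<And>n. 0 < n \<Longrightarrow> \<bar>ln (partition_count n) - (A - ln n + 2 * pi * sqrt (n / 6))\<bar> \<le> C / sqrt n"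
proof -
  obtain A K where A_pos: "0 < A"
    and asymp: "\<And>n. 2 \<le> n \<Longrightarrow> \<bar>partition_count n / (A / real n * exp (2 * pi * sqrt (real n / 6)))
        - 1\<bar> \<le> K / sqrt (real n)"
    using partition_count_asymp by blast
  define main where "main n = ln A - ln n + 2 * pi * sqrt (n / 6)" for n :: nat
  have "(\<lambda>n. ln (partition_count n) - main n) \<in> O(\<lambda>n. 1 / sqrt n)"
  proof (rule bigoI)
    have "\<forall>\<^sub>F n :: nat in sequentially. K / sqrt n \<le> 1 / 2" by real_asymp
    then show "\<forall>\<^sub>F n in sequentially. norm (ln (partition_count n) - main n)
        \<le> 2 * K * norm (1 / sqrt n)"
      using eventually_ge_at_top[of 2]
    proof eventually_elim
      case (elim n)
      define M where "M = A / real n * exp (2 * pi * sqrt (real n / 6))"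
      define e where "e = partition_count n / M - 1"
      have M_pos: "0 < M" using A_pos elim by (simp add: M_def)
      have "ln (partition_count n) = ln M + ln (1 + e)"
        using M_pos partition_count_pos[of n] by (simp add: e_def ln_div)
      moreover have "ln M = main n"
        unfolding M_def main_def using A_pos elim by (simp add: ln_mult ln_div)
      moreover have "\<bar>e\<bar> \<le> K / sqrt n" using asymp[of n] elim by (simp add: e_def M_def)
      moreover from this have "\<bar>ln (1 + e)\<bar> \<le> 2 * \<bar>e\<bar>" using elim
        by (intro abs_ln_one_plus_le) linarith
      ultimately show ?case by simp
    qed
  qed
  then obtain C where "0 < C" "\<And>n. 0 < n \<Longrightarrow> \<bar>ln (partition_count n) - main n\<bar> \<le> C * (1 / sqrt n)"
    by (rule bigo_sequentially_imp_bound) auto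
  then show ?thesis using that[of C "ln A"] by (simp add: main_def)
qed

section \<open>Ratios of partition numbers\<close>

lemma sqrt_diff_bounds:
  fixes N x :: real
  assumes "0 < N" "0 \<le> x" "x \<le> N"
  shows "x / (2 * sqrt N) \<le> sqrt N - sqrt (N - x)"
    and "sqrt N - sqrt (N - x) \<le> x / (2 * sqrt N) + x\<^sup>2 / (2 * (N * sqrt N))"
proof -
  define r q where "r = sqrt N" and "q = sqrt (N - x)"
  have r: "0 < r" "0 \<le> q" "q \<le> r" "r\<^sup>2 = N" "q\<^sup>2 = N - x" using assms by (auto simp: r_def q_def)
  have x: "x = (r - q) * (r + q)" using r by (simp add: power2_eq_square algebra_simps)
  have "(r - q) * (r + q) \<le> (r - q) * (2 * r)" using r by (intro mult_left_mono) auto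
  then show "x / (2 * sqrt N) \<le> sqrt N - sqrt (N - x)"
    unfolding r_def[symmetric] q_def[symmetric] using r x by (subst pos_divide_le_eq) auto
  have "(r - q) * r \<le> (r - q) * (r + q)" using r by (intro mult_left_mono) auto
  then have "r - q \<le> x / r" using r x by (subst pos_le_divide_eq) auto
  then have "(r - q)\<^sup>2 / (2 * r) \<le> (x / r)\<^sup>2 / (2 * r)"
    using r by (intro divide_right_mono power_mono) auto
  also have "\<dots> = x\<^sup>2 / (2 * (N * r))" unfolding r(4)[symmetric] by (simp add: power_divide mult_ac)
  finally have second_order: "(r - q)\<^sup>2 / (2 * r) \<le> x\<^sup>2 / (2 * (N * r))" .
  have "r - q = x / (2 * r) + (r - q)\<^sup>2 / (2 * r)"
    using r(1) unfolding x by (simp add: field_simps power2_eq_square)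
  then show "sqrt N - sqrt (N - x) \<le> x / (2 * sqrt N) + x\<^sup>2 / (2 * (N * sqrt N))"
    unfolding r_def[symmetric] q_def[symmetric] using second_order by linarith
qed

lemma saddle_mult_eq: "saddle N * x = 2 * pi / sqrt 6 * (x / (2 * sqrt N))"
  by (simp add: saddle_def real_sqrt_mult)

lemma sqrt_shift_bounds:
  fixes N x :: nat
  assumes "0 < N" "x \<le> N"
  shows "saddle N * x \<le> 2 * pi * sqrt (N / 6) - 2 * pi * sqrt (real (N - x) / 6)"
    and "2 * pi * sqrt (N / 6) - 2 * pi * sqrt (real (N - x) / 6)
        \<le> saddle N * x + 3 * ((real x)\<^sup>2 / (N * sqrt N))"
proof -
  define c where "c = 2 * pi / sqrt 6"
  have c_pos: "0 < c" by (simp add: c_def)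
  have "2 \<le> sqrt 6" by (rule real_le_rsqrt) simp
  then have c_le: "c \<le> 4" using pi_less_4 by (simp add: c_def field_simps)
  have diff: "2 * pi * sqrt (N / 6) - 2 * pi * sqrt (real (N - x) / 6)
      = c * (sqrt N - sqrt (real N - real x))"
    using assms by (simp add: c_def real_sqrt_divide of_nat_diff field_simps)
  have saddle: "saddle N * x = c * (x / (2 * sqrt N))" by (simp only: saddle_mult_eq c_def)
  show "saddle N * x \<le> 2 * pi * sqrt (N / 6) - 2 * pi * sqrt (real (N - x) / 6)"
    unfolding diff saddle using c_pos assms by (intro mult_left_mono sqrt_diff_bounds(1)) auto
  have "c * (sqrt N - sqrt (real N - real x))
      \<le> c * (x / (2 * sqrt N) + (real x)\<^sup>2 / (2 * (N * sqrt N)))"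
    using c_pos assms by (intro mult_left_mono sqrt_diff_bounds(2)) auto
  also have "\<dots> = saddle N * x + c / 2 * ((real x)\<^sup>2 / (N * sqrt N))"
    unfolding saddle distrib_left by simp
  also have "c / 2 * ((real x)\<^sup>2 / (N * sqrt N)) \<le> 3 * ((real x)\<^sup>2 / (N * sqrt N))"
    using c_le by (intro mult_right_mono) auto
  finally show "2 * pi * sqrt (N / 6) - 2 * pi * sqrt (real (N - x) / 6)
      \<le> saddle N * x + 3 * ((real x)\<^sup>2 / (N * sqrt N))"
    unfolding diff by simp
qed

lemma abs_ln_diff_le:
  assumes "0 < N" "2 * x \<le> N"
  shows "\<bar>ln (real N) - ln (real (N - x))\<bar> \<le> 2 * (x / N)"
proof -
  have "real (N - x) = N * (1 + - (x / N))" using assms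
    by (simp add: right_diff_distrib of_nat_diff)
  moreover have "0 < 1 + - (real x / N)" using assms by (simp add: field_simps)
  ultimately have "ln (real (N - x)) = ln (real N) + ln (1 + - (x / N))"
    using assms by (simp only: ln_mult_pos of_nat_0_less_iff)
  moreover have "\<bar>ln (1 + - (real x / N))\<bar> \<le> 2 * \<bar>- (real x / N)\<bar>"
    using assms by (intro abs_ln_one_plus_le) (simp add: field_simps)
  ultimately show ?thesis by simp
qed

lemma ln_partition_ratio_approx:
  obtains C where "0 < C"
    "\<And>N x. 0 < N \<Longrightarrow> 2 * x \<le> N \<Longrightarrow> \<bar>ln (partition_count (N - x)) - ln (partition_count N)
    + saddle N * x\<bar>
       \<le> C * (1 / sqrt N + x / N + (real x)\<^sup>2 / (N * sqrt N))"
proof -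
  obtain A K where K_pos: "0 < K"
    and ln_approx: "\<And>n. 0 < n
        \<Longrightarrow> \<bar>ln (partition_count n) - (A - ln n + 2 * pi * sqrt (n / 6))\<bar> \<le> K / sqrt n"
    using ln_partition_count_approx by blast
  have "\<bar>ln (partition_count (N - x)) - ln (partition_count N) + saddle N * x\<bar>
       \<le> (3 * K + 3) * (1 / sqrt N + x / N + (real x)\<^sup>2 / (N * sqrt N))"
    if N: "0 < N" "2 * x \<le> N" for N x
  proof -
    have n_pos: "0 < N - x" using N by simp
    have "sqrt N \<le> sqrt (4 * real (N - x))" using N
      by (intro real_sqrt_le_mono) (auto simp: of_nat_diff)
    then have "sqrt N \<le> 2 * sqrt (N - x)" by (simp add: real_sqrt_mult)
    then have "K * sqrt N \<le> K * (2 * sqrt (N - x))" using K_pos by (intro mult_left_mono) auto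
    then have "K / sqrt (N - x) \<le> 2 * (K / sqrt N)" using n_pos N by (simp add: field_simps)
    then have "\<bar>ln (partition_count (N - x)) - ln (partition_count N) + saddle N * x\<bar>
        \<le> 3 * (K / sqrt N) + 2 * (x / N) + 3 * ((real x)\<^sup>2 / (N * sqrt N))"
      using ln_approx[OF n_pos] ln_approx[OF N(1)] abs_ln_diff_le[OF N] sqrt_shift_bounds[of N x] N
      by linarith
    also have "\<dots> \<le> (3 * K + 3) * (1 / sqrt N) + (3 * K + 3) * (x / N)
        + (3 * K + 3) * ((real x)\<^sup>2 / (N * sqrt N))"
      using K_pos N by (intro add_mono mult_right_mono) (auto intro!: divide_right_mono)
    finally show ?thesis by (simp only: distrib_left)
  qed
  then show ?thesis using that[of "3 * K + 3"] K_pos by auto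
qed

definition partition_ratio :: "nat \<Rightarrow> nat \<Rightarrow> real" where
  "partition_ratio N x = partition_count_minus N x / partition_count N"

lemma partition_ratio_nonneg: "0 \<le> partition_ratio N x"
  by (simp add: partition_ratio_def)

lemma partition_ratio_eq_exp:
  assumes "x \<le> N"
  shows "partition_ratio N x = exp (ln (partition_count (N - x)) - ln (partition_count N))"
  using assms partition_count_pos
  by (simp add: partition_ratio_def partition_count_minus_def exp_diff)

lemma partition_ratio_le:
  obtains C where "0 < C" "\<And>N x. 0 < N \<Longrightarrow> partition_ratio N x \<le> C * N * exp (- (saddle N * x))"
proof -
  obtain A K where K_pos: "0 < K"
    and ln_approx: "\<And>n. 0 < n
        \<Longrightarrow> \<bar>ln (partition_count n) - (A - ln n + 2 * pi * sqrt (n / 6))\<bar> \<le> K / sqrt n"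
    using ln_partition_count_approx by blast
  define B where "B = \<bar>A\<bar> + K + ln (partition_count 0)"
  have ln_0: "0 \<le> ln (real (partition_count 0))" using partition_count_pos[of 0] by simp
  have K_div_le: "K / sqrt n \<le> K" if "0 < n" for n :: nat
    using K_pos that by (simp add: divide_le_eq)
  have upper: "ln (partition_count n) \<le> B + 2 * pi * sqrt (n / 6)" for n
  proof (cases "0 < n")
    case True
    then have "0 \<le> ln (real n)" by simp
    then show ?thesis using ln_approx[OF True] K_div_le[OF True] ln_0 unfolding B_def by linarith
  qed (use K_pos in \<open>simp add: B_def\<close>)
  have lower: "- B - ln N + 2 * pi * sqrt (N / 6) \<le> ln (partition_count N)" if "0 < N" for N
    using ln_approx[OF that] K_div_le[OF that] ln_0 unfolding B_def by linarith
  have "partition_ratio N x \<le> exp (2 * B) * N * exp (- (saddle N * x))" if N: "0 < N" for N x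
  proof (cases "x \<le> N")
    case True
    have "ln (partition_count (N - x)) - ln (partition_count N) \<le> 2 * B + ln N - saddle N * x"
      using upper[of "N - x"] lower[OF N] sqrt_shift_bounds(1)[OF N True] by linarith
    then have "partition_ratio N x \<le> exp (2 * B + ln N - saddle N * x)"
      unfolding partition_ratio_eq_exp[OF True] by simp
    also have "\<dots> = exp (2 * B) * N * exp (- (saddle N * x))"
      using N by (simp add: exp_add exp_diff exp_minus field_simps)
    finally show ?thesis .
  qed (simp add: partition_ratio_def partition_count_minus_def)
  then show ?thesis using that[of "exp (2 * B)"] by simp
qed

lemma exp_saddle_le:
  assumes "0 < N" "real N powr (11 / 20) \<le> x"
  shows "exp (- (saddle N * x)) \<le> exp (- (real N powr (1 / 20)))"
proof -
  have "real N powr (1 / 20) = 1 / sqrt N * real N powr (11 / 20)"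
    using assms by (simp add: powr_half_sqrt[symmetric] flip: powr_minus_divide powr_add)
  also have "\<dots> \<le> saddle N * x"
    using assms saddle_bounds[OF assms(1)] by (intro mult_mono) auto
  finally show ?thesis by simp
qed

lemma partition_ratio_le_of_large:
  obtains C where "0 < C"
    "\<And>N x. 0 < N \<Longrightarrow> real N powr (11 / 20) \<le> real x
    \<Longrightarrow> partition_ratio N x \<le> C * N * exp (- (real N powr (1 / 20)))"
proof -
  obtain C where C: "0 < C" "\<And>N x. 0 < N \<Longrightarrow> partition_ratio N x \<le> C * N * exp (- (saddle N * x))"
    using partition_ratio_le by blast
  have "partition_ratio N x \<le> C * N * exp (- (real N powr (1 / 20)))"
    if "0 < N" "real N powr (11 / 20) \<le> real x" for N x
  proof -
    have "partition_ratio N x \<le> C * N * exp (- (saddle N * x))" by (rule C(2)[OF that(1)])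
    also have "\<dots> \<le> C * N * exp (- (real N powr (1 / 20)))"
      using C(1) by (intro mult_left_mono exp_saddle_le that) auto
    finally show ?thesis .
  qed
  then show ?thesis using that C(1) by blast
qed

lemma abs_exp_minus_1_le_linear:
  fixes y :: real
  assumes "\<bar>y\<bar> \<le> 1"
  shows "\<bar>exp y - 1\<bar> \<le> 3 * \<bar>y\<bar>"
proof -
  have "\<bar>exp y - 1\<bar> \<le> \<bar>y\<bar> * exp (max y 0)" by (rule abs_exp_minus_1_le)
  also have "exp (max y 0) \<le> exp 1" using assms by simp
  also have "exp 1 \<le> (3 :: real)" by (rule exp_le)
  finally show ?thesis by (simp add: mult_left_mono)
qed

lemma partition_ratio_approx_of_small:
  obtains C where "0 < C" "\<forall>\<^sub>F N in sequentially. \<forall>x. real x \<le> real N powr (11 / 20) \<longrightarrow>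
     \<bar>partition_ratio N x - exp (- (saddle N * x))\<bar> \<le> C * real N powr (- 2 / 5)"
proof -
  obtain K where K_pos: "0 < K" and ln_approx: "\<And>N x. 0 < N \<Longrightarrow> 2 * x \<le> N \<Longrightarrow>
      \<bar>ln (partition_count (N - x)) - ln (partition_count N) + saddle N * x\<bar>
       \<le> K * (1 / sqrt N + x / N + (real x)\<^sup>2 / (N * sqrt N))"
    using ln_partition_ratio_approx by blast
  define Y where "Y N = real N powr (11 / 20)" for N
  have "\<forall>\<^sub>F N in sequentially. 2 * Y N \<le> N" unfolding Y_def by real_asymp
  moreover have "\<forall>\<^sub>F N in sequentially. 1 / sqrt N + Y N / N + (Y N)\<^sup>2 / (N * sqrt N)
      \<le> 3 * real N powr (- 2 / 5)"
    unfolding Y_def by real_asymp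
  moreover have "\<forall>\<^sub>F N :: nat in sequentially. 3 * K * real N powr (- 2 / 5) \<le> 1" by real_asymp
  ultimately have "\<forall>\<^sub>F N in sequentially. \<forall>x. real x \<le> Y N \<longrightarrow>
      \<bar>partition_ratio N x - exp (- (saddle N * x))\<bar> \<le> 9 * K * real N powr (- 2 / 5)"
    using eventually_gt_at_top[of 0]
  proof (eventually_elim, intro allI impI)
    fix N x :: nat
    assume N: "2 * Y N \<le> N" "1 / sqrt N + Y N / N + (Y N)\<^sup>2 / (N * sqrt N)
        \<le> 3 * real N powr (- 2 / 5)"
      "3 * K * real N powr (- 2 / 5) \<le> 1" "0 < N" and x: "real x \<le> Y N"
    define y where "y = ln (partition_count (N - x)) - ln (partition_count N) + saddle N * x"
    have "2 * x \<le> N" using N x by linarith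
    have "\<bar>y\<bar> \<le> K * (1 / sqrt N + x / N + (real x)\<^sup>2 / (N * sqrt N))"
      unfolding y_def by (rule ln_approx[OF \<open>0 < N\<close> \<open>2 * x \<le> N\<close>])
    also have "\<dots> \<le> K * (1 / sqrt N + Y N / N + (Y N)\<^sup>2 / (N * sqrt N))"
      using K_pos x by (intro mult_left_mono add_mono divide_right_mono power_mono) auto
    also have "\<dots> \<le> K * (3 * real N powr (- 2 / 5))" using K_pos N by (intro mult_left_mono) auto
    finally have y_le: "\<bar>y\<bar> \<le> 3 * K * real N powr (- 2 / 5)" by simp
    then have exp_y: "\<bar>exp y - 1\<bar> \<le> 3 * \<bar>y\<bar>" using N by (intro abs_exp_minus_1_le_linear) linarith
    have "partition_ratio N x - exp (- (saddle N * x)) = exp (- (saddle N * x)) * (exp y - 1)"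
      using \<open>2 * x \<le> N\<close> by (simp add: partition_ratio_eq_exp y_def right_diff_distrib flip: exp_add)
    then have "\<bar>partition_ratio N x - exp (- (saddle N * x))\<bar>
        = exp (- (saddle N * x)) * \<bar>exp y - 1\<bar>"
      by (simp add: abs_mult)
    also have "\<dots> \<le> 1 * (3 * (3 * K * real N powr (- 2 / 5)))"
      using exp_y y_le saddle_bounds(3)[OF \<open>0 < N\<close>] by (intro mult_mono) auto
    finally show "\<bar>partition_ratio N x - exp (- (saddle N * x))\<bar> \<le> 9 * K * real N powr (- 2 / 5)"
      by simp
  qed
  then show ?thesis using that[of "9 * K"] K_pos by (simp add: Y_def)
qed

theorem partition_ratio_approx:
  obtains C where "0 < C" "\<forall>\<^sub>F N in sequentially. \<forall>x.
     \<bar>partition_ratio N x - exp (- (saddle N * x))\<bar> \<le> C * real N powr (- 2 / 5)"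
proof -
  obtain C1 where C1: "0 < C1" "\<forall>\<^sub>F N in sequentially. \<forall>x. real x \<le> real N powr (11 / 20) \<longrightarrow>
     \<bar>partition_ratio N x - exp (- (saddle N * x))\<bar> \<le> C1 * real N powr (- 2 / 5)"
    using partition_ratio_approx_of_small by blast
  obtain C2 where C2: "0 < C2" "\<And>N x. 0 < N \<Longrightarrow> real N powr (11 / 20) \<le> real x \<Longrightarrow>
      partition_ratio N x \<le> C2 * N * exp (- (real N powr (1 / 20)))"
    using partition_ratio_le_of_large by blast
  have "\<forall>\<^sub>F N :: nat in sequentially. C2 * N * exp (- (real N powr (1 / 20)))
      \<le> real N powr (- 2 / 5)" by real_asymp
  moreover have "\<forall>\<^sub>F N :: nat in sequentially. exp (- (real N powr (1 / 20)))
      \<le> real N powr (- 2 / 5)" by real_asymp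
  ultimately have "\<forall>\<^sub>F N in sequentially. \<forall>x.
      \<bar>partition_ratio N x - exp (- (saddle N * x))\<bar> \<le> (C1 + 1) * real N powr (- 2 / 5)"
    using C1(2) eventually_gt_at_top[of 0]
  proof (eventually_elim, intro allI)
    fix N x :: nat
    assume large: "C2 * N * exp (- (real N powr (1 / 20))) \<le> real N powr (- 2 / 5)"
        "exp (- (real N powr (1 / 20))) \<le> real N powr (- 2 / 5)"
      and small: "\<forall>x. real x \<le> real N powr (11 / 20)
          \<longrightarrow> \<bar>partition_ratio N x - exp (- (saddle N * x))\<bar> \<le> C1 * real N powr (- 2 / 5)"
      and N: "0 < N"
    show "\<bar>partition_ratio N x - exp (- (saddle N * x))\<bar> \<le> (C1 + 1) * real N powr (- 2 / 5)"
    proof (cases "real x \<le> real N powr (11 / 20)")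
      case True
      then have "\<bar>partition_ratio N x - exp (- (saddle N * x))\<bar> \<le> C1 * real N powr (- 2 / 5)"
        using small by blast
      also have "\<dots> \<le> (C1 + 1) * real N powr (- 2 / 5)" by (simp add: distrib_right)
      finally show ?thesis .
    next
      case False
      then have "partition_ratio N x \<le> real N powr (- 2 / 5)"
          "exp (- (saddle N * x)) \<le> real N powr (- 2 / 5)"
        using C2(2)[OF N, of x] exp_saddle_le[OF N, of x] large by linarith+
      then have "\<bar>partition_ratio N x - exp (- (saddle N * x))\<bar> \<le> real N powr (- 2 / 5)"
        using partition_ratio_nonneg[of N x] exp_ge_zero[of "- (saddle N * x)"] by linarith
      also have "\<dots> \<le> (C1 + 1) * real N powr (- 2 / 5)" using C1(1) by (simp add: distrib_right)
      finally show ?thesis .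
    qed
  qed
  then show ?thesis using that[of "C1 + 1"] C1(1) by simp
qed

section \<open>Alternating sums of false theta type\<close>

lemma false_theta_sum_diff:
  "false_theta_sum (\<lambda>j. f j - g j) A = false_theta_sum f A - false_theta_sum g A"
  by (simp add: false_theta_sum_def algebra_simps flip: sum_subtractf)

lemma abs_false_theta_sum_le:
  fixes f :: "nat \<Rightarrow> real" and \<epsilon> :: real
  assumes "\<And>k. k \<in> A \<Longrightarrow> \<bar>f (3 * k)\<bar> \<le> \<epsilon>" "\<And>k. k \<in> A \<Longrightarrow> \<bar>f (3 * k + 2)\<bar> \<le> \<epsilon>"
  shows "\<bar>false_theta_sum f A\<bar> \<le> card A * (2 * \<epsilon>)"
proof -
  have "\<bar>f (3 * k) - f (3 * k + 2)\<bar> \<le> 2 * \<epsilon>" if "k \<in> A" for k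
    using assms[OF that] by linarith
  then have "\<bar>false_theta_sum f A\<bar> \<le> (\<Sum>k\<in>A. 2 * \<epsilon>)"
    unfolding false_theta_sum_def by (intro order_trans[OF sum_abs] sum_mono)
  then show ?thesis by simp
qed

(* The coefficient (1 + u) / (1 + u + u^2) makes the comparison exact for constant weights; for
   u close to 1 it is also exact to first order in the differences of the weights. *)
lemma false_theta_block_approx:
  fixes u w0 w1 w2 w3 \<delta> \<eta> :: real
  assumes u: "0 \<le> u" "u \<le> 1"
    and first: "0 \<le> w0 - w1" "w0 - w1 \<le> \<delta>"
    and second: "\<bar>(w1 - w2) - (w0 - w1)\<bar> \<le> \<eta>" "\<bar>(w2 - w3) - (w1 - w2)\<bar> \<le> \<eta>"
  defines "F \<equiv> (1 + u) / (1 + u + u\<^sup>2)"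
  shows "\<bar>(w0 - u\<^sup>2 * w2) - F * (w0 - u ^ 3 * w3)\<bar> \<le> 2 * \<delta> * (1 - u ^ 3) + 4 * \<eta>"
proof -
  define d e1 e2 where "d = w0 - w1" and "e1 = (w1 - w2) - d" and "e2 = (w2 - w3) - d"
  have e: "\<bar>e1\<bar> \<le> \<eta>" "\<bar>e2\<bar> \<le> 2 * \<eta>" using second by (auto simp: d_def e1_def e2_def)
  have u_le: "u ^ 3 \<le> u" "u\<^sup>2 \<le> 1" "u ^ 3 \<le> 1"
    using u power_decreasing[of 1 3 u] by (auto simp: power_le_one)
  have den: "0 < 1 + u + u\<^sup>2" using u by (simp add: add_pos_nonneg)
  have F: "0 \<le> F" "F \<le> 1" using u den by (auto simp: F_def)
  have zeroth_order: "1 - F - u\<^sup>2 + F * u ^ 3 = 0"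
    unfolding F_def using den by (simp add: field_simps power2_eq_square power3_eq_cube)
  have linear_eq: "2 * u\<^sup>2 - 3 * F * u ^ 3 = u\<^sup>2 * ((1 - u) * ((2 + u) / (1 + u + u\<^sup>2)))"
    unfolding F_def using den by (simp add: field_simps power2_eq_square power3_eq_cube)
  have quotient: "0 \<le> (2 + u) / (1 + u + u\<^sup>2)" "(2 + u) / (1 + u + u\<^sup>2) \<le> 2"
    using u den by (auto simp: divide_le_eq)
  have linear_nonneg: "0 \<le> 2 * u\<^sup>2 - 3 * F * u ^ 3"
    unfolding linear_eq using u quotient by (intro mult_nonneg_nonneg) auto
  have linear_le: "2 * u\<^sup>2 - 3 * F * u ^ 3 \<le> 1 * ((1 - u ^ 3) * 2)"
    unfolding linear_eq using u u_le quotient by (intro mult_mono mult_nonneg_nonneg) auto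
  have "(2 * u\<^sup>2 - 3 * F * u ^ 3) * d \<le> 1 * ((1 - u ^ 3) * 2) * \<delta>"
    using linear_le first u_le unfolding d_def by (intro mult_mono) auto
  then have linear: "\<bar>(2 * u\<^sup>2 - 3 * F * u ^ 3) * d\<bar> \<le> 2 * \<delta> * (1 - u ^ 3)"
    using linear_nonneg first by (simp add: d_def mult_ac)
  have "\<bar>u\<^sup>2 * e1 - F * u ^ 3 * (e1 + e2)\<bar> \<le> \<bar>u\<^sup>2 * e1\<bar> + \<bar>F * u ^ 3 * (e1 + e2)\<bar>"
    by (rule abs_triangle_ineq4)
  also have "\<bar>u\<^sup>2 * e1\<bar> \<le> 1 * \<eta>" unfolding abs_mult using u u_le e by (intro mult_mono) auto
  also have "\<bar>F * u ^ 3 * (e1 + e2)\<bar> \<le> (1 * 1) * (3 * \<eta>)"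
    unfolding abs_mult using u u_le e F by (intro mult_mono) auto
  finally have quadratic: "\<bar>u\<^sup>2 * e1 - F * u ^ 3 * (e1 + e2)\<bar> \<le> 4 * \<eta>" by simp
  have "w2 = w0 - (2 * d + e1)" "w3 = w0 - (3 * d + e1 + e2)" by (simp_all add: d_def e1_def e2_def)
  then have "(w0 - u\<^sup>2 * w2) - F * (w0 - u ^ 3 * w3)
      = w0 * (1 - F - u\<^sup>2 + F * u ^ 3)
      + ((2 * u\<^sup>2 - 3 * F * u ^ 3) * d + (u\<^sup>2 * e1 - F * u ^ 3 * (e1 + e2)))"
    by (simp only:) (simp add: algebra_simps)
  then show ?thesis
    unfolding zeroth_order using linear quadratic by linarith
qed

lemma false_theta_sum_approx:
  fixes u \<delta> \<eta> :: real and w :: "nat \<Rightarrow> real"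
  assumes u: "0 \<le> u" "u \<le> 1"
    and first: "\<And>j. j < 3 * K \<Longrightarrow> 0 \<le> w j - w (Suc j)" "\<And>j. j < 3 * K \<Longrightarrow> w j - w (Suc j) \<le> \<delta>"
    and second: "\<And>j. Suc j < 3 * K \<Longrightarrow> \<bar>(w (Suc j) - w (Suc (Suc j))) - (w j - w (Suc j))\<bar> \<le> \<eta>"
  defines "F \<equiv> (1 + u) / (1 + u + u\<^sup>2)"
  shows "\<bar>false_theta_sum (\<lambda>j. u ^ j * w j) {..<K} - F * (w 0 - u ^ (3 * K) * w (3 * K))\<bar>
     \<le> 2 * \<delta> * (1 - u ^ (3 * K)) + 4 * real K * \<eta>"
proof -
  define block where "block k
      = (w (3 * k) - u\<^sup>2 * w (3 * k + 2)) - F * (w (3 * k) - u ^ 3 * w (3 * Suc k))" for k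
  have "\<bar>u ^ (3 * k) * block k\<bar> \<le> 2 * \<delta> * (u ^ (3 * k) - u ^ (3 * Suc k)) + 4 * \<eta>" if "k < K" for k
  proof -
    have "\<bar>block k\<bar> \<le> 2 * \<delta> * (1 - u ^ 3) + 4 * \<eta>"
      unfolding block_def F_def
      using that first[of "3 * k"] second[of "3 * k"] second[of "3 * k + 1"]
      by (intro false_theta_block_approx[OF u, where ?w1.0 = "w (3 * k + 1)"])
          (simp_all add: numeral_3_eq_3)
    then have "\<bar>u ^ (3 * k) * block k\<bar> \<le> u ^ (3 * k) * (2 * \<delta> * (1 - u ^ 3) + 4 * \<eta>)"
      using u by (simp add: abs_mult mult_left_mono)
    also have "\<dots> = 2 * \<delta> * (u ^ (3 * k) - u ^ (3 * Suc k)) + u ^ (3 * k) * (4 * \<eta>)"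
      by (simp add: power_add algebra_simps)
    also have "u ^ (3 * k) * (4 * \<eta>) \<le> 1 * (4 * \<eta>)"
      using u second[of "3 * k"] that by (intro mult_right_mono) (auto simp: power_le_one)
    finally show ?thesis by simp
  qed
  then have "\<bar>\<Sum>k<K. u ^ (3 * k) * block k\<bar>
      \<le> (\<Sum>k<K. 2 * \<delta> * (u ^ (3 * k) - u ^ (3 * Suc k)) + 4 * \<eta>)"
    by (intro order_trans[OF sum_abs] sum_mono) auto
  also have "\<dots> = 2 * \<delta> * (1 - u ^ (3 * K)) + 4 * real K * \<eta>"
    using sum_lessThan_telescope'[of "\<lambda>k. u ^ (3 * k)" K]
    by (simp add: sum.distrib flip: sum_distrib_left)
  also have "(\<Sum>k<K. u ^ (3 * k) * block k)
      = (\<Sum>k<K. (u ^ (3 * k) * w (3 * k) - u ^ (3 * k + 2) * w (3 * k + 2))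
          - F * (u ^ (3 * k) * w (3 * k) - u ^ (3 * Suc k) * w (3 * Suc k)))"
    by (simp add: block_def power_add power2_eq_square algebra_simps)
  also have "\<dots> = false_theta_sum (\<lambda>j. u ^ j * w j) {..<K} - F * (w 0 - u ^ (3 * K) * w (3 * K))"
    unfolding false_theta_sum_def
      sum_subtractf[where f = "\<lambda>k. u ^ (3 * k) * w (3 * k) - u ^ (3 * k + 2) * w (3 * k + 2)"]
      sum_distrib_left[symmetric]
    by (subst sum_lessThan_telescope'[of "\<lambda>k. u ^ (3 * k) * w (3 * k)"]) simp
  finally show ?thesis .
qed

definition theta_weight :: "real \<Rightarrow> nat \<Rightarrow> real" where
  "theta_weight a j = exp (- (a * (2 * real j * (real j + 1) / 3)))"

definition theta_drop :: "real \<Rightarrow> nat \<Rightarrow> real" where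
  "theta_drop a j = 1 - exp (- (a * (4 * (real j + 1) / 3)))"

lemma theta_weight_diff:
  "theta_weight a j - theta_weight a (Suc j) = theta_weight a j * theta_drop a j"
proof -
  have "theta_weight a (Suc j) = theta_weight a j * exp (- (a * (4 * (real j + 1) / 3)))"
    unfolding theta_weight_def exp_add[symmetric] by (simp add: field_simps)
  then show ?thesis by (simp add: theta_drop_def right_diff_distrib)
qed

lemma theta_drop_bounds:
  assumes "0 \<le> a"
  shows "0 \<le> theta_drop a j" "theta_drop a j \<le> a * (4 * (real j + 1) / 3)"
    and "\<bar>theta_drop a (Suc j) - theta_drop a j\<bar> \<le> 2 * a"
proof -
  define y where "y j = exp (- (a * (4 * (real j + 1) / 3)))" for j
  have y: "0 \<le> y j" "y j \<le> 1" for j using assms by (auto simp: y_def)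
  then show "0 \<le> theta_drop a j" by (simp add: theta_drop_def y_def)
  show "theta_drop a j \<le> a * (4 * (real j + 1) / 3)"
    using exp_ge_add_one_self[of "- (a * (4 * (real j + 1) / 3))"] by (simp add: theta_drop_def)
  have "y (Suc j) = y j * exp (- (4 * a / 3))"
    unfolding y_def exp_add[symmetric] by (simp add: field_simps)
  then have "theta_drop a (Suc j) - theta_drop a j = y j * (1 - exp (- (4 * a / 3)))"
    by (simp add: theta_drop_def y_def right_diff_distrib)
  moreover have "0 \<le> 1 - exp (- (4 * a / 3))" using assms by simp
  moreover have "1 - exp (- (4 * a / 3)) \<le> 2 * a"
    using exp_ge_add_one_self[of "- (4 * a / 3)"] assms by linarith
  ultimately show "\<bar>theta_drop a (Suc j) - theta_drop a j\<bar> \<le> 2 * a"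
    using y[of j] by (simp add: abs_mult mult_left_le_one_le order_trans[rotated])
qed

lemma theta_weight_differences:
  assumes a: "0 \<le> a"
  shows "0 \<le> theta_weight a j - theta_weight a (Suc j)"
    and "j < 3 * K \<Longrightarrow> theta_weight a j - theta_weight a (Suc j) \<le> 4 * a * K"
    and "Suc j < 3 * K \<Longrightarrow> \<bar>(theta_weight a (Suc j) - theta_weight a (Suc (Suc j)))
      - (theta_weight a j - theta_weight a (Suc j))\<bar> \<le> 16 * a\<^sup>2 * (real K)\<^sup>2 + 2 * a"
proof -
  let ?w = "theta_weight a" and ?g = "theta_drop a"
  note diff = theta_weight_diff[of a] and drop_nonneg = theta_drop_bounds(1)[OF a]
  have weight: "0 \<le> ?w j" "?w j \<le> 1" for j using a by (auto simp: theta_weight_def)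
  have drop_le: "?g j \<le> 4 * a * K" if "j < 3 * K" for j
  proof -
    have "a * (4 * (real j + 1) / 3) \<le> a * (4 * K)" using that a by (intro mult_left_mono) auto
    then show ?thesis using theta_drop_bounds(2)[OF a, of j] by simp
  qed
  show "0 \<le> ?w j - ?w (Suc j)" unfolding diff using weight[of j] drop_nonneg by simp
  show "?w j - ?w (Suc j) \<le> 4 * a * K" if "j < 3 * K"
    unfolding diff using mult_mono[OF weight(2) drop_le[OF that]] weight drop_nonneg[of j] by simp
  assume j: "Suc j < 3 * K"
  have weight_Suc: "?w (Suc j) = ?w j - ?w j * ?g j" using diff[of j] by simp
  have "(?w (Suc j) - ?w (Suc (Suc j))) - (?w j - ?w (Suc j))
      = ?w j * (?g (Suc j) - ?g j) - ?w j * ?g j * ?g (Suc j)"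
    unfolding diff by (simp only: weight_Suc) (simp add: algebra_simps)
  also have "\<bar>\<dots>\<bar> \<le> \<bar>?w j * (?g (Suc j) - ?g j)\<bar> + \<bar>?w j * ?g j * ?g (Suc j)\<bar>"
    by (rule abs_triangle_ineq4)
  also have "\<bar>?w j * (?g (Suc j) - ?g j)\<bar> \<le> 1 * (2 * a)"
    unfolding abs_mult using weight[of j] theta_drop_bounds(3)[OF a, of j] by (intro mult_mono) auto
  also have "\<bar>?w j * ?g j * ?g (Suc j)\<bar> \<le> 1 * (4 * a * K) * (4 * a * K)"
    unfolding abs_mult
    using weight[of j] drop_nonneg[of j] drop_nonneg[of "Suc j"] drop_le[of j] drop_le[of "Suc j"] j
        a
    by (intro mult_mono) auto
  also have "1 * (2 * a) + 1 * (4 * a * K) * (4 * a * K) = 16 * a\<^sup>2 * (real K)\<^sup>2 + 2 * a"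
    by (simp add: power2_eq_square)
  finally show "\<bar>(?w (Suc j) - ?w (Suc (Suc j))) - (?w j - ?w (Suc j))\<bar>
      \<le> 16 * a\<^sup>2 * (real K)\<^sup>2 + 2 * a" by simp
qed

theorem false_theta_gauss_approx:
  fixes a u :: real
  assumes a: "0 \<le> a" and u: "0 \<le> u" "u \<le> 1"
  shows "\<bar>false_theta_sum (\<lambda>j. u ^ j * theta_weight a j) {..<K} - (1 + u) / (1 + u + u\<^sup>2)\<bar>
    \<le> theta_weight a (3 * K) + 16 * a * K + 64 * a\<^sup>2 * K ^ 3"
proof -
  let ?w = "theta_weight a"
  define F where "F = (1 + u) / (1 + u + u\<^sup>2)"
  define S where "S = false_theta_sum (\<lambda>j. u ^ j * ?w j) {..<K}"
  have "\<bar>S - F * (?w 0 - u ^ (3 * K) * ?w (3 * K))\<bar>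
      \<le> 2 * (4 * a * K) * (1 - u ^ (3 * K)) + 4 * real K * (16 * a\<^sup>2 * (real K)\<^sup>2 + 2 * a)"
    unfolding S_def F_def by (intro false_theta_sum_approx theta_weight_differences a u)
  also have "\<dots> \<le> 2 * (4 * a * K) * 1 + 4 * real K * (16 * a\<^sup>2 * (real K)\<^sup>2 + 2 * a)"
    using a u by (intro add_right_mono mult_left_mono) auto
  also have "\<dots> = 16 * a * K + 64 * a\<^sup>2 * K ^ 3"
    by (simp add: power2_eq_square power3_eq_cube algebra_simps)
  finally have sum: "\<bar>S - F * (?w 0 - u ^ (3 * K) * ?w (3 * K))\<bar> \<le> 16 * a * K + 64 * a\<^sup>2 * K ^ 3" .
  have "0 < 1 + u + u\<^sup>2" using u by (simp add: add_pos_nonneg)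
  then have F: "0 \<le> F" "F \<le> 1" using u by (auto simp: F_def)
  have w_nonneg: "0 \<le> ?w (3 * K)" by (simp add: theta_weight_def)
  have "F * (u ^ (3 * K) * ?w (3 * K)) \<le> 1 * (1 * ?w (3 * K))"
    using F u w_nonneg by (intro mult_mono) (auto simp: power_le_one)
  moreover have "0 \<le> F * (u ^ (3 * K) * ?w (3 * K))" using F u w_nonneg by simp
  moreover have "F * (?w 0 - u ^ (3 * K) * ?w (3 * K)) = F - F * (u ^ (3 * K) * ?w (3 * K))"
    by (simp add: theta_weight_def right_diff_distrib)
  ultimately show ?thesis
    using sum unfolding S_def[symmetric] F_def[symmetric] by linarith
qed

section \<open>Compositions of given rank: asymptotics\<close>

lemma real_theta_exponent:
  assumes "j = 3 * k \<or> j = 3 * k + 2"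
  shows "real (theta_exponent l j) = real j * real l + 2 * real j * (real j + 1) / 3"
  using assms
proof (elim disjE)
  assume j: "j = 3 * k"
  show ?thesis unfolding j theta_exponent_simps by (simp add: power2_eq_square field_simps)
next
  assume j: "j = 3 * k + 2"
  show ?thesis unfolding j theta_exponent_simps by (simp add: power2_eq_square field_simps)
qed

lemma exp_theta_exponent:
  fixes a :: real
  assumes "j = 3 * k \<or> j = 3 * k + 2"
  shows "exp (- (a * theta_exponent l j)) = exp (- (a * real l)) ^ j * theta_weight a j"
  unfolding real_theta_exponent[OF assms] theta_weight_def exp_of_nat_mult[symmetric]
      exp_add[symmetric]
  by (simp add: algebra_simps)

lemma square_le_theta_exponent: "k\<^sup>2 \<le> theta_exponent l (3 * k)" "k\<^sup>2 \<le> theta_exponent l (3 * k + 2)"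
  unfolding theta_exponent_simps by simp_all

lemma F_conc_eq: "F_conc \<alpha> = (1 + exp (- \<alpha>)) / (1 + exp (- \<alpha>) + (exp (- \<alpha>))\<^sup>2)"
  by (simp add: F_conc_def power2_eq_square flip: exp_add)

lemma F_conc_ge:
  assumes "0 \<le> \<alpha>"
  shows "2 / 3 \<le> F_conc \<alpha>"
proof -
  define u where "u = exp (- \<alpha>)"
  have u: "0 < u" "u \<le> 1" using assms by (auto simp: u_def)
  then have "0 < 1 + u + u\<^sup>2" by (simp add: add_pos_pos)
  moreover have "u\<^sup>2 \<le> u" using u by (simp add: power2_eq_square mult_left_le)
  ultimately show ?thesis
    unfolding F_conc_eq u_def[symmetric] using u by (auto simp: divide_simps)
qed

definition cutoff :: "nat \<Rightarrow> nat" where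
  "cutoff N = nat \<lceil>real N powr (11 / 40)\<rceil>"

lemma powr_le_cutoff_squared: "real N powr (11 / 20) \<le> (real (cutoff N))\<^sup>2"
proof -
  have "real N powr (11 / 20) = (real N powr (11 / 40))\<^sup>2"
    by (cases "N = 0") (simp_all add: powr_powr flip: powr_numeral)
  also have "\<dots> \<le> (real (cutoff N))\<^sup>2"
    unfolding cutoff_def by (intro power_mono real_nat_ceiling_ge) simp
  finally show ?thesis .
qed

lemma partition_ratio_tail:
  obtains C where "0 < C" "\<forall>\<^sub>F N in sequentially. \<forall>l.
    \<bar>false_theta_sum (\<lambda>j. partition_ratio N (theta_exponent l j)) {cutoff N..<N + 1}\<bar>
      \<le> C * real N powr (- 1 / 10)"
proof -
  obtain C where C_pos: "0 < C" and ratio_le: "\<And>N x. 0 < N \<Longrightarrow> real N powr (11 / 20) \<le> real x \<Longrightarrow>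
      partition_ratio N x \<le> C * N * exp (- (real N powr (1 / 20)))"
    using partition_ratio_le_of_large by blast
  define B where "B N = C * N * exp (- (real N powr (1 / 20)))" for N :: nat
  have "\<forall>\<^sub>F N :: nat in sequentially. (real N + 1) * (2 * (N * exp (- (real N powr (1 / 20)))))
      \<le> real N powr (- 1 / 10)"
    by real_asymp
  then have "\<forall>\<^sub>F N in sequentially. \<forall>l.
    \<bar>false_theta_sum (\<lambda>j. partition_ratio N (theta_exponent l j)) {cutoff N..<N + 1}\<bar>
      \<le> C * real N powr (- 1 / 10)"
    using eventually_gt_at_top[of 0]
  proof (eventually_elim, intro allI)
    fix N l :: nat
    assume N: "(real N + 1) * (2 * (N * exp (- (real N powr (1 / 20))))) \<le> real N powr (- 1 / 10)"
      "0 < N"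
    let ?r = "\<lambda>j. partition_ratio N (theta_exponent l j)"
    have ratios_le: "\<bar>?r (3 * k)\<bar> \<le> B N" "\<bar>?r (3 * k + 2)\<bar> \<le> B N" if k: "k \<in> {cutoff N..<N + 1}" for k
    proof -
      have "real N powr (11 / 20) \<le> (real (cutoff N))\<^sup>2" by (rule powr_le_cutoff_squared)
      also have "\<dots> \<le> real (k\<^sup>2)" using k by (simp add: power_mono)
      finally have "?r (3 * k) \<le> B N" "?r (3 * k + 2) \<le> B N"
        unfolding B_def using square_le_theta_exponent[of k l]
        by (auto intro!: ratio_le[OF N(2)] elim!: order_trans simp del: of_nat_power)
      then show "\<bar>?r (3 * k)\<bar> \<le> B N" "\<bar>?r (3 * k + 2)\<bar> \<le> B N"
        using partition_ratio_nonneg by (simp_all only: abs_of_nonneg)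
    qed
    have "\<bar>false_theta_sum ?r {cutoff N..<N + 1}\<bar> \<le> card {cutoff N..<N + 1} * (2 * B N)"
      by (rule abs_false_theta_sum_le[OF ratios_le])
    also have "\<dots> \<le> (real N + 1) * (2 * B N)"
      using C_pos by (intro mult_right_mono) (simp_all add: B_def)
    also have "\<dots> = C * ((real N + 1) * (2 * (N * exp (- (real N powr (1 / 20))))))"
      by (simp add: B_def)
    also have "\<dots> \<le> C * real N powr (- 1 / 10)" using N C_pos by (intro mult_left_mono) auto
    finally show "\<bar>false_theta_sum ?r {cutoff N..<N + 1}\<bar> \<le> C * real N powr (- 1 / 10)" .
  qed
  then show ?thesis using that C_pos by blast
qed

lemma exp_theta_exponent_sum_approx:
  fixes a :: real
  assumes "0 \<le> a"
  shows "\<bar>false_theta_sum (\<lambda>j. exp (- (a * theta_exponent l j))) {..<K} - F_conc (a * real l)\<bar>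
    \<le> theta_weight a (3 * K) + 16 * a * K + 64 * a\<^sup>2 * K ^ 3"
proof -
  have "false_theta_sum (\<lambda>j. exp (- (a * theta_exponent l j))) {..<K}
      = false_theta_sum (\<lambda>j. exp (- (a * real l)) ^ j * theta_weight a j) {..<K}"
    by (simp only: false_theta_sum_def exp_theta_exponent[OF disjI1[OF refl]]
        exp_theta_exponent[OF disjI2[OF refl]])
  then show ?thesis
    using assms by (simp only: F_conc_eq) (intro false_theta_gauss_approx, auto)
qed

lemma partition_ratio_head:
  obtains C where "0 < C" "\<forall>\<^sub>F N in sequentially. \<forall>l.
    \<bar>false_theta_sum (\<lambda>j. partition_ratio N (theta_exponent l j)) {..<cutoff N}
      - F_conc (saddle N * real l)\<bar> \<le> C * real N powr (- 1 / 10)"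
proof -
  obtain C where C: "0 < C" "\<forall>\<^sub>F N in sequentially. \<forall>x.
     \<bar>partition_ratio N x - exp (- (saddle N * x))\<bar> \<le> C * real N powr (- 2 / 5)"
    using partition_ratio_approx by blast
  have "\<forall>\<^sub>F N in sequentially. cutoff N * (2 * (C * real N powr (- 2 / 5)))
      \<le> 4 * C * real N powr (- 1 / 10)"
    unfolding cutoff_def using C(1) by real_asymp
  moreover have "\<forall>\<^sub>F N in sequentially. theta_weight (saddle N) (3 * cutoff N)
      + 16 * saddle N * cutoff N + 64 * (saddle N)\<^sup>2 * cutoff N ^ 3 \<le> real N powr (- 1 / 10)"
    unfolding cutoff_def saddle_def theta_weight_def by real_asymp
  ultimately have "\<forall>\<^sub>F N in sequentially. \<forall>l.
    \<bar>false_theta_sum (\<lambda>j. partition_ratio N (theta_exponent l j)) {..<cutoff N}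
      - F_conc (saddle N * real l)\<bar> \<le> (4 * C + 1) * real N powr (- 1 / 10)"
    using C(2) eventually_gt_at_top[of 0]
  proof (eventually_elim, intro allI)
    fix N l :: nat
    assume cutoff_le: "cutoff N * (2 * (C * real N powr (- 2 / 5))) \<le> 4 * C * real N powr (- 1 / 10)"
      and theta_error: "theta_weight (saddle N) (3 * cutoff N) + 16 * saddle N * cutoff N
        + 64 * (saddle N)\<^sup>2 * cutoff N ^ 3 \<le> real N powr (- 1 / 10)"
      and ratio_error: "\<forall>x. \<bar>partition_ratio N x - exp (- (saddle N * x))\<bar>
          \<le> C * real N powr (- 2 / 5)"
      and "0 < N"
    let ?r = "\<lambda>j. partition_ratio N (theta_exponent l j)"
      and ?e = "\<lambda>j. exp (- (saddle N * theta_exponent l j))"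
    have "\<bar>false_theta_sum (\<lambda>j. ?r j - ?e j) {..<cutoff N}\<bar>
        \<le> card {..<cutoff N} * (2 * (C * real N powr (- 2 / 5)))"
      using ratio_error by (intro abs_false_theta_sum_le) auto
    then have "\<bar>false_theta_sum ?r {..<cutoff N} - false_theta_sum ?e {..<cutoff N}\<bar>
        \<le> 4 * C * real N powr (- 1 / 10)"
      using cutoff_le by (simp only: false_theta_sum_diff card_lessThan)
    moreover have "\<bar>false_theta_sum ?e {..<cutoff N} - F_conc (saddle N * real l)\<bar>
        \<le> real N powr (- 1 / 10)"
      using exp_theta_exponent_sum_approx[of "saddle N"] saddle_bounds(3)[OF \<open>0 < N\<close>] theta_error
      by (meson less_imp_le order_trans)
    ultimately show "\<bar>false_theta_sum ?r {..<cutoff N} - F_conc (saddle N * real l)\<bar>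
        \<le> (4 * C + 1) * real N powr (- 1 / 10)"
      unfolding distrib_right by linarith
  qed
  then show ?thesis using that[of "4 * C + 1"] C(1) by simp
qed

theorem Vd_rank_approx:
  obtains C where "0 < C" "\<forall>\<^sub>F N in sequentially. \<forall>l.
     \<bar>Vd_rank l (N + triangle (nat \<bar>l\<bar>)) / partition_count N - F_conc (saddle N * \<bar>real_of_int l\<bar>)\<bar>
       \<le> C * real N powr (- 1 / 10)"
proof -
  let ?S = "\<lambda>N l. false_theta_sum (\<lambda>j. partition_ratio N (theta_exponent l j))"
  obtain C1 where C1: "0 < C1" "\<forall>\<^sub>F N in sequentially. \<forall>l.
      \<bar>?S N l {..<cutoff N} - F_conc (saddle N * real l)\<bar> \<le> C1 * real N powr (- 1 / 10)"
    using partition_ratio_head by blast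
  obtain C2 where C2: "0 < C2" "\<forall>\<^sub>F N in sequentially. \<forall>l.
      \<bar>?S N l {cutoff N..<N + 1}\<bar> \<le> C2 * real N powr (- 1 / 10)"
    using partition_ratio_tail by blast
  have "\<forall>\<^sub>F N in sequentially. cutoff N \<le> N" unfolding cutoff_def by real_asymp
  then have "\<forall>\<^sub>F N in sequentially. \<forall>l.
     \<bar>Vd_rank l (N + triangle (nat \<bar>l\<bar>)) / partition_count N - F_conc (saddle N * \<bar>real_of_int l\<bar>)\<bar>
       \<le> (C1 + C2) * real N powr (- 1 / 10)"
    using C1(2) C2(2)
  proof (eventually_elim, intro allI)
    fix N :: nat and l :: int
    assume "cutoff N \<le> N"
      and head: "\<forall>l. \<bar>?S N l {..<cutoff N} - F_conc (saddle N * real l)\<bar>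
          \<le> C1 * real N powr (- 1 / 10)"
      and tail: "\<forall>l. \<bar>?S N l {cutoff N..<N + 1}\<bar> \<le> C2 * real N powr (- 1 / 10)"
    define L where "L = nat \<bar>l\<bar>"
    have "Vd_rank l (N + triangle (nat \<bar>l\<bar>)) / partition_count N = ?S N L {..<N + 1}"
      by (simp only: Vd_rank_false_theta[OF less_add_one] false_theta_sum_def partition_ratio_def
          sum_divide_distrib diff_divide_distrib L_def)
    also have "\<dots> = ?S N L {..<cutoff N} + ?S N L {cutoff N..<N + 1}"
      unfolding false_theta_sum_def lessThan_atLeast0 using \<open>cutoff N \<le> N\<close>
      by (intro sum.atLeastLessThan_concat[symmetric]) auto
    finally show "\<bar>Vd_rank l (N + triangle (nat \<bar>l\<bar>)) / partition_count N
        - F_conc (saddle N * \<bar>real_of_int l\<bar>)\<bar>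
       \<le> (C1 + C2) * real N powr (- 1 / 10)"
      using head[rule_format, of L] tail[rule_format, of L]
      unfolding distrib_right L_def of_nat_nat[OF abs_ge_zero] of_int_abs by linarith
  qed
  then show ?thesis using that[of "C1 + C2"] C1(1) C2(1) by simp
qed

theorem Vd_rank_relative_error:
  obtains C where "\<forall>\<^sub>F N in sequentially. \<forall>l.
     \<bar>Vd_rank l (N + triangle (nat \<bar>l\<bar>)) / (partition_count N * F_conc (saddle N * \<bar>real_of_int l\<bar>))
       - 1\<bar>
       \<le> C * real N powr (- 1 / 10)"
proof -
  obtain C where C: "0 < C" "\<forall>\<^sub>F N in sequentially. \<forall>l.
     \<bar>Vd_rank l (N + triangle (nat \<bar>l\<bar>)) / partition_count N - F_conc (saddle N * \<bar>real_of_int l\<bar>)\<bar>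
       \<le> C * real N powr (- 1 / 10)"
    using Vd_rank_approx by blast
  have "\<forall>\<^sub>F N in sequentially. \<forall>l.
     \<bar>Vd_rank l (N + triangle (nat \<bar>l\<bar>)) / (partition_count N * F_conc (saddle N * \<bar>real_of_int l\<bar>))
       - 1\<bar>
       \<le> 2 * C * real N powr (- 1 / 10)"
    using C(2) eventually_gt_at_top[of 0]
  proof (eventually_elim, intro allI)
    fix N :: nat and l :: int
    assume approx: "\<forall>l. \<bar>Vd_rank l (N + triangle (nat \<bar>l\<bar>)) / partition_count N
        - F_conc (saddle N * \<bar>real_of_int l\<bar>)\<bar>
        \<le> C * real N powr (- 1 / 10)" and "0 < N"
    define v f where "v = Vd_rank l (N + triangle (nat \<bar>l\<bar>)) / partition_count N"
      and "f = F_conc (saddle N * \<bar>real_of_int l\<bar>)"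
    have f_ge: "2 / 3 \<le> f" unfolding f_def using saddle_bounds(3)[OF \<open>0 < N\<close>]
      by (intro F_conc_ge) simp
    then have "v / f - 1 = (v - f) / f" by (simp add: diff_divide_distrib)
    then have "\<bar>v / f - 1\<bar> = \<bar>v - f\<bar> / f" using f_ge by (simp only: abs_divide)
    also have "\<dots> \<le> (C * real N powr (- 1 / 10)) / (1 / 2)"
      using approx f_ge C(1) unfolding v_def f_def by (intro frac_le) auto
    finally show "\<bar>Vd_rank l (N + triangle (nat \<bar>l\<bar>))
        / (partition_count N * F_conc (saddle N * \<bar>real_of_int l\<bar>)) - 1\<bar>
        \<le> 2 * C * real N powr (- 1 / 10)"
      by (simp add: v_def f_def)
  qed
  then show ?thesis by (rule that)
qed

section \<open>The distribution of the rank\<close>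

definition rank_gauss :: "nat \<Rightarrow> int \<Rightarrow> real" where
  "rank_gauss N m = exp (- pi * (real_of_int m)\<^sup>2 / sqrt (24 * real N))"

lemma rank_gauss_pos: "0 < rank_gauss N m"
  by (simp add: rank_gauss_def)

lemma real_triangle: "real (triangle l) = ((real l)\<^sup>2 + real l) / 2"
  by (induction l) (simp_all add: field_simps power2_eq_square)

lemma triangle_smallo:
  fixes m :: "nat \<Rightarrow> int"
  assumes "(\<lambda>N. real_of_int (m N)) \<in> o(\<lambda>N. real N powr (3 / 8))"
  shows "(\<lambda>N. real (triangle (nat \<bar>m N\<bar>))) \<in> o(\<lambda>N. real N powr (3 / 4))"
proof -
  have abs: "(\<lambda>N. \<bar>real_of_int (m N)\<bar>) \<in> o(\<lambda>N. real N powr (3 / 8))"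
    using assms by simp
  have "(\<lambda>N. \<bar>real_of_int (m N)\<bar>\<^sup>2) \<in> o(\<lambda>N. (real N powr (3 / 8))\<^sup>2)"
    by (rule landau_o.small_power[OF abs]) simp
  also have "(\<lambda>N :: nat. (real N powr (3 / 8))\<^sup>2) \<in> O(\<lambda>N. real N powr (3 / 4))" by real_asymp
  finally have square: "(\<lambda>N. \<bar>real_of_int (m N)\<bar>\<^sup>2) \<in> o(\<lambda>N. real N powr (3 / 4))" .
  note abs
  also have "(\<lambda>N :: nat. real N powr (3 / 8)) \<in> O(\<lambda>N. real N powr (3 / 4))" by real_asymp
  finally have "(\<lambda>N. (\<bar>real_of_int (m N)\<bar>\<^sup>2 + \<bar>real_of_int (m N)\<bar>) / 2) \<in> o(\<lambda>N. real N powr (3 / 4))"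
    using square by (intro landau_o.small.cdiv_in_iff'[THEN iffD2] sum_in_smallo) auto
  then show ?thesis by (simp add: real_triangle)
qed

lemma partition_ratio_asymp_equiv:
  assumes "(\<lambda>N. real (x N)) \<in> o(\<lambda>N. real N powr (3 / 4))"
  shows "\<forall>\<^sub>F N in sequentially. 2 * x N \<le> N"
    and "(\<lambda>N. partition_ratio N (x N)) \<sim>[sequentially] (\<lambda>N. exp (- (saddle N * x N)))"
proof -
  note assms
  also have "(\<lambda>N :: nat. real N powr (3 / 4)) \<in> O(\<lambda>N. real N)" by real_asymp
  finally have first: "(\<lambda>N. real (x N) / N) \<longlonglongrightarrow> 0" by (rule smalloD_tendsto)
  have "(\<lambda>N. (real (x N))\<^sup>2) \<in> o(\<lambda>N. (real N powr (3 / 4))\<^sup>2)"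
    by (rule landau_o.small_power[OF assms]) simp
  also have "(\<lambda>N :: nat. (real N powr (3 / 4))\<^sup>2) \<in> O(\<lambda>N. N * sqrt N)" by real_asymp
  finally have second: "(\<lambda>N. (real (x N))\<^sup>2 / (N * sqrt N)) \<longlonglongrightarrow> 0" by (rule smalloD_tendsto)
  have "\<forall>\<^sub>F N in sequentially. real (x N) / N < 1 / 2" using first by (rule order_tendstoD) simp
  then show x_le: "\<forall>\<^sub>F N in sequentially. 2 * x N \<le> N"
    using eventually_gt_at_top[of 0] by eventually_elim (simp add: field_simps)
  obtain C where ln_approx: "\<And>N x. 0 < N \<Longrightarrow> 2 * x \<le> N \<Longrightarrow>
      \<bar>ln (partition_count (N - x)) - ln (partition_count N) + saddle N * x\<bar>
       \<le> C * (1 / sqrt N + x / N + (real x)\<^sup>2 / (N * sqrt N))"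
    by (rule ln_partition_ratio_approx, rule that)
  define y where "y N = ln (partition_count (N - x N)) - ln (partition_count N) + saddle N * x N"
    for N
  have "y \<longlonglongrightarrow> 0"
  proof (rule Lim_null_comparison)
    have "(\<lambda>N. 1 / sqrt N + x N / N + (real (x N))\<^sup>2 / (N * sqrt N)) \<longlonglongrightarrow> 0 + 0 + 0"
      by (intro tendsto_add first second) real_asymp
    from tendsto_mult_right_zero[OF this[simplified], of C]
    show "(\<lambda>N. C * (1 / sqrt N + x N / N + (real (x N))\<^sup>2 / (N * sqrt N))) \<longlonglongrightarrow> 0" by simp
    show "\<forall>\<^sub>F N in sequentially. norm (y N)
        \<le> C * (1 / sqrt N + x N / N + (real (x N))\<^sup>2 / (N * sqrt N))"
      using x_le eventually_gt_at_top[of 0]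
    proof eventually_elim
      case (elim N)
      then show ?case unfolding y_def real_norm_def by (intro ln_approx)
    qed
  qed
  then have "(\<lambda>N. exp (y N)) \<longlonglongrightarrow> exp 0" by (rule tendsto_exp)
  moreover have "\<forall>\<^sub>F N in sequentially. exp (y N)
      = partition_ratio N (x N) / exp (- (saddle N * x N))"
    using x_le by eventually_elim (simp add: y_def partition_ratio_eq_exp flip: exp_diff)
  ultimately show "(\<lambda>N. partition_ratio N (x N)) \<sim>[sequentially] (\<lambda>N. exp (- (saddle N * x N)))"
    by (intro asymp_equivI') (simp add: Lim_transform_eventually)
qed

lemma saddle_mult_tendsto_0:
  fixes m :: "nat \<Rightarrow> int"
  assumes "(\<lambda>N. real_of_int (m N)) \<in> o(\<lambda>N. real N powr (3 / 8))"
  shows "(\<lambda>N. saddle N * \<bar>real_of_int (m N)\<bar>) \<longlonglongrightarrow> 0"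
proof -
  have "saddle \<in> O(\<lambda>N. real N powr (- 1 / 2))" unfolding saddle_def[abs_def] by real_asymp
  moreover have "(\<lambda>N. \<bar>real_of_int (m N)\<bar>) \<in> o(\<lambda>N. real N powr (3 / 8))" using assms by simp
  ultimately have "(\<lambda>N. saddle N * \<bar>real_of_int (m N)\<bar>)
      \<in> o(\<lambda>N. real N powr (- 1 / 2) * real N powr (3 / 8))"
    by (rule landau_o.big_small_mult)
  also have "(\<lambda>N :: nat. real N powr (- 1 / 2) * real N powr (3 / 8)) \<in> O(\<lambda>_. 1)" by real_asymp
  finally show ?thesis using smalloD_tendsto by fastforce
qed

lemma exp_saddle_triangle_asymp_equiv:
  fixes m :: "nat \<Rightarrow> int"
  assumes "(\<lambda>N. real_of_int (m N)) \<in> o(\<lambda>N. real N powr (3 / 8))"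
  shows "(\<lambda>N. exp (- (saddle N * triangle (nat \<bar>m N\<bar>)))) \<sim>[sequentially] (\<lambda>N. rank_gauss N (m N))"
proof (rule asymp_equivI')
  have "(\<lambda>N. exp (- (saddle N * \<bar>real_of_int (m N)\<bar> / 2))) \<longlonglongrightarrow> exp (- (0 / 2))"
    by (intro tendsto_intros saddle_mult_tendsto_0 assms) simp
  moreover have "exp (- (saddle N * \<bar>real_of_int (m N)\<bar> / 2))
      = exp (- (saddle N * triangle (nat \<bar>m N\<bar>))) / rank_gauss N (m N)" for N
  proof -
    have "sqrt (24 * real N) = 2 * sqrt (6 * real N)"
      using real_sqrt_mult[of 4 "6 * real N"] by simp
    then have "saddle N * triangle (nat \<bar>m N\<bar>)
        = saddle N * \<bar>real_of_int (m N)\<bar> / 2 + pi * (real_of_int (m N))\<^sup>2 / sqrt (24 * real N)"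
      by (simp add: real_triangle saddle_def add_divide_distrib distrib_left)
    then show ?thesis by (simp add: rank_gauss_def flip: exp_diff)
  qed
  ultimately show "(\<lambda>N. exp (- (saddle N * triangle (nat \<bar>m N\<bar>))) / rank_gauss N (m N)) \<longlonglongrightarrow> 1" by simp
qed

lemma F_conc_tendsto:
  fixes m :: "nat \<Rightarrow> int"
  assumes m: "(\<lambda>N. real_of_int (m N)) \<in> o(\<lambda>N. real N powr (3 / 8))"
    and N': "\<forall>\<^sub>F N in sequentially. N \<le> 2 * N' N"
  shows "(\<lambda>N. F_conc (saddle (N' N) * \<bar>real_of_int (m N)\<bar>)) \<longlonglongrightarrow> 2 / 3"
proof -
  have "(\<lambda>N. saddle (N' N) * \<bar>real_of_int (m N)\<bar>) \<longlonglongrightarrow> 0"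
  proof (rule Lim_null_comparison)
    show "(\<lambda>N. 2 * (saddle N * \<bar>real_of_int (m N)\<bar>)) \<longlonglongrightarrow> 0"
      using tendsto_mult_right_zero[OF saddle_mult_tendsto_0[OF m]] by simp
    show "\<forall>\<^sub>F N in sequentially. norm (saddle (N' N) * \<bar>real_of_int (m N)\<bar>)
        \<le> 2 * (saddle N * \<bar>real_of_int (m N)\<bar>)"
      using N' eventually_gt_at_top[of 0]
    proof eventually_elim
      case (elim N)
      have "sqrt (6 * real N) \<le> sqrt (4 * (6 * real (N' N)))" using elim
        by (intro real_sqrt_le_mono) simp
      then have "sqrt (6 * real N) \<le> 2 * sqrt (6 * real (N' N))"
        by (simp only: real_sqrt_mult[of 4]) simp
      then have "saddle (N' N) \<le> 2 * saddle N"
        unfolding saddle_def using elim by (simp add: field_simps)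
      moreover have "0 \<le> saddle (N' N)" by (simp add: saddle_def)
      ultimately show ?case by (simp add: abs_mult mult_right_mono flip: mult.assoc)
    qed
  qed
  moreover have "isCont F_conc 0"
    unfolding F_conc_def by (intro continuous_intros) (simp add: add_pos_pos)
  ultimately have "(\<lambda>N. F_conc (saddle (N' N) * \<bar>real_of_int (m N)\<bar>)) \<longlonglongrightarrow> F_conc 0"
    by (rule isCont_tendsto_compose[rotated])
  then show ?thesis by (simp add: F_conc_def)
qed

lemma Vd_rank_asymp_equiv_shifted:
  fixes m :: "nat \<Rightarrow> int"
  defines "N' \<equiv> \<lambda>N. N - triangle (nat \<bar>m N\<bar>)"
  assumes le: "\<forall>\<^sub>F N in sequentially. 2 * triangle (nat \<bar>m N\<bar>) \<le> N"
  shows "(\<lambda>N. real (Vd_rank (m N) N)) \<sim>[sequentially]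
    (\<lambda>N. partition_count (N' N) * F_conc (saddle (N' N) * \<bar>real_of_int (m N)\<bar>))"
proof (rule asymp_equivI')
  let ?main = "\<lambda>N. partition_count (N' N) * F_conc (saddle (N' N) * \<bar>real_of_int (m N)\<bar>)"
  have N'_at_top: "filterlim N' at_top sequentially"
  proof (rule filterlim_at_top_mono)
    show "filterlim (\<lambda>N::nat. N div 2) at_top sequentially"
      by (rule filterlim_at_top_div_const_nat) simp
    show "\<forall>\<^sub>F N in sequentially. N div 2 \<le> N' N" using le by eventually_elim (simp add: N'_def)
  qed
  obtain C where C: "\<forall>\<^sub>F N in sequentially. \<forall>l.
      \<bar>Vd_rank l (N + triangle (nat \<bar>l\<bar>))
        / (partition_count N * F_conc (saddle N * \<bar>real_of_int l\<bar>)) - 1\<bar>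
        \<le> C * real N powr (- 1 / 10)"
    using Vd_rank_relative_error .
  have "(\<lambda>N. Vd_rank (m N) N / ?main N - 1) \<longlonglongrightarrow> 0"
  proof (rule Lim_null_comparison)
    have "(\<lambda>N::nat. C * real N powr (- 1 / 10)) \<longlonglongrightarrow> 0" by real_asymp
    then show "(\<lambda>N. C * real (N' N) powr (- 1 / 10)) \<longlonglongrightarrow> 0"
      by (rule filterlim_compose[OF _ N'_at_top])
    show "\<forall>\<^sub>F N in sequentially. norm (Vd_rank (m N) N / ?main N - 1)
        \<le> C * real (N' N) powr (- 1 / 10)"
      using eventually_compose_filterlim[OF C N'_at_top] le
    proof eventually_elim
      case (elim N)
      have "N' N + triangle (nat \<bar>m N\<bar>) = N" using elim(2) by (simp add: N'_def)
      then show ?case using elim(1)[rule_format, of "m N"] by simp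
    qed
  qed
  then show "(\<lambda>N. Vd_rank (m N) N / ?main N) \<longlonglongrightarrow> 1" by (simp add: LIM_zero_iff)
qed

theorem Vd_rank_asymp_equiv:
  fixes m :: "nat \<Rightarrow> int"
  assumes m: "(\<lambda>N. real_of_int (m N)) \<in> o(\<lambda>N. real N powr (3 / 8))"
  shows "(\<lambda>N. Vd_rank (m N) N / partition_count N) \<sim>[sequentially] (\<lambda>N. 2 / 3 * rank_gauss N (m N))"
proof -
  define x N' where "x N = triangle (nat \<bar>m N\<bar>)" and "N' N = N - x N" for N
  define F where "F N = F_conc (saddle (N' N) * \<bar>real_of_int (m N)\<bar>)" for N
  have x_smallo: "(\<lambda>N. real (x N)) \<in> o(\<lambda>N. real N powr (3 / 4))"
    unfolding x_def by (rule triangle_smallo[OF m])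
  have x_le: "\<forall>\<^sub>F N in sequentially. 2 * x N \<le> N"
    by (rule partition_ratio_asymp_equiv(1)[OF x_smallo])
  then have "(\<lambda>N. real (Vd_rank (m N) N)) \<sim>[sequentially] (\<lambda>N. partition_count (N' N) * F N)"
    unfolding F_def N'_def x_def by (rule Vd_rank_asymp_equiv_shifted)
  then have "(\<lambda>N. Vd_rank (m N) N / partition_count N)
      \<sim>[sequentially] (\<lambda>N. partition_count (N' N) * F N / partition_count N)"
    by (intro asymp_equiv_divide asymp_equiv_refl)
  moreover have "\<forall>\<^sub>F N in sequentially. partition_count (N' N) * F N / partition_count N
      = F N * partition_ratio N (x N)"
    using x_le by eventually_elim (simp add: partition_ratio_def partition_count_minus_def N'_def)
  ultimately have "(\<lambda>N. Vd_rank (m N) N / partition_count N)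
      \<sim>[sequentially] (\<lambda>N. F N * partition_ratio N (x N))"
    by (rule asymp_equiv_transfer_trans)
  also have "(\<lambda>N. F N * partition_ratio N (x N)) \<sim>[sequentially] (\<lambda>N. 2 / 3 * rank_gauss N (m N))"
  proof (rule asymp_equiv_mult)
    have "\<forall>\<^sub>F N in sequentially. N \<le> 2 * N' N" using x_le by eventually_elim (simp add: N'_def)
    then show "F \<sim>[sequentially] (\<lambda>N. 2 / 3)"
      unfolding F_def[abs_def] by (intro tendsto_imp_asymp_equiv_const F_conc_tendsto m) simp_all
    show "(\<lambda>N. partition_ratio N (x N)) \<sim>[sequentially] (\<lambda>N. rank_gauss N (m N))"
      using partition_ratio_asymp_equiv(2)[OF x_smallo] exp_saddle_triangle_asymp_equiv[OF m]
      unfolding x_def by (rule asymp_equiv_trans)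
  qed
  finally show ?thesis .
qed

section \<open>Summation over the rank\<close>

lemma eventually_ball_if_selections:
  assumes "\<And>x. S x \<noteq> {}" "\<And>m. (\<And>x. m x \<in> S x) \<Longrightarrow> \<forall>\<^sub>F x in F. P x (m x)"
  shows "\<forall>\<^sub>F x in F. \<forall>y\<in>S x. P x y"
proof -
  define m where "m x = (SOME y. y \<in> S x \<and> ((\<exists>y\<in>S x. \<not> P x y) \<longrightarrow> \<not> P x y))" for x
  have m: "m x \<in> S x \<and> ((\<exists>y\<in>S x. \<not> P x y) \<longrightarrow> \<not> P x (m x))" for x
    unfolding m_def by (rule someI_ex) (use assms(1)[of x] in blast)
  have "\<forall>\<^sub>F x in F. P x (m x)" by (rule assms(2)) (rule m[THEN conjunct1])
  moreover have "\<forall>y\<in>S x. P x y" if "P x (m x)" for x using m[of x] that by blast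
  ultimately show ?thesis by (rule eventually_mono)
qed

lemma sum_asymp_equivI:
  fixes f g :: "'a \<Rightarrow> 'b \<Rightarrow> real"
  assumes nonneg: "\<And>x y. 0 \<le> g x y"
    and uniform: "\<And>e. 0 < e \<Longrightarrow> \<forall>\<^sub>F x in F. \<forall>y\<in>S x. \<bar>f x y - g x y\<bar> \<le> e * g x y"
  shows "(\<lambda>x. \<Sum>y\<in>S x. f x y) \<sim>[F] (\<lambda>x. \<Sum>y\<in>S x. g x y)"
  unfolding asymp_equiv_altdef
proof (rule landau_o.smallI)
  fix e :: real assume "0 < e"
  from uniform[OF this] show "\<forall>\<^sub>F x in F. norm ((\<Sum>y\<in>S x. f x y) - (\<Sum>y\<in>S x. g x y))
      \<le> e * norm (\<Sum>y\<in>S x. g x y)"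
  proof eventually_elim
    case (elim x)
    have "\<bar>\<Sum>y\<in>S x. f x y - g x y\<bar> \<le> (\<Sum>y\<in>S x. e * g x y)"
      using elim by (intro order_trans[OF sum_abs] sum_mono) auto
    then show ?case
      using sum_nonneg[of "S x" "g x"] nonneg by (simp add: sum_subtractf sum_distrib_left)
  qed
qed

definition central_ranks :: "nat \<Rightarrow> int set" where
  "central_ranks N = {- int (nat \<lfloor>real N powr (3 / 10)\<rfloor>)..int (nat \<lfloor>real N powr (3 / 10)\<rfloor>)}"

lemma abs_le_if_central_rank:
  assumes "m \<in> central_ranks N"
  shows "\<bar>real_of_int m\<bar> \<le> real N powr (3 / 10)"
proof -
  have "\<bar>real_of_int m\<bar> \<le> real (nat \<lfloor>real N powr (3 / 10)\<rfloor>)"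
    using assms by (auto simp: central_ranks_def)
  also have "\<dots> \<le> real N powr (3 / 10)" by simp
  finally show ?thesis .
qed

lemma less_abs_if_not_central_rank:
  assumes "m \<notin> central_ranks N"
  shows "real N powr (3 / 10) < \<bar>real_of_int m\<bar>"
proof -
  have "int (nat \<lfloor>real N powr (3 / 10)\<rfloor>) < \<bar>m\<bar>"
    using assms by (auto simp: central_ranks_def)
  then show ?thesis by (simp add: floor_less_iff)
qed

lemma central_Vd_rank_sum_asymp_equiv:
  "(\<lambda>N. \<Sum>m\<in>central_ranks N. Vd_rank m N / partition_count N) \<sim>[sequentially]
    (\<lambda>N. \<Sum>m\<in>central_ranks N. 2 / 3 * rank_gauss N m)"
proof (intro sum_asymp_equivI eventually_ball_if_selections)
  show "central_ranks N \<noteq> {}" for N by (simp add: central_ranks_def)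
  show "0 \<le> 2 / 3 * rank_gauss N m" for N m using rank_gauss_pos[of N m] by simp
  fix e :: real and m :: "nat \<Rightarrow> int"
  assume "0 < e" and m: "\<And>N. m N \<in> central_ranks N"
  have "(\<lambda>N. real_of_int (m N)) \<in> O(\<lambda>N. real N powr (3 / 10))"
    using abs_le_if_central_rank[OF m] by (intro bigoI[of _ 1] always_eventually) simp
  also have "(\<lambda>N :: nat. real N powr (3 / 10)) \<in> o(\<lambda>N. real N powr (3 / 8))" by real_asymp
  finally have "(\<lambda>N. Vd_rank (m N) N / partition_count N)
      \<sim>[sequentially] (\<lambda>N. 2 / 3 * rank_gauss N (m N))"
    by (rule Vd_rank_asymp_equiv)
  then have "\<forall>\<^sub>F N in sequentially. norm (Vd_rank (m N) N / partition_count N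
      - 2 / 3 * rank_gauss N (m N))
      \<le> e * norm (2 / 3 * rank_gauss N (m N))"
    unfolding asymp_equiv_altdef using \<open>0 < e\<close> by (rule landau_o.smallD)
  then show "\<forall>\<^sub>F N in sequentially. \<bar>Vd_rank (m N) N / partition_count N
      - 2 / 3 * rank_gauss N (m N)\<bar>
      \<le> e * (2 / 3 * rank_gauss N (m N))"
    using rank_gauss_pos by (simp add: abs_mult less_imp_le)
qed

lemma sum_symmetric_int:
  fixes g :: "nat \<Rightarrow> 'a::comm_ring_1"
  shows "(\<Sum>m=-int M..int M. g (nat \<bar>m\<bar>)) = 2 * (\<Sum>k\<le>M. g k) - g 0"
proof (induction M)
  case (Suc M)
  have "{-int (Suc M)..int (Suc M)} = insert (int (Suc M)) (insert (- int (Suc M)) {-int M..int M})"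
    by auto
  then show ?case using Suc by (simp add: nat_add_distrib algebra_simps)
qed simp

lemma gaussian_sum_minus_integral:
  fixes b :: real
  assumes "0 < b"
  shows "\<bar>(\<Sum>m=-int M..int M. exp (- b * (real_of_int m)\<^sup>2))
      - 2 * integral {0..real M} (\<lambda>x. exp (- b * x\<^sup>2))\<bar> \<le> 1"
proof -
  define f where "f x = exp (- b * x\<^sup>2)" for x :: real
  interpret antimono_fun_sum_integral_diff f
  proof
    show "f y \<le> f x" if "0 \<le> x" "x \<le> y" for x y
      using that assms by (simp add: f_def power_mono)
  qed (auto simp: f_def intro!: continuous_intros)
  have "0 \<le> (\<Sum>k\<le>M. f (real k)) - integral {0..real M} f"
      "(\<Sum>k\<le>M. f (real k)) - integral {0..real M} f \<le> 1"
    using sum_integral_diff_series_nonneg[of M] sum_integral_diff_series_antimono[of 0 M]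
    by (simp_all add: sum_integral_diff_series_def f_def)
  moreover have "(\<Sum>m=-int M..int M. exp (- b * (real_of_int m)\<^sup>2)) = 2 * (\<Sum>k\<le>M. f (real k)) - 1"
    using sum_symmetric_int[of "\<lambda>k. f (real k)" M] by (simp add: f_def)
  ultimately show ?thesis unfolding f_def[abs_def] by linarith
qed

lemma gaussian_integral_approx:
  fixes b :: real
  assumes b: "0 < b" and M: "0 \<le> M"
  shows "\<bar>2 * integral {0..M} (\<lambda>x. exp (- b * x\<^sup>2)) - sqrt (pi / b)\<bar>
      \<le> exp (- b * M\<^sup>2 / 2) * sqrt (2 * pi / b)"
proof -
  define f where "f x = exp (- b * x\<^sup>2)" for x :: real
  define I where "I = integral {0..M} f"
  have "continuous_on {0..M} f" unfolding f_def by (intro continuous_intros)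
  then have right: "(f has_integral I) {0..M}"
    unfolding I_def using integrable_continuous_real integrable_integral by blast
  then have "((\<lambda>x. f (- x)) has_integral I) {- M..- 0}"
    by (subst has_integral_reflect_real)
  then have "(f has_integral I) {- M..0}" by (simp add: f_def[abs_def])
  then have "(f has_integral (I + I)) {- M..M}"
    using right M by (intro has_integral_combine[of "- M" 0 M]) auto
  then have truncated: "((\<lambda>x. if x \<in> {- M..M} then f x else 0) has_integral (I + I)) UNIV"
    by (subst has_integral_restrict_UNIV)
  have full: "(f has_integral sqrt (pi / b)) UNIV"
    using has_integral_gaussian[OF b] by (simp add: f_def[abs_def])
  have majorant: "((\<lambda>x. exp (- b * M\<^sup>2 / 2) * exp (- (b / 2) * x\<^sup>2))
      has_integral (exp (- b * M\<^sup>2 / 2) * sqrt (pi / (b / 2)))) UNIV"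
    using b by (intro has_integral_mult_right has_integral_gaussian) simp
  have "I + I \<le> sqrt (pi / b)"
    by (rule has_integral_le[OF truncated full]) (simp add: f_def)
  moreover have "sqrt (pi / b) - (I + I) \<le> exp (- b * M\<^sup>2 / 2) * sqrt (pi / (b / 2))"
  proof (rule has_integral_le[OF has_integral_diff[OF full truncated] majorant])
    show "f x - (if x \<in> {- M..M} then f x else 0) \<le> exp (- b * M\<^sup>2 / 2) * exp (- (b / 2) * x\<^sup>2)" for x
    proof (cases "x \<in> {- M..M}")
      case False
      then have "\<bar>M\<bar> \<le> \<bar>x\<bar>" using M by auto
      then have "M\<^sup>2 \<le> x\<^sup>2" by (simp only: abs_le_square_iff)
      then have "b * M\<^sup>2 \<le> b * x\<^sup>2" using b by (intro mult_left_mono) auto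
      then show ?thesis using False by (simp add: f_def flip: exp_add)
    qed simp
  qed
  ultimately show ?thesis unfolding I_def f_def[abs_def] by (simp add: mult.commute)
qed

lemma central_rank_gauss_sum_asymp_equiv:
  "(\<lambda>N. \<Sum>m\<in>central_ranks N. rank_gauss N m) \<sim>[sequentially] (\<lambda>N. (24 * real N) powr (1 / 4))"
proof (rule smallo_imp_asymp_equiv, rule landau_o.big_small_trans)
  define M where "M N = real (nat \<lfloor>real N powr (3 / 10)\<rfloor>)" for N
  define b where "b N = pi / sqrt (24 * real N)" for N :: nat
  show "(\<lambda>N. (\<Sum>m\<in>central_ranks N. rank_gauss N m) - (24 * real N) powr (1 / 4))
      \<in> O(\<lambda>N. 1 + exp (- b N * (M N)\<^sup>2 / 2) * sqrt (2 * pi / b N))"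
  proof (rule bigoI[of _ 1])
    show "\<forall>\<^sub>F N in sequentially. norm ((\<Sum>m\<in>central_ranks N. rank_gauss N m)
        - (24 * real N) powr (1 / 4))
        \<le> 1 * norm (1 + exp (- b N * (M N)\<^sup>2 / 2) * sqrt (2 * pi / b N))"
      using eventually_gt_at_top[of 0]
    proof eventually_elim
      case (elim N)
      then have b_pos: "0 < b N" by (simp add: b_def)
      have "(\<Sum>m\<in>central_ranks N. rank_gauss N m)
          = (\<Sum>m=-int (nat \<lfloor>real N powr (3 / 10)\<rfloor>)..int (nat \<lfloor>real N powr (3 / 10)\<rfloor>). exp (- b N
            * (real_of_int m)\<^sup>2))"
        unfolding central_ranks_def rank_gauss_def b_def by simp
      moreover have "(24 * real N) powr (1 / 4) = sqrt (pi / b N)"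
        using elim by (simp add: b_def powr_powr flip: powr_half_sqrt)
      ultimately have "\<bar>(\<Sum>m\<in>central_ranks N. rank_gauss N m) - (24 * real N) powr (1 / 4)\<bar>
          \<le> 1 + exp (- b N * (M N)\<^sup>2 / 2) * sqrt (2 * pi / b N)"
        using gaussian_sum_minus_integral[OF b_pos, of "nat \<lfloor>real N powr (3 / 10)\<rfloor>"]
          gaussian_integral_approx[OF b_pos, of "M N"] unfolding M_def by linarith
      then show ?case by simp
    qed
  qed
  show "(\<lambda>N. 1 + exp (- b N * (M N)\<^sup>2 / 2) * sqrt (2 * pi / b N))
      \<in> o(\<lambda>N. (24 * real N) powr (1 / 4))"
    unfolding M_def b_def by real_asymp
qed

lemma Vd_rank_tail_smallo:
  "(\<lambda>N. \<Sum>m\<in>{-int N..int N} - central_ranks N. Vd_rank m N / partition_count N)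
     \<in> o(\<lambda>N. (24 * real N) powr (1 / 4))"
proof -
  obtain C where C_pos: "0 < C" and ratio_le: "\<And>N x. 0 < N \<Longrightarrow> real N powr (11 / 20) \<le> real x \<Longrightarrow>
      partition_ratio N x \<le> C * N * exp (- (real N powr (1 / 20)))"
    using partition_ratio_le_of_large by blast
  have "\<forall>\<^sub>F N :: nat in sequentially. real N powr (11 / 20) \<le> (real N powr (3 / 10))\<^sup>2 / 2"
    by real_asymp
  then have "\<forall>\<^sub>F N in sequentially. norm (\<Sum>m\<in>{-int N..int N}
      - central_ranks N. Vd_rank m N / partition_count N)
      \<le> 1 * norm ((2 * real N + 1) * (C * N * exp (- (real N powr (1 / 20)))))"
    using eventually_gt_at_top[of 0]
  proof eventually_elim
    case (elim N)
    define B where "B = C * N * exp (- (real N powr (1 / 20)))"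
    have B_nonneg: "0 \<le> B" using C_pos by (simp add: B_def)
    have term_le: "Vd_rank m N / partition_count N \<le> B" if "m \<notin> central_ranks N" for m
    proof -
      have "(real N powr (3 / 10))\<^sup>2 \<le> \<bar>real_of_int m\<bar>\<^sup>2"
        using less_abs_if_not_central_rank[OF that] by (intro power_mono) auto
      then have "real N powr (11 / 20) \<le> real (triangle (nat \<bar>m\<bar>))"
        using elim by (simp add: real_triangle)
      then have "partition_ratio N (triangle (nat \<bar>m\<bar>)) \<le> B"
        unfolding B_def using elim by (intro ratio_le)
      moreover have "Vd_rank m N / partition_count N \<le> partition_ratio N (triangle (nat \<bar>m\<bar>))"
        unfolding partition_ratio_def by (intro divide_right_mono) (simp_all add: Vd_rank_le)
      ultimately show ?thesis by linarith
    qed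
    have "(\<Sum>m\<in>{-int N..int N} - central_ranks N. Vd_rank m N / partition_count N)
        \<le> (\<Sum>m\<in>{-int N..int N} - central_ranks N. B)"
      by (intro sum_mono term_le) auto
    also have "\<dots> \<le> (\<Sum>m\<in>{-int N..int N}. B)" using B_nonneg by (intro sum_mono2) auto
    also have "\<dots> = (2 * real N + 1) * B" by (simp add: nat_add_distrib)
    finally show ?case using C_pos by (simp add: B_def sum_nonneg)
  qed
  then have "(\<lambda>N. \<Sum>m\<in>{-int N..int N} - central_ranks N. Vd_rank m N / partition_count N)
      \<in> O(\<lambda>N. (2 * real N + 1) * (C * N * exp (- (real N powr (1 / 20)))))"
    by (rule bigoI)
  also have "(\<lambda>N. (2 * real N + 1) * (C * N * exp (- (real N powr (1 / 20)))))
      \<in> o(\<lambda>N. (24 * real N) powr (1 / 4))"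
    by real_asymp
  finally show ?thesis .
qed

theorem Vd_asymp_equiv:
  "(\<lambda>N. Vd N / partition_count N) \<sim>[sequentially] (\<lambda>N. 2 / 3 * (24 * real N) powr (1 / 4))"
proof -
  have "(\<lambda>N. \<Sum>m\<in>central_ranks N. Vd_rank m N / partition_count N) \<sim>[sequentially]
      (\<lambda>N. 2 / 3 * (\<Sum>m\<in>central_ranks N. rank_gauss N m))"
    unfolding sum_distrib_left by (rule central_Vd_rank_sum_asymp_equiv)
  also have "\<dots> \<sim>[sequentially] (\<lambda>N. 2 / 3 * (24 * real N) powr (1 / 4))"
    by (intro asymp_equiv_mult asymp_equiv_refl central_rank_gauss_sum_asymp_equiv)
  finally have "(\<lambda>N. (\<Sum>m\<in>central_ranks N. Vd_rank m N / partition_count N)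
      + (\<Sum>m\<in>{-int N..int N} - central_ranks N. Vd_rank m N / partition_count N))
    \<sim>[sequentially] (\<lambda>N. 2 / 3 * (24 * real N) powr (1 / 4))"
    using Vd_rank_tail_smallo by (subst asymp_equiv_add_right) simp_all
  moreover have "\<forall>\<^sub>F N in sequentially. (\<Sum>m\<in>central_ranks N. Vd_rank m N / partition_count N)
      + (\<Sum>m\<in>{-int N..int N} - central_ranks N. Vd_rank m N / partition_count N)
      = Vd N / partition_count N"
  proof -
    have "\<forall>\<^sub>F N :: nat in sequentially. nat \<lfloor>real N powr (3 / 10)\<rfloor> \<le> N" by real_asymp
    then show ?thesis
    proof eventually_elim
      case (elim N)
      then have "central_ranks N \<subseteq> {-int N..int N}" by (auto simp: central_ranks_def)
      then have "(\<Sum>m\<in>{-int N..int N}. Vd_rank m N / partition_count N)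
          = (\<Sum>m\<in>{-int N..int N} - central_ranks N. Vd_rank m N / partition_count N)
            + (\<Sum>m\<in>central_ranks N. Vd_rank m N / partition_count N)"
        by (intro sum.subset_diff) auto
      then show ?case by (simp add: Vd_eq_sum sum_divide_distrib)
    qed
  qed
  ultimately show ?thesis by (rule asymp_equiv_transfer_trans)
qed

theorem theorem1:
  shows "(\<exists>C N0. \<forall>N::nat. N \<ge> N0 \<longrightarrow> (\<forall>l::int.
            \<bar>real (Vd_rank l (N + nat \<bar>l\<bar> * (nat \<bar>l\<bar> + 1) div 2))
              / (real (partition_count N) * F_conc (pi * \<bar>real_of_int l\<bar> / sqrt (6 * real N))) - 1\<bar>
            \<le> C * real N powr (-1/10)))
       \<and> (\<forall>m :: nat \<Rightarrow> int.
            (\<lambda>N. real_of_int (m N)) \<in> o(\<lambda>N. real N powr (3/8)) \<longrightarrow>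
            (\<lambda>N. real (Vd_rank (m N) N) / real (Vd N)) \<sim>[at_top]
            (\<lambda>N. 1 / (24 * real N) powr (1/4)
              * exp (- pi * (real_of_int (m N))\<^sup>2 / sqrt (24 * real N))))"
proof (intro conjI allI impI)
  obtain C where "\<forall>\<^sub>F N in sequentially. \<forall>l.
     \<bar>Vd_rank l (N + triangle (nat \<bar>l\<bar>)) / (partition_count N * F_conc (saddle N * \<bar>real_of_int l\<bar>))
       - 1\<bar>
       \<le> C * real N powr (- 1 / 10)"
    using Vd_rank_relative_error .
  then show "\<exists>C N0. \<forall>N::nat. N \<ge> N0 \<longrightarrow> (\<forall>l::int.
            \<bar>real (Vd_rank l (N + nat \<bar>l\<bar> * (nat \<bar>l\<bar> + 1) div 2))
              / (real (partition_count N) * F_conc (pi * \<bar>real_of_int l\<bar> / sqrt (6 * real N))) - 1\<bar>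
            \<le> C * real N powr (-1/10))"
    by (simp add: eventually_sequentially triangle_def saddle_def) blast
next
  fix m :: "nat \<Rightarrow> int"
  assume "(\<lambda>N. real_of_int (m N)) \<in> o(\<lambda>N. real N powr (3/8))"
  then have "(\<lambda>N. (Vd_rank (m N) N / partition_count N)
      / (Vd N / partition_count N)) \<sim>[sequentially]
      (\<lambda>N. (2 / 3 * rank_gauss N (m N)) / (2 / 3 * (24 * real N) powr (1 / 4)))"
    by (intro asymp_equiv_divide Vd_rank_asymp_equiv Vd_asymp_equiv)
  then show "(\<lambda>N. real (Vd_rank (m N) N) / real (Vd N)) \<sim>[at_top]
      (\<lambda>N. 1 / (24 * real N) powr (1/4) * exp (- pi * (real_of_int (m N))\<^sup>2 / sqrt (24 * real N)))"
    using partition_count_pos by (simp add: rank_gauss_def)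
qed

end
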